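(* Let $K$ be a compact metrisable space, let $X$ be any Motakis realisation over $K$, and let $n\geqslant1$. Then $$\operatorname{ltsr}\mathcal B(X^n)=\operatorname{rtsr}\mathcal B(X^n)=\begin{cases}\left\lceil\dfrac{\lfloor\dim K/2\rfloor}{n}\right\rceil+1,&\dim K<\infty,\\[2mm]\infty,&\dim K=\infty.\end{cases}$$ In particular, $$\operatorname{ltsr}\mathcal B(X)=\operatorname{rtsr}\mathcal B(X)=\operatorname{tsr}C(K),$$ and $\mathcal B(X)$ has stable rank one if and only if $\dim K\leqslant1$.
   Context: All Banach spaces and algebras are complex. $\mathcal B(Y)$ is the Banach algebra of bounded operators on a Banach space $Y$, $\mathcal K(Y)$ the ideal of compact operators, $\mathcal Q(Y)=\mathcal B(Y)/\mathcal K(Y)$ the Calkin algebra, and $\mathfrak q_Y:\mathcal B(Y)\to\mathcal Q(Y)$ the quotient map. $X^n$ is the direct sum of $n$ copies of $X$ with any standard product norm. $\dim$ denotes covering dimension. For a complex unital Banach algebra $A$ and $m\in\mathbb N$ put $\operatorname{Lg}_m(A)=\{(a_1,\dots,a_m)\in A^m: Aa_1+\cdots+Aa_m=A\}$ and $\operatorname{Rg}_m(A)=\{(a_1,\dots,a_m)\in A^m: a_1A+\cdots+a_mA=A\}$. The left topological stable rank $\operatorname{ltsr}(A)$ (resp. right topological stable rank $\operatorname{rtsr}(A)$) is the least $m\ge1$ for which $\operatorname{Lg}_m(A)$ (resp. $\operatorname{Rg}_m(A)$) is dense in $A^m$, and is $\infty$ if no such $m$ exists. For a unital $C^*$-algebra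 the two ranks coincide and their common value is denoted $\operatorname{tsr}$. "$\mathcal B(X)$ has stable rank one" means $\operatorname{ltsr}\mathcal B(X)=\operatorname{rtsr}\mathcal B(X)=1$. Let $K$ be a non-empty compact metrisable space. A Motakis realisation over $K$ is a complex Banach space $X$ (a $\mathcal L_\infty$-space, produced by Motakis' Argyros–Haydon-type Bourgain–Delbaen construction) which comes with a metric $\rho$ on $K$ compatible with its topology, a countable index set $\Gamma$, listed in a fixed order, a Schauder basis $(d_\gamma)_{\gamma\in\Gamma}$ of $X$, a map $\kappa:\Gamma\to K$, and a unital Banach-algebra isomorphism (bounded, with bounded inverse) $\Psi:C(K)\to\mathcal Q(X)$, such that: (1) every $T\in\mathcal B(X)$ can be written $T=D+K_0$ with $K_0\in\mathcal K(X)$ and $D\in\mathcal B(X)$ diagonal with respect to $(d_\gamma)$, i.e. $Dd_\gamma=\lambda_\gamma d_\gamma$ for scalars $\lambda_\gamma$; (2) after an equivalent renorming of $X$, $\Psi$ is isometric; (3) for every complex-valued Lipschitz function $f$ on $(K,\rho)$, the prescription $\widehat f(d_\gamma)=f(\kappa(\gamma))d_\gamma$ $(\gamma\in\Gamma)$ defines an operator $\widehat f\in\mathcal B(X)$, the map $f\mapsto\widehat f$ is a unital algebra homomorphism from $\operatorname{Lip}(K,\rho)$ to $\mathcal B(X)$, and $\mathfrak q_X(\widehat f)=\Psi(f)$. *)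

theory Defs
  imports
    "HOL-Analysis.Analysis"
    "HOL-Algebra.QuotRing"
begin

section \<open>Complex Banach spaces\<close>

class complex_normed_vector = real_normed_vector +
  fixes scaleC :: "complex \<Rightarrow> 'a \<Rightarrow> 'a"  (infixr \<open>*\<^sub>C\<close> 75)
  assumes scaleC_add_right: "c *\<^sub>C (x + y) = c *\<^sub>C x + c *\<^sub>C y"
    and scaleC_add_left: "(b + c) *\<^sub>C x = b *\<^sub>C x + c *\<^sub>C x"
    and scaleC_scaleC: "b *\<^sub>C c *\<^sub>C x = (b * c) *\<^sub>C x"
    and scaleC_of_real: "of_real r *\<^sub>C x = r *\<^sub>R x"
    and norm_scaleC: "norm (c *\<^sub>C x) = cmod c * norm x"

class complex_banach = complex_normed_vector + banach

lemma scaleC_one: "1 *\<^sub>C x = (x :: 'a::complex_normed_vector)"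
  using scaleC_of_real[of 1 x] by simp

interpretation cvec: vector_space "scaleC :: complex \<Rightarrow> 'a \<Rightarrow> 'a::complex_normed_vector"
  by unfold_locales (simp_all add: scaleC_add_right scaleC_add_left scaleC_scaleC scaleC_one)

lemma bounded_linear_scaleC: "bounded_linear (scaleC c :: 'a \<Rightarrow> 'a::complex_normed_vector)"
proof (rule bounded_linear_intro[where K = "cmod c"])
  fix r :: real and x :: 'a
  show "c *\<^sub>C r *\<^sub>R x = r *\<^sub>R c *\<^sub>C x"
    by (simp add: scaleC_of_real[symmetric] scaleC_scaleC mult.commute)
qed (simp_all add: scaleC_add_right norm_scaleC mult.commute)

text \<open>The type \<open>'a ^ 'n\<close>, with its Euclidean (\<open>\<ell>\<^sup>2\<close>) product norm, plays the role of \<open>X\<^sup>n\<close> for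
  \<open>n = CARD('n)\<close>.\<close>

instantiation vec :: (complex_normed_vector, finite) complex_normed_vector
begin

definition scaleC_vec :: "complex \<Rightarrow> 'a ^ 'b \<Rightarrow> 'a ^ 'b"
  where "c *\<^sub>C x = (\<chi> i. c *\<^sub>C (x $ i))"

instance
proof
  fix b c :: complex and r :: real and x y :: "'a ^ 'b"
  show "c *\<^sub>C (x + y) = c *\<^sub>C x + c *\<^sub>C y"
    by (simp add: scaleC_vec_def vec_eq_iff scaleC_add_right)
  show "(b + c) *\<^sub>C x = b *\<^sub>C x + c *\<^sub>C x"
    by (simp add: scaleC_vec_def vec_eq_iff scaleC_add_left)
  show "b *\<^sub>C c *\<^sub>C x = (b * c) *\<^sub>C x"
    by (simp add: scaleC_vec_def vec_eq_iff scaleC_scaleC)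
  show "of_real r *\<^sub>C x = r *\<^sub>R x"
    by (simp add: scaleC_vec_def vec_eq_iff scaleC_of_real)
  show "norm (c *\<^sub>C x) = cmod c * norm x"
    by (simp add: scaleC_vec_def norm_vec_def norm_scaleC L2_set_right_distrib)
qed

end

instance vec :: (complex_banach, finite) complex_banach ..

text \<open>The supremum norm on \<open>\<complex>\<^sup>N\<close>, a vector being given by the values of \<open>c\<close> at \<open>0, \<dots>, N - 1\<close>.\<close>

definition linf_norm :: "nat \<Rightarrow> (nat \<Rightarrow> complex) \<Rightarrow> real"
  where "linf_norm N c = Max (insert 0 ((\<lambda>i. cmod (c i)) ` {..<N}))"

text \<open>Every finite-dimensional subspace \<open>F\<close> lies in a finite-dimensional subspace \<open>G\<close> that is
  \<open>C\<close>-isomorphic to \<open>\<ell>\<^sub>\<infinity>\<^sup>N\<close>, \<open>N = dim G\<close>. The isomorphism is given by the images \<open>g 0, \<dots>, g (N - 1)\<close>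
  of the unit vectors and is scaled so that its inverse has norm at most 1.\<close>

definition script_Linf_space :: "'a::complex_normed_vector itself \<Rightarrow> bool"
  where "script_Linf_space _ \<longleftrightarrow>
    (\<exists>C. \<forall>S :: 'a set. finite S \<longrightarrow>
      (\<exists>N g. cvec.span S \<subseteq> cvec.span (g ` {..<N}) \<and>
        (\<forall>c. linf_norm N c \<le> norm (\<Sum>i<N. c i *\<^sub>C g i) \<and>
             norm (\<Sum>i<N. c i *\<^sub>C g i) \<le> C * linf_norm N c)))"

definition schauder_basis :: "(nat \<Rightarrow> 'a::complex_normed_vector) \<Rightarrow> bool"
  where "schauder_basis b \<longleftrightarrow> (\<forall>x. \<exists>!a. (\<lambda>n. a n *\<^sub>C b n) sums x)"

definition equivalent_norm :: "('a::complex_normed_vector \<Rightarrow> real) \<Rightarrow> bool"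
  where "equivalent_norm N \<longleftrightarrow>
    (\<forall>x y. N (x + y) \<le> N x + N y) \<and> (\<forall>c x. N (c *\<^sub>C x) = cmod c * N x) \<and>
    (\<exists>a>0. \<exists>b. \<forall>x. a * norm x \<le> N x \<and> N x \<le> b * norm x)"


section \<open>Complex normed algebras and topological stable rank\<close>

record 'b normed_algebra = "'b ring" +
  scal :: "complex \<Rightarrow> 'b \<Rightarrow> 'b"
  nrm :: "'b \<Rightarrow> real"

definition algebra_hom ::
    "('b, 'm) normed_algebra_scheme \<Rightarrow> ('c, 'k) normed_algebra_scheme \<Rightarrow> ('b \<Rightarrow> 'c) set"
  where "algebra_hom A B =
    {h \<in> ring_hom A B. \<forall>c. \<forall>a\<in>carrier A. h (scal A c a) = scal B c (h a)}"

definition banach_algebra_iso ::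
    "('b, 'm) normed_algebra_scheme \<Rightarrow> ('c, 'k) normed_algebra_scheme \<Rightarrow> ('b \<Rightarrow> 'c) set"
  where "banach_algebra_iso A B =
    {h \<in> algebra_hom A B. bij_betw h (carrier A) (carrier B) \<and>
      (\<exists>M. \<forall>a\<in>carrier A. nrm B (h a) \<le> M * nrm A a) \<and>
      (\<exists>M. \<forall>a\<in>carrier A. nrm A a \<le> M * nrm B (h a))}"

definition Lg :: "('b, 'm) normed_algebra_scheme \<Rightarrow> nat \<Rightarrow> (nat \<Rightarrow> 'b) set"
  where "Lg A m = {a \<in> {..<m} \<rightarrow>\<^sub>E carrier A.
    {\<Oplus>\<^bsub>A\<^esub>i\<in>{..<m}. b i \<otimes>\<^bsub>A\<^esub> a i | b. b \<in> {..<m} \<rightarrow> carrier A} = carrier A}"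

definition Rg :: "('b, 'm) normed_algebra_scheme \<Rightarrow> nat \<Rightarrow> (nat \<Rightarrow> 'b) set"
  where "Rg A m = {a \<in> {..<m} \<rightarrow>\<^sub>E carrier A.
    {\<Oplus>\<^bsub>A\<^esub>i\<in>{..<m}. a i \<otimes>\<^bsub>A\<^esub> b i | b. b \<in> {..<m} \<rightarrow> carrier A} = carrier A}"

definition dense_tuples ::
    "('b, 'm) normed_algebra_scheme \<Rightarrow> nat \<Rightarrow> (nat \<Rightarrow> 'b) set \<Rightarrow> bool"
  where "dense_tuples A m S \<longleftrightarrow>
    (\<forall>a \<in> {..<m} \<rightarrow>\<^sub>E carrier A. \<forall>\<epsilon>>0. \<exists>b\<in>S. \<forall>i<m. nrm A (b i \<ominus>\<^bsub>A\<^esub> a i) < \<epsilon>)"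

text \<open>In \<^typ>\<open>enat\<close> the infimum of the empty set is \<open>\<infinity>\<close>.\<close>

definition ltsr :: "('b, 'm) normed_algebra_scheme \<Rightarrow> enat"
  where "ltsr A = Inf {enat m | m. 1 \<le> m \<and> dense_tuples A m (Lg A m)}"

definition rtsr :: "('b, 'm) normed_algebra_scheme \<Rightarrow> enat"
  where "rtsr A = Inf {enat m | m. 1 \<le> m \<and> dense_tuples A m (Rg A m)}"

text \<open>Meaningful only if the two ranks coincide, as they do for unital C*-algebras.\<close>

definition tsr :: "('b, 'm) normed_algebra_scheme \<Rightarrow> enat"
  where "tsr A = (THE r. ltsr A = r \<and> rtsr A = r)"

definition stable_rank_one :: "('b, 'm) normed_algebra_scheme \<Rightarrow> bool"
  where "stable_rank_one A \<longleftrightarrow> ltsr A = 1 \<and> rtsr A = 1"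


section \<open>Bounded operators and the Calkin algebra\<close>

text \<open>The library type \<^typ>\<open>'a \<Rightarrow>\<^sub>L 'a\<close> consists of the real-linear bounded operators, so
  complex linearity is imposed on the carrier.\<close>

definition bounded_ops :: "'a::complex_normed_vector itself \<Rightarrow> ('a \<Rightarrow>\<^sub>L 'a) normed_algebra"
  where "bounded_ops _ =
    \<lparr>carrier = {T. \<forall>c x. blinfun_apply T (c *\<^sub>C x) = c *\<^sub>C blinfun_apply T x},
     mult = (o\<^sub>L), one = id_blinfun, zero = 0, add = (+),
     scal = (\<lambda>c T. Blinfun (\<lambda>x. c *\<^sub>C blinfun_apply T x)),
     nrm = norm\<rparr>"

definition compact_ops :: "'a::complex_normed_vector itself \<Rightarrow> ('a \<Rightarrow>\<^sub>L 'a) set"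
  where "compact_ops X =
    {T \<in> carrier (bounded_ops X). compact (closure (blinfun_apply T ` cball 0 1))}"

text \<open>Adding the ideal in the scalar multiplication matters only for the scalar 0.\<close>

definition calkin :: "'a::complex_normed_vector itself \<Rightarrow> ('a \<Rightarrow>\<^sub>L 'a) set normed_algebra"
  where "calkin X = ring.extend (bounded_ops X Quot compact_ops X)
    \<lparr>scal = (\<lambda>c Q. compact_ops X <+>\<^bsub>bounded_ops X\<^esub> (scal (bounded_ops X) c ` Q)),
     nrm = (\<lambda>Q. Inf (norm ` Q))\<rparr>"

definition calkin_map :: "'a \<Rightarrow>\<^sub>L 'a \<Rightarrow> ('a::complex_normed_vector \<Rightarrow>\<^sub>L 'a) set"
  where "calkin_map T = compact_ops TYPE('a) +>\<^bsub>bounded_ops TYPE('a)\<^esub> T"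

text \<open>The operator norm and the quotient norm induced by a norm \<open>N\<close> on the underlying space; for
  \<open>N = norm\<close> the former is \<^const>\<open>onorm\<close>.\<close>

definition onorm_wrt :: "('a::complex_normed_vector \<Rightarrow> real) \<Rightarrow> ('a \<Rightarrow>\<^sub>L 'a) \<Rightarrow> real"
  where "onorm_wrt N T = (SUP x. N (blinfun_apply T x) / N x)"

definition calkin_norm_wrt :: "('a::complex_normed_vector \<Rightarrow> real) \<Rightarrow> ('a \<Rightarrow>\<^sub>L 'a) set \<Rightarrow> real"
  where "calkin_norm_wrt N Q = Inf (onorm_wrt N ` Q)"


section \<open>Continuous and Lipschitz functions, covering dimension\<close>

definition cont_algebra :: "'k topology \<Rightarrow> ('k \<Rightarrow> complex) normed_algebra"
  where "cont_algebra K =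
    \<lparr>carrier = {f \<in> extensional (topspace K). continuous_map K euclidean f},
     mult = (\<lambda>f g. \<lambda>x\<in>topspace K. f x * g x), one = (\<lambda>x\<in>topspace K. 1),
     zero = (\<lambda>x\<in>topspace K. 0), add = (\<lambda>f g. \<lambda>x\<in>topspace K. f x + g x),
     scal = (\<lambda>c f. \<lambda>x\<in>topspace K. c * f x),
     nrm = (\<lambda>f. SUP x\<in>topspace K. cmod (f x))\<rparr>"

definition lip_algebra :: "'k metric \<Rightarrow> ('k \<Rightarrow> complex) normed_algebra"
  where "lip_algebra \<rho> = (cont_algebra (mtopology_of \<rho>))
    \<lparr>carrier := {f \<in> carrier (cont_algebra (mtopology_of \<rho>)).
                  Lipschitz_continuous_map \<rho> euclidean_metric f}\<rparr>"

definition covering_dim_le :: "'k topology \<Rightarrow> nat \<Rightarrow> bool"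
  where "covering_dim_le K d \<longleftrightarrow>
    (\<forall>\<U>. finite \<U> \<and> (\<forall>U\<in>\<U>. openin K U) \<and> \<Union>\<U> = topspace K \<longrightarrow>
      (\<exists>\<V>. finite \<V> \<and> (\<forall>V\<in>\<V>. openin K V) \<and> \<Union>\<V> = topspace K \<and>
        (\<forall>V\<in>\<V>. \<exists>U\<in>\<U>. V \<subseteq> U) \<and>
        (\<forall>x\<in>topspace K. card {V\<in>\<V>. x \<in> V} \<le> d + 1)))"

text \<open>Intended for nonempty spaces: the empty space gets dimension 0 rather than -1.\<close>

definition covering_dim :: "'k topology \<Rightarrow> enat"
  where "covering_dim K = Inf {enat d | d. covering_dim_le K d}"


section \<open>Motakis realisations\<close>

text \<open>The space \<open>X\<close> is the type \<^typ>\<open>'a\<close>. The enumeration \<open>e\<close> is the fixed order of the index set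
  \<open>\<Gamma>\<close>, which is infinite because the Calkin algebra of a finite-dimensional space is zero.\<close>

locale motakis_realisation =
  fixes K :: "'k topology"
    and \<rho> :: "'k metric"
    and \<Gamma> :: "'g set"
    and e :: "nat \<Rightarrow> 'g"
    and d :: "'g \<Rightarrow> 'a::complex_banach"
    and \<kappa> :: "'g \<Rightarrow> 'k"
    and \<Psi> :: "('k \<Rightarrow> complex) \<Rightarrow> ('a \<Rightarrow>\<^sub>L 'a) set"
  assumes Linf: "script_Linf_space TYPE('a)"
    and metric: "mtopology_of \<rho> = K"
    and enumeration: "bij_betw e UNIV \<Gamma>"
    and basis: "schauder_basis (d \<circ> e)"
    and index_map: "\<kappa> \<in> \<Gamma> \<rightarrow> topspace K"
    and Psi_iso: "\<Psi> \<in> banach_algebra_iso (cont_algebra K) (calkin TYPE('a))"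
    and diagonal_plus_compact:
      "\<forall>T \<in> carrier (bounded_ops TYPE('a)).
        \<exists>D \<in> carrier (bounded_ops TYPE('a)). \<exists>K\<^sub>0 \<in> compact_ops TYPE('a).
          T = D + K\<^sub>0 \<and> (\<exists>\<mu>. \<forall>\<gamma>\<in>\<Gamma>. blinfun_apply D (d \<gamma>) = \<mu> \<gamma> *\<^sub>C d \<gamma>)"
    and isometric_renorming:
      "\<exists>N :: 'a \<Rightarrow> real. equivalent_norm N \<and>
        (\<forall>f \<in> carrier (cont_algebra K). calkin_norm_wrt N (\<Psi> f) = nrm (cont_algebra K) f)"
    and lipschitz_lift:
      "\<exists>hat \<in> algebra_hom (lip_algebra \<rho>) (bounded_ops TYPE('a)).
        \<forall>f \<in> carrier (lip_algebra \<rho>).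
          (\<forall>\<gamma>\<in>\<Gamma>. blinfun_apply (hat f) (d \<gamma>) = f (\<kappa> \<gamma>) *\<^sub>C d \<gamma>) \<and>
          calkin_map (hat f) = \<Psi> f"


section \<open>Basic facts\<close>

lemma cont_algebra_mult_commute: "f \<otimes>\<^bsub>cont_algebra K\<^esub> g = g \<otimes>\<^bsub>cont_algebra K\<^esub> f"
  by (simp add: cont_algebra_def mult.commute)

lemma ltsr_cont_algebra: "ltsr (cont_algebra K) = rtsr (cont_algebra K)"
proof -
  have "Lg (cont_algebra K) m = Rg (cont_algebra K) m" for m
    unfolding Lg_def Rg_def by (simp add: cont_algebra_mult_commute)
  then show ?thesis
    by (simp add: ltsr_def rtsr_def)
qed

lemma tsr_cont_algebra: "tsr (cont_algebra K) = ltsr (cont_algebra K)"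
  unfolding tsr_def ltsr_cont_algebra by blast

lemma ring_bounded_ops: "ring (bounded_ops X)"
proof (rule ringI)
  show "abelian_group (bounded_ops X)"
  proof (rule abelian_groupI)
    fix S assume "S \<in> carrier (bounded_ops X)"
    then have "- S \<in> carrier (bounded_ops X)" "- S \<oplus>\<^bsub>bounded_ops X\<^esub> S = \<zero>\<^bsub>bounded_ops X\<^esub>"
      by (simp_all add: bounded_ops_def blinfun.bilinear_simps)
    then show "\<exists>T\<in>carrier (bounded_ops X). T \<oplus>\<^bsub>bounded_ops X\<^esub> S = \<zero>\<^bsub>bounded_ops X\<^esub>"
      by blast
  qed (simp_all add: bounded_ops_def blinfun.bilinear_simps scaleC_add_right add.assoc)
  show "Group.monoid (bounded_ops X)"
    by (rule monoidI) (simp_all add: bounded_ops_def blinfun_eqI)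
qed (simp_all add: bounded_ops_def blinfun_eqI blinfun.bilinear_simps)

lemma blinfun_apply_scal:
  "blinfun_apply (scal (bounded_ops X) c T) x = c *\<^sub>C blinfun_apply T x"
  unfolding bounded_ops_def
  by (simp add: bounded_linear_Blinfun_apply bounded_linear_compose[OF bounded_linear_scaleC]
      blinfun.bounded_linear_right)

lemma norm_eq_onorm_wrt: "onorm_wrt norm T = norm T"
  by (simp add: onorm_wrt_def norm_blinfun.rep_eq onorm_def)

lemma compact_closure_subset:
  fixes A B :: "'a::metric_space set"
  assumes "A \<subseteq> B" "compact B"
  shows "compact (closure A)"
proof -
  have "B \<inter> closure A = closure A"
    using assms by (simp add: Int_absorb1 closure_minimal compact_imp_closed)
  then show ?thesis
    using assms compact_Int_closed[of B "closure A"] by simp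
qed

lemma ideal_compact_ops: "ideal (compact_ops X) (bounded_ops X)"
proof (rule idealI)
  show "ring (bounded_ops X)"
    by (rule ring_bounded_ops)
  show "subgroup (compact_ops X) (add_monoid (bounded_ops X))"
  proof (rule group.subgroupI)
    show "group (add_monoid (bounded_ops X))"
      using abelian_group.a_group ring.is_abelian_group ring_bounded_ops by blast
    show "compact_ops X \<subseteq> carrier (add_monoid (bounded_ops X))"
      by (auto simp: compact_ops_def)
    have "0 \<in> compact_ops X"
    proof -
      have "(\<lambda>x::'a. 0::'a) ` cball 0 1 = {0}"
        by (auto simp: image_constant_conv)
      then show ?thesis
        by (simp add: compact_ops_def bounded_ops_def)
    qed
    then show "compact_ops X \<noteq> {}"
      by auto
  next
    fix T assume T: "T \<in> compact_ops X"
    have c: "- T \<in> carrier (bounded_ops X)"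
      using T by (simp add: compact_ops_def bounded_ops_def blinfun.bilinear_simps)
    have "inv\<^bsub>add_monoid (bounded_ops X)\<^esub> T = - T"
    proof (rule group.inv_equality)
      show "group (add_monoid (bounded_ops X))"
        using abelian_group.a_group ring.is_abelian_group ring_bounded_ops by blast
    qed (use T c in \<open>simp_all add: compact_ops_def\<close>, simp add: bounded_ops_def)
    moreover have "blinfun_apply (- T) ` cball 0 1 = uminus ` blinfun_apply T ` cball 0 1"
      by (simp add: image_image blinfun.bilinear_simps)
    moreover have "compact (closure (uminus ` blinfun_apply T ` cball 0 1))"
    proof (rule compact_closure_subset)
      show "compact (uminus ` closure (blinfun_apply T ` cball 0 1))"
        using T by (auto simp: compact_ops_def intro!: compact_continuous_image continuous_intros)
    qed (intro image_mono closure_subset)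
    ultimately show "inv\<^bsub>add_monoid (bounded_ops X)\<^esub> T \<in> compact_ops X"
      using c by (simp add: compact_ops_def)
  next
    fix S T assume S: "S \<in> compact_ops X" and T: "T \<in> compact_ops X"
    let ?A = "closure (blinfun_apply S ` cball 0 1)" and ?B = "closure (blinfun_apply T ` cball 0 1)"
    have "S + T \<in> carrier (bounded_ops X)"
      using S T
      by (simp add: compact_ops_def bounded_ops_def blinfun.bilinear_simps scaleC_add_right)
    moreover have "compact (closure (blinfun_apply (S + T) ` cball 0 1))"
    proof (rule compact_closure_subset)
      show "compact {x + y |x y. x \<in> ?A \<and> y \<in> ?B}"
        by (rule compact_sums) (use S T in \<open>auto simp: compact_ops_def\<close>)
      show "blinfun_apply (S + T) ` cball 0 1 \<subseteq> {x + y |x y. x \<in> ?A \<and> y \<in> ?B}"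
      proof safe
        fix x :: 'a assume "x \<in> cball 0 1"
        then have "blinfun_apply S x \<in> ?A" "blinfun_apply T x \<in> ?B"
          by (intro subsetD[OF closure_subset] imageI; simp)+
        moreover have "blinfun_apply (S + T) x = blinfun_apply S x + blinfun_apply T x"
          by (simp add: blinfun.bilinear_simps)
        ultimately show "\<exists>y z. blinfun_apply (S + T) x = y + z \<and> y \<in> ?A \<and> z \<in> ?B"
          by (intro exI conjI)
      qed
    qed
    ultimately show "S \<otimes>\<^bsub>add_monoid (bounded_ops X)\<^esub> T \<in> compact_ops X"
      by (simp add: compact_ops_def bounded_ops_def)
  qed
next
  fix T S assume T: "T \<in> compact_ops X" and S: "S \<in> carrier (bounded_ops X)"
  have "S o\<^sub>L T \<in> carrier (bounded_ops X)" "T o\<^sub>L S \<in> carrier (bounded_ops X)"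
    using S T by (simp_all add: compact_ops_def bounded_ops_def)
  moreover have "compact (closure (blinfun_apply (S o\<^sub>L T) ` cball 0 1))"
  proof (rule compact_closure_subset)
    show "compact (blinfun_apply S ` closure (blinfun_apply T ` cball 0 1))"
      using T by (auto simp: compact_ops_def intro!: compact_continuous_image continuous_intros)
    have "blinfun_apply (S o\<^sub>L T) ` cball 0 1 = blinfun_apply S ` blinfun_apply T ` cball 0 1"
      by (simp add: image_image)
    also have "\<dots> \<subseteq> blinfun_apply S ` closure (blinfun_apply T ` cball 0 1)"
      by (intro image_mono closure_subset)
    finally show "blinfun_apply (S o\<^sub>L T) ` cball 0 1 \<subseteq>
        blinfun_apply S ` closure (blinfun_apply T ` cball 0 1)" .
  qed
  moreover have "compact (closure (blinfun_apply (T o\<^sub>L S) ` cball 0 1))"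
  proof (rule compact_closure_subset)
    show "compact ((\<lambda>x. norm S *\<^sub>R x) ` closure (blinfun_apply T ` cball 0 1))"
      using T by (auto simp: compact_ops_def intro!: compact_continuous_image continuous_intros)
    show "blinfun_apply (T o\<^sub>L S) ` cball 0 1 \<subseteq>
        (\<lambda>x. norm S *\<^sub>R x) ` closure (blinfun_apply T ` cball 0 1)"
    proof safe
      fix x :: 'a assume x: "x \<in> cball 0 1"
      show "blinfun_apply (T o\<^sub>L S) x \<in>
          (\<lambda>x. norm S *\<^sub>R x) ` closure (blinfun_apply T ` cball 0 1)"
      proof (cases "S = 0")
        case True
        have "blinfun_apply T 0 \<in> closure (blinfun_apply T ` cball 0 1)"
          by (intro subsetD[OF closure_subset] imageI) simp
        moreover have "blinfun_apply (T o\<^sub>L S) x = norm S *\<^sub>R blinfun_apply T 0"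
          using True by (simp add: blinfun.bilinear_simps)
        ultimately show ?thesis
          by (simp only: image_eqI[OF refl])
      next
        case False
        define y where "y = inverse (norm S) *\<^sub>R blinfun_apply S x"
        have "norm (blinfun_apply S x) \<le> norm S * 1"
          using x by (intro order_trans[OF norm_blinfun] mult_left_mono) auto
        then have "y \<in> cball 0 1"
          using False by (simp add: y_def field_simps)
        then have "blinfun_apply T y \<in> closure (blinfun_apply T ` cball 0 1)"
          by (intro subsetD[OF closure_subset]) auto
        moreover have "blinfun_apply (T o\<^sub>L S) x = norm S *\<^sub>R blinfun_apply T y"
          using False by (simp add: y_def blinfun.bilinear_simps)
        ultimately show ?thesis
          by (simp only: image_eqI[OF refl])
      qed
    qed
  qed
  ultimately show "S \<otimes>\<^bsub>bounded_ops X\<^esub> T \<in> compact_ops X" "T \<otimes>\<^bsub>bounded_ops X\<^esub> S \<in> compact_ops X"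
    by (simp_all add: compact_ops_def bounded_ops_def)
qed

lemma continuous_map_restrict_topspace:
  "continuous_map K L (restrict f (topspace K)) \<longleftrightarrow> continuous_map K L f"
  by (metis continuous_map_eq restrict_apply)

lemma continuous_map_complex_mult:
  fixes f g :: "'k \<Rightarrow> complex"
  assumes "continuous_map K euclidean f" "continuous_map K euclidean g"
  shows "continuous_map K euclidean (\<lambda>x. f x * g x)"
  using assms by (auto simp: continuous_map_atin intro: tendsto_mult)

lemma ring_cont_algebra: "ring (cont_algebra K)"
proof (rule ringI)
  show "abelian_group (cont_algebra K)"
  proof (rule abelian_groupI)
    fix f assume "f \<in> carrier (cont_algebra K)"
    then have "(\<lambda>x\<in>topspace K. - f x) \<in> carrier (cont_algebra K)"
      "(\<lambda>x\<in>topspace K. - f x) \<oplus>\<^bsub>cont_algebra K\<^esub> f = \<zero>\<^bsub>cont_algebra K\<^esub>"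
      by (simp_all add: cont_algebra_def continuous_map_restrict_topspace
          continuous_map_minus fun_eq_iff)
    then show "\<exists>g\<in>carrier (cont_algebra K). g \<oplus>\<^bsub>cont_algebra K\<^esub> f = \<zero>\<^bsub>cont_algebra K\<^esub>"
      by blast
  qed (auto simp: cont_algebra_def continuous_map_restrict_topspace continuous_map_add
      fun_eq_iff extensional_def algebra_simps)
  show "Group.monoid (cont_algebra K)"
    by (rule monoidI)
      (auto simp: cont_algebra_def continuous_map_restrict_topspace continuous_map_complex_mult
        fun_eq_iff extensional_def)
qed (auto simp: cont_algebra_def fun_eq_iff algebra_simps)

end

theory Submission
  imports Defs
begin

text \<open>The theorem rests on one equivalence and one piece of linear algebra.

For \<open>m \<ge> 1\<close> the following are equivalent: left-unimodular \<open>m\<close>-tuples are dense in \<open>B(X)\<close>;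
right-unimodular \<open>m\<close>-tuples are dense in \<open>B(X)\<close>; unimodular \<open>m\<close>-tuples are dense in \<open>C(K)\<close>;
\<open>dim K \<le> 2 * m - 1\<close>. The passage from \<open>B(X)\<close> to \<open>C(K)\<close> is the bounded surjective homomorphism
\<open>B(X) \<rightarrow> Q(X) \<cong> C(K)\<close>, called \<open>symbol\<close> below. A tuple in \<open>C(K)\<close> is unimodular iff it has no common
zero, so \<open>C(K)\<close> and covering dimension are related by the question whether the common zeros of \<open>2 * m\<close>
real functions can be removed by a small perturbation (\<open>covering_dim_le_if_zeros_removable\<close>,
\<open>remove_zeros\<close>). Both directions are proved directly with covers, without extension theorems for maps
into spheres: from zero-free approximations of \<open>g\<^sub>j - g\<^sub>N\<close> (\<open>j < N\<close>), with the \<open>g\<^sub>i\<close> subordinate to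
\<open>N + 1\<close> open sets, one reads off a shrinking with empty intersection; conversely a barycentric subdivision
of a fine cover of order \<open>N\<close> splits it into \<open>N\<close> disjoint families, and the \<open>i\<close>-th function is made locally
constant and nonzero near the \<open>i\<close>-th family.

For the way back to \<open>B(X)\<close> the tuple in \<open>C(K)\<close> is chosen Lipschitz. If \<open>g\<close> is a Lipschitz tuple
without common zero, so is \<open>h = cnj g / \<Sum>|g|\<^sup>2\<close>, and because the Lipschitz functions act on \<open>X\<close> by an algebra
homomorphism, \<open>\<Sum> H\<^sub>i G\<^sub>i = I\<close> holds exactly for the operators of \<open>h\<close> and \<open>g\<close>, not merely modulo
compacts. A given tuple is within \<open>\<epsilon>\<close> of some \<open>G + C\<close> with compact \<open>C\<^sub>i\<close>. Replacing \<open>G + C\<close> by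
\<open>G + C + G E\<close> turns \<open>\<Sum> H\<^sub>i (G\<^sub>i + C\<^sub>i) = I + C'\<close> into \<open>I + C' + E\<close>, with \<open>C' = \<Sum> H\<^sub>i C\<^sub>i\<close> compact, so
that it remains to find an arbitrarily small \<open>E\<close> for which \<open>I + C' + E\<close> is invertible
(\<open>compact_perturbation_of_id\<close>). No index obstruction occurs even for \<open>m = 1\<close>, since the operator to
be perturbed has the form \<open>I + C'\<close> and hence index zero. Here the Schauder basis enters: it makes \<open>C'\<close> a limit
of finite-rank operators, whose rank-one summands can be rescaled one at a time.

The passage from \<open>X\<close> to \<open>X\<^sup>n\<close> is Rieffel's computation of the stable rank of a matrix ring: with
\<open>D r n\<close> the density of left-invertible \<open>r \<times> n\<close> matrices over a normed ring, \<open>D (r + n) (n + 1)\<close> holds iff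
\<open>D r 1\<close> does (\<open>left_invertibles_dense_iff\<close>), by row and column operations with pivot. An \<open>m\<close>-tuple of
operators on \<open>X\<^sup>n\<close> is an \<open>m n \<times> n\<close> matrix over \<open>B(X)\<close>, hence \<open>m\<close>-tuples are good for \<open>B(X\<^sup>n)\<close> iff
\<open>n (m - 1) + 1\<close>-tuples are good for \<open>B(X)\<close>, that is iff \<open>dim K \<le> 2 * n * (m - 1) + 1\<close>. The right-hand
versions are the left-hand ones over the opposite ring.\<close>

section \<open>Dense left-invertible matrices over a normed ring\<close>

text \<open>The multiplication is a parameter, so that the opposite ring is another instance and every statement on
left-invertibility has its right-hand counterpart. The ring is a subset \<open>C\<close> of a normed space because the
complex-linear operators are not a type of their own.\<close>

locale unital_normed_ring =
  fixes C :: "'r::real_normed_vector set"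
    and mul :: "'r \<Rightarrow> 'r \<Rightarrow> 'r"  (infixl \<open>\<cdot>\<close> 70)
    and unit :: 'r
  assumes bilinear: "bounded_bilinear mul"
    and mul_assoc: "(x \<cdot> y) \<cdot> z = x \<cdot> (y \<cdot> z)"
    and unit_left [simp]: "unit \<cdot> x = x"
    and unit_right [simp]: "x \<cdot> unit = x"
    and unit_mem [simp]: "unit \<in> C"
    and diff_mem: "x \<in> C \<Longrightarrow> y \<in> C \<Longrightarrow> x - y \<in> C"
    and mul_mem: "x \<in> C \<Longrightarrow> y \<in> C \<Longrightarrow> x \<cdot> y \<in> C"
    and inverse_near_unit:
      "x \<in> C \<Longrightarrow> norm (x - unit) \<le> 1/2 \<Longrightarrow> \<exists>y\<in>C. y \<cdot> x = unit \<and> x \<cdot> y = unit \<and> norm y \<le> 2"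
begin

sublocale mul: bounded_bilinear mul
  by (rule bilinear)

lemma zero_mem [simp]: "0 \<in> C"
  using diff_mem[OF unit_mem unit_mem] by simp

lemma minus_mem: "x \<in> C \<Longrightarrow> - x \<in> C"
  using diff_mem[of 0 x] by simp

lemma add_mem: "x \<in> C \<Longrightarrow> y \<in> C \<Longrightarrow> x + y \<in> C"
  using diff_mem[of x "- y"] minus_mem[of y] by simp

lemma sum_mem: "(\<And>i. i \<in> I \<Longrightarrow> f i \<in> C) \<Longrightarrow> sum f I \<in> C"
  by (induction I rule: infinite_finite_induct) (auto simp: add_mem)

definition row_span :: "(nat \<Rightarrow> nat \<Rightarrow> 'r) \<Rightarrow> nat \<Rightarrow> nat \<Rightarrow> (nat \<Rightarrow> 'r) set"
  where "row_span M r n =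
    {f. \<exists>c. (\<forall>i<r. c i \<in> C) \<and> (\<forall>k<n. f k = (\<Sum>i<r. c i \<cdot> M i k))}"

text \<open>A left inverse of an \<open>r \<times> n\<close> matrix is read row by row: its \<open>j\<close>-th row expresses the \<open>j\<close>-th unit vector
as a left combination of the rows of the matrix. Row operations then need no matrix products.\<close>

definition left_invertible :: "(nat \<Rightarrow> nat \<Rightarrow> 'r) \<Rightarrow> nat \<Rightarrow> nat \<Rightarrow> bool"
  where "left_invertible M r n \<longleftrightarrow> (\<forall>j<n. (\<lambda>k. if k = j then unit else 0) \<in> row_span M r n)"

definition left_invertibles_dense :: "nat \<Rightarrow> nat \<Rightarrow> bool"
  where "left_invertibles_dense r n \<longleftrightarrow>
    (\<forall>M. (\<forall>i<r. \<forall>k<n. M i k \<in> C) \<longrightarrow> (\<forall>\<epsilon>>0. \<exists>M'. (\<forall>i<r. \<forall>k<n. M' i k \<in> C) \<and>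
       left_invertible M' r n \<and> (\<forall>i<r. \<forall>k<n. norm (M' i k - M i k) < \<epsilon>)))"

lemma row_span_row: "i < r \<Longrightarrow> M i \<in> row_span M r n"
proof -
  assume i: "i < r"
  have "(\<Sum>j<r. (if j = i then unit else 0) \<cdot> M j k) = M i k" for k
  proof -
    have "(\<Sum>j<r. (if j = i then unit else 0) \<cdot> M j k) = (\<Sum>j<r. if j = i then M i k else 0)"
      by (rule sum.cong) (auto simp: mul.zero_left)
    then show ?thesis using i by simp
  qed
  then show ?thesis
    unfolding row_span_def by (intro CollectI exI[of _ "\<lambda>j. if j = i then unit else 0"]) auto
qed

lemma row_span_add:
  assumes "f \<in> row_span M r n" "g \<in> row_span M r n"
  shows "(\<lambda>k. f k + g k) \<in> row_span M r n"
proof -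
  obtain c d where "\<forall>i<r. c i \<in> C" "\<forall>k<n. f k = (\<Sum>i<r. c i \<cdot> M i k)"
    "\<forall>i<r. d i \<in> C" "\<forall>k<n. g k = (\<Sum>i<r. d i \<cdot> M i k)"
    using assms unfolding row_span_def by blast
  then show ?thesis
    unfolding row_span_def
    by (intro CollectI exI[of _ "\<lambda>i. c i + d i"]) (auto simp: add_mem mul.add_left sum.distrib)
qed

lemma row_span_mul:
  assumes "f \<in> row_span M r n" "a \<in> C"
  shows "(\<lambda>k. a \<cdot> f k) \<in> row_span M r n"
proof -
  obtain c where "\<forall>i<r. c i \<in> C" "\<forall>k<n. f k = (\<Sum>i<r. c i \<cdot> M i k)"
    using assms unfolding row_span_def by blast
  then show ?thesis
    using assms unfolding row_span_def
    by (intro CollectI exI[of _ "\<lambda>i. a \<cdot> c i"]) (auto simp: mul_mem mul_assoc mul.sum_right)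
qed

lemma row_span_diff:
  assumes "f \<in> row_span M r n" "g \<in> row_span M r n"
  shows "(\<lambda>k. f k - g k) \<in> row_span M r n"
  using row_span_add[OF assms(1) row_span_mul[OF assms(2), of "- unit"]]
  by (simp add: minus_mem mul.minus_left)

lemma row_span_zero: "(\<lambda>k. 0) \<in> row_span M r n"
  unfolding row_span_def by (intro CollectI exI[of _ "\<lambda>_. 0"]) (auto simp: mul.zero_left)

lemma row_span_sum:
  assumes "\<And>i. i \<in> I \<Longrightarrow> f i \<in> row_span M r n" "\<And>i. i \<in> I \<Longrightarrow> a i \<in> C"
  shows "(\<lambda>k. \<Sum>i\<in>I. a i \<cdot> f i k) \<in> row_span M r n"
  using assms
  by (induction I rule: infinite_finite_induct)
    (auto simp: row_span_zero intro!: row_span_add row_span_mul)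

lemma row_span_cong:
  assumes "f \<in> row_span M r n" "\<And>k. k < n \<Longrightarrow> f k = g k"
  shows "g \<in> row_span M r n"
  using assms unfolding row_span_def by auto

text \<open>Border the given matrix by a unit in the corner and approximate. The corner entry of the
approximation stays invertible, and clearing its row by a column operation leaves a left-invertible matrix
that has moved only by a product of two small entries and one bounded one.\<close>

lemma left_invertibles_dense_drop:
  assumes "left_invertibles_dense (Suc r) (Suc n)"
  shows "left_invertibles_dense r n"
  unfolding left_invertibles_dense_def
proof (intro allI impI)
  fix B and \<epsilon> :: real
  assume B: "\<forall>i<r. \<forall>k<n. B i k \<in> C" and "\<epsilon> > 0"
  obtain \<beta> where \<beta>: "\<beta> > 0" "\<And>a b. norm (a \<cdot> b) \<le> norm a * norm b * \<beta>"
    using mul.pos_bounded by blast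
  \<comment> \<open>the total error is at most \<open>\<eta> * (1 + 2 * \<beta>\<^sup>2)\<close>, since the inverse of the corner has norm at most 2\<close>
  define \<eta> where "\<eta> = min (1/2) (\<epsilon> / (2 * (1 + 2 * \<beta> * \<beta>)))"
  have \<eta>: "\<eta> > 0" "\<eta> \<le> 1/2"
  proof -
    have "0 < 2 * (1 + 2 * \<beta> * \<beta>)"
      using \<beta>(1) by (intro mult_pos_pos add_pos_pos) auto
    then show "\<eta> > 0"
      using \<open>\<epsilon> > 0\<close> unfolding \<eta>_def by (metis divide_pos_pos half_gt_zero_iff min_less_iff_conj zero_less_one)
    show "\<eta> \<le> 1/2"
      unfolding \<eta>_def by (rule min.cobounded1)
  qed
  have "\<eta> * (1 + 2 * \<beta> * \<beta>) \<le> \<epsilon> / (2 * (1 + 2 * \<beta> * \<beta>)) * (1 + 2 * \<beta> * \<beta>)"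
    using \<beta> by (intro mult_right_mono) (auto simp: \<eta>_def)
  also have "\<dots> = \<epsilon> / 2"
  proof -
    have "1 + 2 * \<beta> * \<beta> \<noteq> 0" using \<beta>(1) by (smt (verit) mult_pos_pos)
    then show ?thesis by (simp add: divide_simps)
  qed
  finally have \<eta>3: "\<eta> * (1 + 2 * \<beta> * \<beta>) < \<epsilon>"
    using \<open>\<epsilon> > 0\<close> by linarith
  define B1 where
    "B1 = (\<lambda>i k. if i < r \<and> k < n then B i k else if i = r \<and> k = n then unit else 0)"
  have "\<forall>i<Suc r. \<forall>k<Suc n. B1 i k \<in> C"
    using B by (auto simp: B1_def)
  then obtain M where M: "\<And>i k. i \<le> r \<Longrightarrow> k \<le> n \<Longrightarrow> M i k \<in> C" "left_invertible M (Suc r) (Suc n)"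
    "\<And>i k. i \<le> r \<Longrightarrow> k \<le> n \<Longrightarrow> norm (M i k - B1 i k) < \<eta>"
    using assms \<eta>(1) unfolding left_invertibles_dense_def by (metis less_Suc_eq_le)
  have "norm (M r n - unit) \<le> 1/2"
    using M(3)[of r n] \<eta> by (simp add: B1_def)
  then obtain g where g: "g \<in> C" "M r n \<cdot> g = unit" "norm g \<le> 2"
    using inverse_near_unit[of "M r n"] M(1) by blast
  define P where "P = (\<lambda>i k. M i k - M i n \<cdot> (g \<cdot> M r k))"
  have "P r k = 0" for k
    by (simp add: P_def mul_assoc[symmetric] g)
  have "left_invertible P r n"
    unfolding left_invertible_def
  proof (intro allI impI)
    fix j assume j: "j < n"
    then obtain c where c: "\<And>i. i \<le> r \<Longrightarrow> c i \<in> C"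
      "\<And>k. k \<le> n \<Longrightarrow> (if k = j then unit else 0) = (\<Sum>i<Suc r. c i \<cdot> M i k)"
    proof -
      have "(\<lambda>k. if k = j then unit else 0) \<in> row_span M (Suc r) (Suc n)"
        using M(2) j unfolding left_invertible_def by simp
      then show thesis
        unfolding row_span_def by (auto intro: that simp: less_Suc_eq_le simp del: sum.lessThan_Suc)
    qed
    have "(\<Sum>i<r. c i \<cdot> P i k) = (if k = j then unit else 0)" if k: "k < n" for k
    proof -
      have "(\<Sum>i<r. c i \<cdot> P i k) = (\<Sum>i<Suc r. c i \<cdot> P i k)"
        by (simp add: \<open>P r k = 0\<close> mul.zero_right)
      also have "\<dots> = (\<Sum>i<Suc r. c i \<cdot> M i k) - (\<Sum>i<Suc r. c i \<cdot> M i n) \<cdot> (g \<cdot> M r k)"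
        unfolding P_def by (simp only: mul.diff_right sum_subtractf mul.sum_left mul_assoc)
      also have "\<dots> = (if k = j then unit else 0)"
        using c(2)[of k] c(2)[of n] k j by (simp add: mul.zero_left del: sum.lessThan_Suc)
      finally show ?thesis .
    qed
    then show "(\<lambda>k. if k = j then unit else 0) \<in> row_span P r n"
      unfolding row_span_def using c(1) by (intro CollectI exI[of _ c]) auto
  qed
  moreover have "P i k \<in> C" if "i < r" "k < n" for i k
    unfolding P_def using that M(1) g by (intro diff_mem mul_mem) auto
  moreover have "norm (P i k - B i k) < \<epsilon>" if ik: "i < r" "k < n" for i k
  proof -
    have 1: "norm (M i k - B i k) \<le> \<eta>" "norm (M i n) \<le> \<eta>" "norm (M r k) \<le> \<eta>"
      using M(3)[of i k] M(3)[of i n] M(3)[of r k] ik by (auto simp: B1_def)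
    have "norm (M i n \<cdot> (g \<cdot> M r k)) \<le> norm (M i n) * norm (g \<cdot> M r k) * \<beta>"
      by (rule \<beta>)
    also have "\<dots> \<le> \<eta> * (2 * \<eta> * \<beta>) * \<beta>"
    proof (intro mult_right_mono mult_mono)
      show "norm (g \<cdot> M r k) \<le> 2 * \<eta> * \<beta>"
        by (rule order_trans[OF \<beta>(2)]) (use 1 g \<eta> \<beta>(1) in \<open>auto intro!: mult_right_mono mult_mono\<close>)
    qed (use 1 \<eta> \<beta>(1) in auto)
    also have "\<dots> = \<eta> * (2 * \<beta> * \<beta>) * \<eta>"
      by simp
    also have "\<dots> \<le> \<eta> * (2 * \<beta> * \<beta>) * 1"
      using \<eta> \<beta>(1) by (intro mult_left_mono) auto
    finally have "norm (M i n \<cdot> (g \<cdot> M r k)) \<le> \<eta> * (2 * \<beta> * \<beta>)"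
      by simp
    moreover have "norm (P i k - B i k) \<le> norm (M i k - B i k) + norm (M i n \<cdot> (g \<cdot> M r k))"
    proof -
      have "P i k - B i k = (M i k - B i k) - M i n \<cdot> (g \<cdot> M r k)"
        by (simp add: P_def)
      then show ?thesis
        using norm_triangle_ineq4 by metis
    qed
    ultimately show ?thesis
      using 1(1) \<eta>3 by (simp add: distrib_left)
  qed
  ultimately show "\<exists>M'. (\<forall>i<r. \<forall>k<n. M' i k \<in> C) \<and> left_invertible M' r n \<and>
      (\<forall>i<r. \<forall>k<n. norm (M' i k - B i k) < \<epsilon>)"
    by blast
qed

text \<open>The upper \<open>r\<close> entries of the last column can be made unimodular, \<open>\<Sum> b\<^sub>i w\<^sub>i = unit\<close>. Adding suitable
multiples of the upper rows to the last row, with coefficients \<open>a\<^sub>i = (unit - u) b\<^sub>i\<close>, turns the corner \<open>u\<close>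
into \<open>unit\<close>; this pivot clears the last column. The remaining \<open>r \<times> n\<close> block is made left-invertible by
hypothesis, and the row operations, which are invertible, are undone.\<close>

lemma left_invertibles_dense_extend:
  assumes D1: "left_invertibles_dense r 1" and Dn: "left_invertibles_dense r n"
  shows "left_invertibles_dense (Suc r) (Suc n)"
  unfolding left_invertibles_dense_def
proof (intro allI impI)
  fix B and \<epsilon> :: real
  assume B: "\<forall>i<Suc r. \<forall>k<Suc n. B i k \<in> C" and "\<epsilon> > 0"
  obtain \<beta> where \<beta>: "\<beta> > 0" "\<And>a b. norm (a \<cdot> b) \<le> norm a * norm b * \<beta>"
    using mul.pos_bounded by blast
  obtain W where W: "\<And>i. i < r \<Longrightarrow> W i 0 \<in> C" "left_invertible W r 1"
    "\<And>i. i < r \<Longrightarrow> norm (W i 0 - B i n) < \<epsilon>"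
    using D1[unfolded left_invertibles_dense_def, rule_format, of "\<lambda>i k. B i n" \<epsilon>] B \<open>\<epsilon> > 0\<close> by auto
  define w where "w = (\<lambda>i. W i 0)"
  obtain b where b: "\<And>i. i < r \<Longrightarrow> b i \<in> C" "(\<Sum>i<r. b i \<cdot> w i) = unit"
    using W(2) unfolding left_invertible_def row_span_def w_def by auto
  define u where "u = B r n"
  define a where "a = (\<lambda>i. (unit - u) \<cdot> b i)"
  \<comment> \<open>the last row after the row operation; it is kept fixed while the block above changes\<close>
  define R where "R = (\<lambda>k. B r k + (\<Sum>i<r. a i \<cdot> B i k))"
  have aC: "a i \<in> C" if "i < r" for i
    unfolding a_def using that B b(1) by (auto simp: u_def intro!: mul_mem diff_mem)
  have RC: "R k \<in> C" if "k \<le> n" for k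
    unfolding R_def using B that aC by (intro add_mem sum_mem mul_mem) auto
  define T where "T = 1 + (\<Sum>i<r. norm (a i) * \<beta>)"
  have T: "T \<ge> 1" unfolding T_def using \<beta>(1) by (auto intro!: sum_nonneg)
  obtain M where M: "\<And>i k. i < r \<Longrightarrow> k < n \<Longrightarrow> M i k \<in> C" "left_invertible M r n"
    "\<And>i k. i < r \<Longrightarrow> k < n \<Longrightarrow> norm (M i k - (B i k - w i \<cdot> R k)) < \<epsilon> / T"
  proof -
    have "\<forall>i<r. \<forall>k<n. B i k - w i \<cdot> R k \<in> C"
      using B W RC by (auto intro!: diff_mem mul_mem simp: w_def)
    moreover have "\<epsilon> / T > 0"
      using \<open>\<epsilon> > 0\<close> T by simp
    ultimately show thesis
      using that Dn[unfolded left_invertibles_dense_def, rule_format, of "\<lambda>i k. B i k - w i \<cdot> R k" "\<epsilon> / T"]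
      by blast
  qed
  define Q where "Q = (\<lambda>i k. if k = n then w i else M i k + w i \<cdot> R k)"
  define N where "N = (\<lambda>i k. if i < r then Q i k else if k = n then u
      else R k - (\<Sum>l<r. a l \<cdot> Q l k))"
  have QC: "Q i k \<in> C" if "i < r" "k \<le> n" for i k
    unfolding Q_def using that M(1) W(1) RC by (auto simp: w_def intro!: add_mem mul_mem)
  have NC: "N i k \<in> C" if "i \<le> r" "k \<le> n" for i k
    unfolding N_def using that QC RC aC B by (auto simp: u_def intro!: diff_mem sum_mem mul_mem)
  have near: "norm (Q i k - B i k) < \<epsilon> / T" if "i < r" "k < n" for i k
    using M(3)[OF that] that by (simp add: Q_def algebra_simps)
  have eT: "\<epsilon> / T \<le> \<epsilon>"
    using T \<open>\<epsilon> > 0\<close> by (simp add: divide_le_eq)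
  have "norm (N i k - B i k) < \<epsilon>" if ik: "i \<le> r" "k \<le> n" for i k
  proof (cases "i < r")
    case True
    show ?thesis
    proof (cases "k = n")
      case True
      then show ?thesis using W(3)[OF \<open>i < r\<close>] \<open>i < r\<close> by (simp add: N_def Q_def w_def)
    next
      case False
      then show ?thesis using near[of i k] \<open>i < r\<close> ik eT by (simp add: N_def)
    qed
  next
    case False
    then have [simp]: "i = r" using ik by simp
    show ?thesis
    proof (cases "k = n")
      case True
      then show ?thesis using \<open>\<epsilon> > 0\<close> by (simp add: N_def u_def)
    next
      case False
      then have k: "k < n" using ik by simp
      have "N i k - B i k = - (\<Sum>l<r. a l \<cdot> (Q l k - B l k))"
        using False by (simp add: N_def R_def mul.diff_right sum_subtractf)
      then have "norm (N i k - B i k) \<le> (\<Sum>l<r. norm (a l \<cdot> (Q l k - B l k)))"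
        by (simp add: norm_sum)
      also have "\<dots> \<le> (\<Sum>l<r. (norm (a l) * \<beta>) * (\<epsilon> / T))"
      proof (rule sum_mono)
        fix l assume "l \<in> {..<r}"
        then have "norm (a l \<cdot> (Q l k - B l k)) \<le> norm (a l) * (\<epsilon> / T) * \<beta>"
          using near[of l k] k \<beta>(1)
          by (intro order_trans[OF \<beta>(2)] mult_right_mono mult_left_mono) auto
        then show "norm (a l \<cdot> (Q l k - B l k)) \<le> (norm (a l) * \<beta>) * (\<epsilon> / T)"
          by (simp add: mult_ac)
      qed
      also have "\<dots> = (T - 1) * (\<epsilon> / T)"
        by (simp only: T_def sum_distrib_right add_diff_cancel_left')
      also have "\<dots> < T * (\<epsilon> / T)"
        using T \<open>\<epsilon> > 0\<close> by (intro mult_strict_right_mono) auto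
      also have "\<dots> = \<epsilon>" using T by simp
      finally show ?thesis .
    qed
  qed
  moreover have "left_invertible N (Suc r) (Suc n)"
  proof -
    let ?S = "row_span N (Suc r) (Suc n)"
    define \<rho> where "\<rho> = (\<lambda>k. if k = n then unit else R k)"
    have "(\<lambda>k. N r k + (\<Sum>i<r. a i \<cdot> N i k)) \<in> ?S"
      using aC by (intro row_span_add row_span_sum row_span_row) auto
    then have \<rho>: "\<rho> \<in> ?S"
    proof (rule row_span_cong)
      fix k
      have "(\<Sum>i<r. a i \<cdot> w i) = unit - u"
        by (simp add: a_def mul_assoc mul.sum_right[symmetric] b)
      then show "N r k + (\<Sum>i<r. a i \<cdot> N i k) = \<rho> k"
        by (simp add: N_def \<rho>_def Q_def)
    qed
    have rows: "(\<lambda>k. if k = n then 0 else M i k) \<in> ?S" if i: "i < r" for i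
    proof (rule row_span_cong)
      show "(\<lambda>k. N i k - w i \<cdot> \<rho> k) \<in> ?S"
        using i W by (intro row_span_diff row_span_mul row_span_row \<rho>) (auto simp: w_def)
    qed (use i in \<open>auto simp: N_def Q_def \<rho>_def\<close>)
    have unit_j: "(\<lambda>k. if k = j then unit else 0) \<in> ?S" if j: "j < n" for j
    proof -
      obtain c where c: "\<And>i. i < r \<Longrightarrow> c i \<in> C"
        "\<And>k. k < n \<Longrightarrow> (if k = j then unit else 0) = (\<Sum>i<r. c i \<cdot> M i k)"
      proof -
        have "(\<lambda>k. if k = j then unit else 0) \<in> row_span M r n"
          using M(2) j unfolding left_invertible_def by simp
        then show thesis
          unfolding row_span_def by (auto intro: that)
      qed
      show ?thesis
      proof (rule row_span_cong)
        show "(\<lambda>k. \<Sum>i<r. c i \<cdot> (if k = n then 0 else M i k)) \<in> ?S"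
          using c rows by (intro row_span_sum) auto
        show "(\<Sum>i<r. c i \<cdot> (if k = n then 0 else M i k)) = (if k = j then unit else 0)"
          if "k < Suc n" for k
          using that c(2)[of k] j by (cases "k = n") (auto simp: mul.zero_right less_Suc_eq)
      qed
    qed
    have "(\<lambda>k. if k = n then unit else 0) \<in> ?S"
    proof (rule row_span_cong)
      show "(\<lambda>k. \<rho> k - (\<Sum>j<n. R j \<cdot> (if k = j then unit else 0))) \<in> ?S"
        using unit_j RC by (intro row_span_diff row_span_sum \<rho>) auto
      fix k assume k: "k < Suc n"
      have "(\<Sum>j<n. R j \<cdot> (if k = j then unit else 0)) = (\<Sum>j<n. if k = j then R j else 0)"
        by (rule sum.cong) (auto simp: mul.zero_right)
      then show "\<rho> k - (\<Sum>j<n. R j \<cdot> (if k = j then unit else 0)) = (if k = n then unit else 0)"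
        using k by (auto simp: \<rho>_def less_Suc_eq)
    qed
    then show ?thesis
      using unit_j unfolding left_invertible_def by (auto simp: less_Suc_eq)
  qed
  ultimately show "\<exists>M'. (\<forall>i<Suc r. \<forall>k<Suc n. M' i k \<in> C) \<and> left_invertible M' (Suc r) (Suc n) \<and>
      (\<forall>i<Suc r. \<forall>k<Suc n. norm (M' i k - B i k) < \<epsilon>)"
    using NC by (intro exI[of _ N]) (auto simp: less_Suc_eq_le)
qed

text \<open>Perturb the first \<open>r\<close> entries and give the others coefficient zero.\<close>

lemma left_invertibles_dense_more_rows:
  assumes "left_invertibles_dense r 1"
  shows "left_invertibles_dense (r + s) 1"
proof (induction s)
  case (Suc s)
  show ?case
    unfolding left_invertibles_dense_def
  proof (intro allI impI)
    fix B :: "nat \<Rightarrow> nat \<Rightarrow> 'r" and \<epsilon> :: real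
    assume B: "\<forall>i<r + Suc s. \<forall>k<1. B i k \<in> C" and "\<epsilon> > 0"
    then obtain M where M: "\<forall>i<r + s. \<forall>k<1. M i k \<in> C" "left_invertible M (r + s) 1"
      "\<forall>i<r + s. \<forall>k<1. norm (M i k - B i k) < \<epsilon>"
      using Suc[unfolded left_invertibles_dense_def, rule_format, of B \<epsilon>] by auto
    define N where "N = (\<lambda>i. if i < r + s then M i else B i)"
    obtain c where c: "\<forall>i<r + s. c i \<in> C" "unit = (\<Sum>i<r + s. c i \<cdot> M i 0)"
      using M(2) unfolding left_invertible_def row_span_def by auto
    define c' where "c' = (\<lambda>i. if i < r + s then c i else 0)"
    have "(\<Sum>i<r + Suc s. c' i \<cdot> N i 0) = (\<Sum>i<r + s. c i \<cdot> M i 0)"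
      by (simp add: c'_def N_def mul.zero_left)
    moreover have "\<forall>i<r + Suc s. c' i \<in> C"
      using c by (simp add: c'_def)
    ultimately have "left_invertible N (r + Suc s) 1"
      unfolding left_invertible_def row_span_def using c(2) by (auto intro: exI[of _ c'])
    then show "\<exists>M'. (\<forall>i<r + Suc s. \<forall>k<1. M' i k \<in> C) \<and> left_invertible M' (r + Suc s) 1 \<and>
      (\<forall>i<r + Suc s. \<forall>k<1. norm (M' i k - B i k) < \<epsilon>)"
      using M B \<open>\<epsilon> > 0\<close> by (intro exI[of _ N]) (auto simp: N_def less_Suc_eq)
  qed
qed (use assms in simp)

theorem left_invertibles_dense_iff:
  "left_invertibles_dense (r + n) (Suc n) \<longleftrightarrow> left_invertibles_dense r 1"
proof
  show "left_invertibles_dense r 1" if "left_invertibles_dense (r + n) (Suc n)"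
    using that
  proof (induction n)
    case (Suc n)
    then show ?case
      using left_invertibles_dense_drop[of "r + n" "Suc n"] by simp
  qed simp
  show "left_invertibles_dense (r + n) (Suc n)" if "left_invertibles_dense r 1"
  proof (induction n)
    case (Suc n)
    then show ?case
      using left_invertibles_dense_extend[OF left_invertibles_dense_more_rows[OF that, of n] Suc] by simp
  qed (use that in simp)
qed

text \<open>An exact left inverse \<open>H\<close> of \<open>G\<close> converts the invertibility of a perturbation of
\<open>unit + \<Sum> H\<^sub>i D\<^sub>i\<close> by \<open>x\<close> into left-invertibility of the perturbation of \<open>G + D\<close> by \<open>G x\<close>.\<close>

lemma perturb_to_left_invertible:
  fixes G H D :: "nat \<Rightarrow> 'r"
  assumes mem: "\<And>i. i < m \<Longrightarrow> G i \<in> C" "\<And>i. i < m \<Longrightarrow> H i \<in> C" "\<And>i. i < m \<Longrightarrow> D i \<in> C"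
    and HG: "(\<Sum>i<m. H i \<cdot> G i) = unit"
    and inv: "\<And>\<delta>. 0 < \<delta> \<Longrightarrow> \<exists>x\<in>C. norm x < \<delta> \<and>
      (\<exists>q\<in>C. q \<cdot> (unit + (\<Sum>i<m. H i \<cdot> D i) + x) = unit)"
    and \<epsilon>: "0 < \<epsilon>"
  shows "\<exists>T. (\<forall>i<m. T i \<in> C) \<and> (\<exists>S. (\<forall>i<m. S i \<in> C) \<and> unit = (\<Sum>i<m. S i \<cdot> T i)) \<and>
    (\<forall>i<m. norm (T i - (G i + D i)) < \<epsilon>)"
proof -
  obtain \<beta> where \<beta>: "\<beta> > 0" "\<And>a b. norm (a \<cdot> b) \<le> norm a * norm b * \<beta>"
    using mul.pos_bounded by blast
  define N where "N = 1 + (\<Sum>i<m. norm (G i))"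
  have N: "0 < N" unfolding N_def by (intro add_pos_nonneg sum_nonneg) auto
  have "0 < \<epsilon> / (N * \<beta>)" using \<epsilon> N \<beta>(1) by simp
  from inv[OF this] obtain x q where x: "x \<in> C" "norm x < \<epsilon> / (N * \<beta>)"
    and q: "q \<in> C" "q \<cdot> (unit + (\<Sum>i<m. H i \<cdot> D i) + x) = unit" by blast
  define T where "T i = G i + D i + G i \<cdot> x" for i
  have "(\<Sum>i<m. H i \<cdot> T i) = (\<Sum>i<m. H i \<cdot> G i) + (\<Sum>i<m. H i \<cdot> D i) + (\<Sum>i<m. H i \<cdot> G i) \<cdot> x"
    by (simp add: T_def mul.add_right sum.distrib mul.sum_left mul_assoc)
  then have "(\<Sum>i<m. H i \<cdot> T i) = unit + (\<Sum>i<m. H i \<cdot> D i) + x"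
    by (simp add: HG)
  then have "(\<Sum>i<m. (q \<cdot> H i) \<cdot> T i) = unit"
    using q(2) by (simp only: mul_assoc mul.sum_right[symmetric])
  moreover have "norm (T i - (G i + D i)) < \<epsilon>" if i: "i < m" for i
  proof -
    have "norm (G i) \<le> N"
      using member_le_sum[of i "{..<m}" "\<lambda>i. norm (G i)"] i by (simp add: N_def)
    then have "norm (G i \<cdot> x) \<le> N * norm x * \<beta>"
      using \<beta>(1) by (intro order_trans[OF \<beta>(2)] mult_right_mono) auto
    also have "\<dots> < N * (\<epsilon> / (N * \<beta>)) * \<beta>"
      using x(2) N \<beta>(1) by (intro mult_strict_right_mono mult_strict_left_mono) auto
    also have "\<dots> = \<epsilon>" using N \<beta>(1) by simp
    finally show ?thesis by (simp add: T_def)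
  qed
  moreover have "T i \<in> C" "q \<cdot> H i \<in> C" if "i < m" for i
    unfolding T_def using mem that q(1) x(1) by (auto intro!: add_mem mul_mem)
  ultimately show ?thesis
    by (intro exI[of _ T] conjI exI[of _ "\<lambda>i. q \<cdot> H i"]) auto
qed

end

section \<open>Matrix rings\<close>

text \<open>The ring \<open>C'\<close> consists of the \<open>n \<times> n\<close> matrices over \<open>C\<close>; \<open>E x a b\<close> is an entry of \<open>x\<close>. The norms
need only be comparable to the largest entry.\<close>

locale matrix_ring =
  entry: unital_normed_ring C mul unit + big: unital_normed_ring C' mul' unit'
  for C :: "'r::real_normed_vector set" and mul :: "'r \<Rightarrow> 'r \<Rightarrow> 'r" (infixl \<open>\<cdot>\<close> 70) and unit :: 'r
    and C' :: "'s::real_normed_vector set" and mul' :: "'s \<Rightarrow> 's \<Rightarrow> 's" (infixl \<open>\<odot>\<close> 70) and unit' :: 's +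
  fixes n :: nat and E :: "'s \<Rightarrow> nat \<Rightarrow> nat \<Rightarrow> 'r"
  assumes E_diff: "E (x - y) a b = E x a b - E y a b"
    and E_mul: "a < n \<Longrightarrow> b < n \<Longrightarrow> E (x \<odot> y) a b = (\<Sum>c<n. E x a c \<cdot> E y c b)"
    and E_unit: "a < n \<Longrightarrow> b < n \<Longrightarrow> E unit' a b = (if a = b then unit else 0)"
    and E_mem: "x \<in> C' \<Longrightarrow> a < n \<Longrightarrow> b < n \<Longrightarrow> E x a b \<in> C"
    and E_surj: "(\<And>a b. a < n \<Longrightarrow> b < n \<Longrightarrow> F a b \<in> C) \<Longrightarrow>
      \<exists>x\<in>C'. \<forall>a<n. \<forall>b<n. E x a b = F a b"
    and norm_E_le: "a < n \<Longrightarrow> b < n \<Longrightarrow> norm (E x a b) \<le> norm x"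
    and norm_le_E: "norm x \<le> (\<Sum>a<n. \<Sum>b<n. norm (E x a b))"
begin

lemma E_zero: "E 0 a b = 0"
  using E_diff[of 0 0 a b] by simp

lemma E_add: "E (x + y) a b = E x a b + E y a b"
  using E_diff[of "x + y" y a b] by simp

lemma E_sum: "E (sum f I) a b = (\<Sum>i\<in>I. E (f i) a b)"
  by (induction I rule: infinite_finite_induct) (simp_all add: E_zero E_add)

lemma E_inject:
  assumes "\<And>a b. a < n \<Longrightarrow> b < n \<Longrightarrow> E x a b = E y a b"
  shows "x = y"
proof -
  have "norm (x - y) \<le> 0"
    by (rule order_trans[OF norm_le_E]) (simp add: E_diff assms)
  then show ?thesis by simp
qed

text \<open>An \<open>m\<close>-tuple of \<open>n \<times> n\<close> matrices, written below each other.\<close>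

definition stack :: "(nat \<Rightarrow> 's) \<Rightarrow> nat \<Rightarrow> nat \<Rightarrow> 'r"
  where "stack T i k = E (T (i div n)) (i mod n) k"

lemma sum_div_mod: "(\<Sum>i<m * n. f (i div n) (i mod n)) = (\<Sum>i<m. \<Sum>a<n. f i a)"
  for f :: "nat \<Rightarrow> nat \<Rightarrow> 'r"
proof -
  have "(\<Sum>i<m. \<Sum>a<n. f i a) = (\<Sum>i<m. \<Sum>j\<in>{i * n..<i * n + n}. f (j div n) (j mod n))"
  proof (rule sum.cong)
    fix i
    have "(\<Sum>j\<in>{i * n..<i * n + n}. f (j div n) (j mod n)) =
        (\<Sum>a\<in>{0..<n}. f ((a + i * n) div n) ((a + i * n) mod n))"
      using sum.shift_bounds_nat_ivl[of "\<lambda>j. f (j div n) (j mod n)" 0 "i * n" n]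
      by (simp add: add.commute)
    also have "\<dots> = (\<Sum>a<n. f i a)"
      by (rule sum.cong) auto
    finally show "(\<Sum>a<n. f i a) = (\<Sum>j\<in>{i * n..<i * n + n}. f (j div n) (j mod n))" ..
  qed simp
  then show ?thesis by (simp add: sum.nat_group)
qed

lemma left_invertible_stack:
  assumes T: "\<And>i. i < m \<Longrightarrow> T i \<in> C'"
  shows "entry.left_invertible (stack T) (m * n) n \<longleftrightarrow> big.left_invertible (\<lambda>i k. T i) m 1"
proof -
  have prod: "E (\<Sum>i<m. S i \<odot> T i) a k = (\<Sum>i<m * n. E (S (i div n)) a (i mod n) \<cdot> stack T i k)"
    if "a < n" "k < n" for S a k
    using that sum_div_mod[of "\<lambda>i c. E (S i) a c \<cdot> E (T i) c k" m]
    by (simp add: E_sum E_mul stack_def)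
  show ?thesis
  proof
    assume "big.left_invertible (\<lambda>i k. T i) m 1"
    then obtain S where S: "\<And>i. i < m \<Longrightarrow> S i \<in> C'" "unit' = (\<Sum>i<m. S i \<odot> T i)"
      by (auto simp: big.left_invertible_def big.row_span_def)
    show "entry.left_invertible (stack T) (m * n) n"
      unfolding entry.left_invertible_def entry.row_span_def
    proof (intro allI impI CollectI exI conjI)
      fix a k assume "a < n" "k < n"
      then show "(if k = a then unit else 0) = (\<Sum>i<m * n. E (S (i div n)) a (i mod n) \<cdot> stack T i k)"
        using prod[of a k S] E_unit[of a k] by (auto simp: S(2)[symmetric])
    next
      fix a i assume "a < n" "i < m * n"
      then show "E (S (i div n)) a (i mod n) \<in> C"
        by (intro E_mem S) (auto simp: less_mult_imp_div_less)
    qed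
  next
    assume "entry.left_invertible (stack T) (m * n) n"
    then have "\<forall>a. \<exists>c. a < n \<longrightarrow> (\<forall>i<m * n. c i \<in> C) \<and>
        (\<forall>k<n. (if k = a then unit else 0) = (\<Sum>i<m * n. c i \<cdot> stack T i k))"
      by (auto simp: entry.left_invertible_def entry.row_span_def)
    from choice[OF this] obtain c where c: "\<And>a i. a < n \<Longrightarrow> i < m * n \<Longrightarrow> c a i \<in> C"
      "\<And>a k. a < n \<Longrightarrow> k < n \<Longrightarrow> (if k = a then unit else 0) = (\<Sum>i<m * n. c a i \<cdot> stack T i k)"
      by blast
    have "\<exists>x\<in>C'. \<forall>a<n. \<forall>b<n. E x a b = c a (i * n + b)" if "i < m" for i
    proof (rule E_surj)
      fix a b assume "a < n" "b < n"
      have "i * n + b < Suc i * n" using \<open>b < n\<close> by simp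
      also have "\<dots> \<le> m * n" using that by (intro mult_right_mono) auto
      finally show "c a (i * n + b) \<in> C" using c \<open>a < n\<close> by simp
    qed
    then have "\<forall>i. \<exists>x. i < m \<longrightarrow> x \<in> C' \<and> (\<forall>a<n. \<forall>b<n. E x a b = c a (i * n + b))"
      by blast
    from choice[OF this] obtain S where S: "\<And>i. i < m \<Longrightarrow> S i \<in> C'"
      "\<And>i a b. i < m \<Longrightarrow> a < n \<Longrightarrow> b < n \<Longrightarrow> E (S i) a b = c a (i * n + b)"
      by blast
    have "(\<Sum>i<m. S i \<odot> T i) = unit'"
    proof (rule E_inject)
      fix a k assume ak: "a < n" "k < n"
      have "E (\<Sum>i<m. S i \<odot> T i) a k = (\<Sum>i<m * n. c a i \<cdot> stack T i k)"
        unfolding prod[OF ak]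
      proof (rule sum.cong)
        fix i assume "i \<in> {..<m * n}"
        then show "E (S (i div n)) a (i mod n) \<cdot> stack T i k = c a i \<cdot> stack T i k"
          using ak by (subst S(2)) (auto simp: less_mult_imp_div_less)
      qed simp
      then show "E (\<Sum>i<m. S i \<odot> T i) a k = E unit' a k"
        using c(2)[OF ak] E_unit[OF ak] by auto
    qed
    then show "big.left_invertible (\<lambda>i k. T i) m 1"
      using S(1) by (auto simp: big.left_invertible_def big.row_span_def intro!: exI[of _ S])
  qed
qed

lemma unstack:
  assumes M: "\<forall>i<m * n. \<forall>k<n. M i k \<in> C"
  shows "\<exists>T. (\<forall>i<m. T i \<in> C') \<and> (\<forall>i<m * n. \<forall>k<n. stack T i k = M i k)"
proof -
  have "\<exists>x\<in>C'. \<forall>a<n. \<forall>b<n. E x a b = M (i * n + a) b" if "i < m" for i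
  proof (rule E_surj)
    fix a b assume "a < n" "b < n"
    have "i * n + a < Suc i * n" using \<open>a < n\<close> by simp
    also have "\<dots> \<le> m * n" using that by (intro mult_right_mono) auto
    finally show "M (i * n + a) b \<in> C" using M \<open>b < n\<close> by simp
  qed
  then have "\<forall>i. \<exists>x. i < m \<longrightarrow> x \<in> C' \<and> (\<forall>a<n. \<forall>b<n. E x a b = M (i * n + a) b)"
    by blast
  from choice[OF this] obtain T where T: "\<And>i. i < m \<Longrightarrow> T i \<in> C'"
    "\<And>i a b. i < m \<Longrightarrow> a < n \<Longrightarrow> b < n \<Longrightarrow> E (T i) a b = M (i * n + a) b"
    by blast
  have "stack T i k = M i k" if "i < m * n" "k < n" for i k
    unfolding stack_def using that by (subst T(2)) (auto simp: less_mult_imp_div_less)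
  then show ?thesis using T(1) by (intro exI[of _ T]) simp
qed

lemma stack_mem:
  assumes "\<And>i. i < m \<Longrightarrow> T i \<in> C'" "i < m * n" "k < n"
  shows "stack T i k \<in> C"
  unfolding stack_def using assms by (intro E_mem) (auto simp: less_mult_imp_div_less)

lemma left_invertibles_dense_stack:
  assumes "0 < n"
  shows "big.left_invertibles_dense m 1 \<longleftrightarrow> entry.left_invertibles_dense (m * n) n"
proof
  assume big: "big.left_invertibles_dense m 1"
  show "entry.left_invertibles_dense (m * n) n"
    unfolding entry.left_invertibles_dense_def
  proof (intro allI impI)
    fix M and \<epsilon> :: real
    assume M: "\<forall>i<m * n. \<forall>k<n. M i k \<in> C" and "\<epsilon> > 0"
    obtain S where S: "\<And>i. i < m \<Longrightarrow> S i \<in> C'" "\<And>i k. i < m * n \<Longrightarrow> k < n \<Longrightarrow> stack S i k = M i k"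
      using unstack[OF M] by blast
    obtain T' where T': "\<forall>i<m. \<forall>k<1::nat. T' i k \<in> C'" "big.left_invertible T' m 1"
      "\<forall>i<m. \<forall>k<1::nat. norm (T' i k - S i) < \<epsilon>"
      using big[unfolded big.left_invertibles_dense_def, rule_format, of "\<lambda>i k. S i" \<epsilon>] S \<open>\<epsilon> > 0\<close>
      by auto
    define T where "T = (\<lambda>i. T' i 0)"
    have T: "\<And>i. i < m \<Longrightarrow> T i \<in> C'" "\<And>i. i < m \<Longrightarrow> norm (T i - S i) < \<epsilon>"
      using T' by (auto simp: T_def)
    have "big.left_invertible (\<lambda>i k. T i) m 1"
      using T'(2) by (simp add: T_def big.left_invertible_def big.row_span_def)
    then have "entry.left_invertible (stack T) (m * n) n"
      using left_invertible_stack[of m T] T by simp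
    moreover have "norm (stack T i k - M i k) < \<epsilon>" if "i < m * n" "k < n" for i k
    proof -
      have i: "i div n < m" "i mod n < n" using that \<open>0 < n\<close> by (auto simp: less_mult_imp_div_less)
      have "stack T i k - M i k = E (T (i div n) - S (i div n)) (i mod n) k"
        using S(2)[OF that] by (simp add: stack_def E_diff)
      then show ?thesis
        using norm_E_le[OF i(2) that(2), of "T (i div n) - S (i div n)"] T(2)[OF i(1)] by simp
    qed
    moreover have "stack T i k \<in> C" if "i < m * n" "k < n" for i k
      using T(1) that by (rule stack_mem)
    ultimately show "\<exists>M'. (\<forall>i<m * n. \<forall>k<n. M' i k \<in> C) \<and> entry.left_invertible M' (m * n) n \<and>
       (\<forall>i<m * n. \<forall>k<n. norm (M' i k - M i k) < \<epsilon>)"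
      by blast
  qed
next
  assume small: "entry.left_invertibles_dense (m * n) n"
  show "big.left_invertibles_dense m 1"
    unfolding big.left_invertibles_dense_def
  proof (intro allI impI)
    fix S :: "nat \<Rightarrow> nat \<Rightarrow> 's" and \<epsilon> :: real
    assume S: "\<forall>i<m. \<forall>k<1. S i k \<in> C'" and "\<epsilon> > 0"
    define \<eta> where "\<eta> = \<epsilon> / (real n * real n)"
    have "\<eta> > 0" using \<open>\<epsilon> > 0\<close> \<open>0 < n\<close> by (simp add: \<eta>_def)
    have "\<forall>i<m * n. \<forall>k<n. stack (\<lambda>i. S i 0) i k \<in> C"
      using S by (auto intro: stack_mem)
    then obtain M where M: "\<And>i k. i < m * n \<Longrightarrow> k < n \<Longrightarrow> M i k \<in> C"
      "entry.left_invertible M (m * n) n"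
      "\<And>i k. i < m * n \<Longrightarrow> k < n \<Longrightarrow> norm (M i k - stack (\<lambda>i. S i 0) i k) < \<eta>"
      using small[unfolded entry.left_invertibles_dense_def, rule_format,
          of "stack (\<lambda>i. S i 0)" \<eta>] \<open>\<eta> > 0\<close> by blast
    have idx: "i * n + a < m * n" if "i < m" "a < n" for i a
    proof -
      have "i * n + a < Suc i * n" using \<open>a < n\<close> by simp
      also have "\<dots> \<le> m * n" using that by (intro mult_right_mono) auto
      finally show ?thesis .
    qed
    have "\<forall>i<m * n. \<forall>k<n. M i k \<in> C" using M(1) by blast
    then obtain T where T: "\<And>i. i < m \<Longrightarrow> T i \<in> C'" "\<And>i k. i < m * n \<Longrightarrow> k < n \<Longrightarrow> stack T i k = M i k"
      using unstack[of m M] by blast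
    have "entry.left_invertible (stack T) (m * n) n"
      using M(2) T(2) unfolding entry.left_invertible_def entry.row_span_def by simp
    then have "big.left_invertible (\<lambda>i k. T i) m 1"
      using left_invertible_stack[of m T] T by simp
    moreover have "norm (T i - S i 0) < \<epsilon>" if "i < m" for i
    proof -
      have "norm (T i - S i 0) \<le> (\<Sum>a<n. \<Sum>b<n. norm (E (T i - S i 0) a b))"
        by (rule norm_le_E)
      also have "\<dots> < (\<Sum>a<n. \<Sum>b<n. \<eta>)"
      proof (intro sum_strict_mono)
        fix a b assume ab: "a \<in> {..<n}" "b \<in> {..<n}"
        have "E (T i - S i 0) a b = M (i * n + a) b - stack (\<lambda>i. S i 0) (i * n + a) b"
          using T(2)[OF idx[of i a], of b] ab that by (simp add: E_diff stack_def)
        then show "norm (E (T i - S i 0) a b) < \<eta>"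
          using M(3)[OF idx] ab that by simp
      qed (use \<open>0 < n\<close> in auto)
      also have "\<dots> = \<epsilon>" using \<open>0 < n\<close> by (simp add: \<eta>_def)
      finally show ?thesis .
    qed
    ultimately show "\<exists>M'. (\<forall>i<m. \<forall>k<1. M' i k \<in> C') \<and> big.left_invertible M' m 1 \<and>
       (\<forall>i<m. \<forall>k<1. norm (M' i k - S i k) < \<epsilon>)"
      using T(1) by (intro exI[of _ "\<lambda>i k. T i"]) auto
  qed
qed

text \<open>Stacking turns an \<open>m\<close>-tuple into an \<open>m n \<times> n\<close> matrix, and \<open>m n = (n (m - 1) + 1) + (n - 1)\<close>.\<close>

corollary left_invertibles_dense_big_iff:
  assumes "0 < n" "0 < m"
  shows "big.left_invertibles_dense m 1 \<longleftrightarrow> entry.left_invertibles_dense (n * (m - 1) + 1) 1"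
proof -
  obtain n' m' where nm: "n = Suc n'" "m = Suc m'"
    using assms by (auto simp: gr0_conv_Suc)
  have "m * n = (n * (m - 1) + 1) + n'"
    by (simp add: nm algebra_simps)
  then have "entry.left_invertibles_dense (m * n) n \<longleftrightarrow> entry.left_invertibles_dense (n * (m - 1) + 1) 1"
    using entry.left_invertibles_dense_iff[of "n * (m - 1) + 1" n'] nm(1) by (simp only:)
  then show ?thesis
    using left_invertibles_dense_stack[OF assms(1), of m] by simp
qed

end

section \<open>Operators on a Banach space and on its powers\<close>

lemma bounded_ops_simps:
  "carrier (bounded_ops TYPE('a::complex_normed_vector)) = {T. \<forall>c x. blinfun_apply T (c *\<^sub>C x) = c *\<^sub>C blinfun_apply T x}"
  "S \<otimes>\<^bsub>bounded_ops TYPE('a)\<^esub> T = S o\<^sub>L T" "\<one>\<^bsub>bounded_ops TYPE('a)\<^esub> = id_blinfun"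
  "\<zero>\<^bsub>bounded_ops TYPE('a)\<^esub> = 0" "S \<oplus>\<^bsub>bounded_ops TYPE('a)\<^esub> T = S + T"
  "nrm (bounded_ops TYPE('a)) = norm"
  by (simp_all add: bounded_ops_def)

abbreviation clops :: "'a::complex_normed_vector itself \<Rightarrow> ('a \<Rightarrow>\<^sub>L 'a) set"
  where "clops X \<equiv> carrier (bounded_ops X)"

text \<open>The equation \<open>S x = y\<close> is a fixed-point problem for a contraction with constant \<open>1/2\<close>.\<close>

lemma inverse_near_id:
  fixes S :: "'a::complex_banach \<Rightarrow>\<^sub>L 'a"
  assumes S: "S \<in> clops TYPE('a)" and near: "norm (S - id_blinfun) \<le> 1/2"
  shows "\<exists>R\<in>clops TYPE('a). R o\<^sub>L S = id_blinfun \<and> S o\<^sub>L R = id_blinfun \<and> norm R \<le> 2"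
proof -
  have lin: "S (c *\<^sub>C x) = c *\<^sub>C S x" for c x
    using S by (simp add: bounded_ops_simps)
  have small: "norm (S x - x) \<le> norm x / 2" for x
  proof -
    have "norm ((S - id_blinfun) x) \<le> norm (S - id_blinfun) * norm x"
      by (rule norm_blinfun)
    also have "\<dots> \<le> (1/2) * norm x"
      using near by (rule mult_right_mono) simp
    finally show ?thesis by (simp add: blinfun.diff_left)
  qed
  have ex1: "\<exists>!x. S x = y" for y
  proof -
    have "\<exists>!x. x - (S x - y) = x"
    proof (rule banach_fix_type[of "1/2"])
      show "\<forall>x z. dist (x - (S x - y)) (z - (S z - y)) \<le> 1/2 * dist x z"
      proof (intro allI)
        fix x z
        have "dist (x - (S x - y)) (z - (S z - y)) = norm (S (x - z) - (x - z))"
          unfolding dist_norm by (subst norm_minus_commute) (simp add: blinfun.diff_right algebra_simps)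
        then show "dist (x - (S x - y)) (z - (S z - y)) \<le> 1/2 * dist x z"
          using small[of "x - z"] by (simp add: dist_norm)
      qed
    qed auto
    moreover have "x - (S x - y) = x \<longleftrightarrow> S x = y" for x
      by auto
    ultimately show ?thesis by simp
  qed
  define r where "r y = (THE x. S x = y)" for y
  have r: "S (r y) = y" for y
    unfolding r_def by (rule theI'[OF ex1])
  have r_eq: "r y = x" if "S x = y" for x y
    unfolding r_def using ex1 that by (rule the1_equality)
  have norm_r: "norm (r y) \<le> norm y * 2" for y
  proof -
    have "norm (r y) - norm (S (r y)) \<le> norm (S (r y) - r y)"
      by (metis norm_minus_commute norm_triangle_ineq2)
    then show ?thesis using small[of "r y"] r[of y] by simp
  qed
  have bl: "bounded_linear r"
  proof (rule bounded_linear_intro[where K = 2])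
    show "r (x + y) = r x + r y" for x y
      by (rule r_eq) (simp add: blinfun.add_right r)
    show "r (c *\<^sub>R x) = c *\<^sub>R r x" for c x
      by (rule r_eq) (simp add: blinfun.scaleR_right r)
  qed (rule norm_r)
  define R where "R = Blinfun r"
  have R: "blinfun_apply R = r"
    unfolding R_def by (rule bounded_linear_Blinfun_apply[OF bl])
  have "R \<in> clops TYPE('a)"
    by (auto simp: bounded_ops_simps R lin r intro!: r_eq)
  moreover have "R o\<^sub>L S = id_blinfun" "S o\<^sub>L R = id_blinfun"
    by (auto intro!: blinfun_eqI r_eq simp: R r)
  moreover have "norm R \<le> 2"
    using norm_r by (intro norm_blinfun_bound) (auto simp: R mult.commute)
  ultimately show ?thesis by blast
qed

interpretation ops: unital_normed_ring
  "clops TYPE('a::complex_banach)" "(o\<^sub>L)" id_blinfun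
proof (rule unital_normed_ring.intro)
  show "bounded_bilinear ((o\<^sub>L) :: ('a::complex_banach \<Rightarrow>\<^sub>L 'a) \<Rightarrow> ('a \<Rightarrow>\<^sub>L 'a) \<Rightarrow> _)"
    by (rule bounded_bilinear_blinfun_compose)
qed (use inverse_near_id in \<open>auto simp: bounded_ops_simps blinfun.diff_left blinfun.diff_right
    cvec.scale_right_diff_distrib intro: blinfun_eqI\<close>)

interpretation ops_op: unital_normed_ring
  "clops TYPE('a::complex_banach)" "\<lambda>S T. T o\<^sub>L S" id_blinfun
proof (rule unital_normed_ring.intro)
  show "bounded_bilinear (\<lambda>S T :: 'a::complex_banach \<Rightarrow>\<^sub>L 'a. T o\<^sub>L S)"
    by (rule bounded_bilinear.flip[OF bounded_bilinear_blinfun_compose])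
qed (use inverse_near_id in \<open>auto simp: ops.mul_mem ops.diff_mem intro: blinfun_eqI\<close>)

lemma finsum_bounded_ops:
  assumes "finite I" "\<And>i. i \<in> I \<Longrightarrow> f i \<in> clops TYPE('a::complex_normed_vector)"
  shows "(\<Oplus>\<^bsub>bounded_ops TYPE('a)\<^esub>i\<in>I. f i) = sum f I"
proof -
  interpret ring "bounded_ops TYPE('a)" by (rule ring_bounded_ops)
  show ?thesis
    using assms by (induction I rule: finite_induct) (auto simp: bounded_ops_simps)
qed

lemma minus_bounded_ops:
  assumes "S \<in> clops TYPE('a::complex_normed_vector)" "T \<in> clops TYPE('a)"
  shows "S \<ominus>\<^bsub>bounded_ops TYPE('a)\<^esub> T = S - T"
proof -
  interpret ring "bounded_ops TYPE('a)" by (rule ring_bounded_ops)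
  have "- T \<in> clops TYPE('a)"
    using assms by (simp add: bounded_ops_simps blinfun.minus_left)
  then have "\<ominus>\<^bsub>bounded_ops TYPE('a)\<^esub> T = - T"
    using assms by (intro minus_equality) (auto simp: bounded_ops_simps)
  then show ?thesis
    by (simp add: a_minus_def bounded_ops_simps)
qed

text \<open>A left ideal is the whole ring as soon as it contains the unit.\<close>

lemma (in unital_normed_ring) left_ideal_eq_iff:
  fixes T :: "nat \<Rightarrow> 'r"
  assumes T: "\<And>i. i < m \<Longrightarrow> T i \<in> C"
  shows "{\<Sum>i<m. b i \<cdot> T i | b. b \<in> {..<m} \<rightarrow> C} = C \<longleftrightarrow>
    (\<exists>S. (\<forall>i<m. S i \<in> C) \<and> unit = (\<Sum>i<m. S i \<cdot> T i))" (is "?I = C \<longleftrightarrow> ?R")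
proof
  assume "?I = C"
  then have "unit \<in> ?I" using unit_mem by simp
  then show ?R by (auto simp: Pi_iff)
next
  assume ?R
  then obtain S where S: "\<And>i. i < m \<Longrightarrow> S i \<in> C" "unit = (\<Sum>i<m. S i \<cdot> T i)" by auto
  have "x \<in> ?I" if x: "x \<in> C" for x
  proof (intro CollectI exI conjI)
    have "(\<Sum>i<m. (x \<cdot> S i) \<cdot> T i) = x \<cdot> (\<Sum>i<m. S i \<cdot> T i)"
      by (simp only: mul_assoc mul.sum_right)
    then show "x = (\<Sum>i<m. (x \<cdot> S i) \<cdot> T i)" by (simp only: S(2)[symmetric] unit_right)
    show "(\<lambda>i. x \<cdot> S i) \<in> {..<m} \<rightarrow> C" using S(1) x by (auto intro!: mul_mem)
  qed
  moreover have "?I \<subseteq> C"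
    using T by (auto intro!: sum_mem mul_mem)
  ultimately show "?I = C" by blast
qed

lemma Lg_bounded_ops:
  fixes T :: "nat \<Rightarrow> 'a::complex_banach \<Rightarrow>\<^sub>L 'a"
  assumes T: "T \<in> {..<m} \<rightarrow>\<^sub>E clops TYPE('a)"
  shows "T \<in> Lg (bounded_ops TYPE('a)) m \<longleftrightarrow>
    (\<exists>S. (\<forall>i<m. S i \<in> clops TYPE('a)) \<and> id_blinfun = (\<Sum>i<m. S i o\<^sub>L T i))"
proof -
  let ?A = "bounded_ops TYPE('a)"
  have Tc: "\<And>i. i < m \<Longrightarrow> T i \<in> carrier ?A" using T by auto
  have "(\<Oplus>\<^bsub>?A\<^esub>i\<in>{..<m}. b i \<otimes>\<^bsub>?A\<^esub> T i) = (\<Sum>i<m. b i o\<^sub>L T i)"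
    if "b \<in> {..<m} \<rightarrow> carrier ?A" for b
    using that Tc by (subst finsum_bounded_ops) (auto simp: bounded_ops_simps(2) intro!: ops.mul_mem)
  then have "{\<Oplus>\<^bsub>?A\<^esub>i\<in>{..<m}. b i \<otimes>\<^bsub>?A\<^esub> T i | b. b \<in> {..<m} \<rightarrow> carrier ?A} =
      {\<Sum>i<m. b i o\<^sub>L T i | b. b \<in> {..<m} \<rightarrow> carrier ?A}"
    by (metis (no_types, lifting))
  then show ?thesis
    unfolding Lg_def mem_Collect_eq using T ops.left_ideal_eq_iff[of m T, OF Tc] by simp
qed

lemma Rg_bounded_ops:
  fixes T :: "nat \<Rightarrow> 'a::complex_banach \<Rightarrow>\<^sub>L 'a"
  assumes T: "T \<in> {..<m} \<rightarrow>\<^sub>E clops TYPE('a)"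
  shows "T \<in> Rg (bounded_ops TYPE('a)) m \<longleftrightarrow>
    (\<exists>S. (\<forall>i<m. S i \<in> clops TYPE('a)) \<and> id_blinfun = (\<Sum>i<m. T i o\<^sub>L S i))"
proof -
  let ?A = "bounded_ops TYPE('a)"
  have Tc: "\<And>i. i < m \<Longrightarrow> T i \<in> carrier ?A" using T by auto
  have "(\<Oplus>\<^bsub>?A\<^esub>i\<in>{..<m}. T i \<otimes>\<^bsub>?A\<^esub> b i) = (\<Sum>i<m. T i o\<^sub>L b i)"
    if "b \<in> {..<m} \<rightarrow> carrier ?A" for b
    using that Tc by (subst finsum_bounded_ops) (auto simp: bounded_ops_simps(2) intro!: ops.mul_mem)
  then have "{\<Oplus>\<^bsub>?A\<^esub>i\<in>{..<m}. T i \<otimes>\<^bsub>?A\<^esub> b i | b. b \<in> {..<m} \<rightarrow> carrier ?A} =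
      {\<Sum>i<m. T i o\<^sub>L b i | b. b \<in> {..<m} \<rightarrow> carrier ?A}"
    by (metis (no_types, lifting))
  then show ?thesis
    unfolding Rg_def mem_Collect_eq using T ops_op.left_ideal_eq_iff[of m T, OF Tc] by simp
qed

lemma dense_tuples_bounded_ops:
  assumes G: "\<And>T. T \<in> {..<m} \<rightarrow>\<^sub>E clops TYPE('a::complex_banach) \<Longrightarrow> T \<in> G \<longleftrightarrow> P T"
    and sub: "G \<subseteq> {..<m} \<rightarrow>\<^sub>E clops TYPE('a)"
    and P: "\<And>T T'. (\<And>i. i < m \<Longrightarrow> T i = T' i) \<Longrightarrow> P T \<Longrightarrow> P T'"
  shows "dense_tuples (bounded_ops TYPE('a)) m G \<longleftrightarrow>
    (\<forall>T. (\<forall>i<m. T i \<in> clops TYPE('a)) \<longrightarrow> (\<forall>\<epsilon>>0.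
      \<exists>T'. (\<forall>i<m. T' i \<in> clops TYPE('a)) \<and> P T' \<and> (\<forall>i<m. norm (T' i - T i) < \<epsilon>)))"
    (is "?L \<longleftrightarrow> ?R")
proof
  assume L: ?L
  show ?R
  proof (intro allI impI)
    fix T and \<epsilon> :: real
    assume T: "\<forall>i<m. T i \<in> clops TYPE('a)" and \<epsilon>: "\<epsilon> > 0"
    have "restrict T {..<m} \<in> {..<m} \<rightarrow>\<^sub>E clops TYPE('a)" using T by auto
    then obtain T' where T': "T' \<in> G"
      "\<forall>i<m. nrm (bounded_ops TYPE('a)) (T' i \<ominus>\<^bsub>bounded_ops TYPE('a)\<^esub> restrict T {..<m} i) < \<epsilon>"
      using L \<epsilon> unfolding dense_tuples_def by blast
    have "T' \<in> {..<m} \<rightarrow>\<^sub>E clops TYPE('a)" using T' sub by blast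
    then show "\<exists>T'. (\<forall>i<m. T' i \<in> clops TYPE('a)) \<and> P T' \<and> (\<forall>i<m. norm (T' i - T i) < \<epsilon>)"
      using T' G[of T'] T by (intro exI[of _ T']) (auto simp: minus_bounded_ops bounded_ops_simps(6) PiE_iff)
  qed
next
  assume R: ?R
  show ?L
    unfolding dense_tuples_def
  proof (intro ballI allI impI)
    fix T and \<epsilon> :: real
    assume T: "T \<in> {..<m} \<rightarrow>\<^sub>E clops TYPE('a)" and \<epsilon>: "\<epsilon> > 0"
    have "\<forall>i<m. T i \<in> clops TYPE('a)" using T by auto
    then obtain T' where T': "\<forall>i<m. T' i \<in> clops TYPE('a)" "P T'"
      "\<forall>i<m. norm (T' i - T i) < \<epsilon>"
      using R \<epsilon> by blast
    let ?T = "restrict T' {..<m}"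
    have "?T \<in> {..<m} \<rightarrow>\<^sub>E clops TYPE('a)" using T' by auto
    moreover have "P ?T" by (rule P[OF _ T'(2)]) simp
    ultimately have "?T \<in> G" using G by blast
    then show "\<exists>T'\<in>G. \<forall>i<m. nrm (bounded_ops TYPE('a)) (T' i \<ominus>\<^bsub>bounded_ops TYPE('a)\<^esub> T i) < \<epsilon>"
      using T' T by (intro bexI[of _ ?T]) (auto simp: minus_bounded_ops bounded_ops_simps(6) PiE_iff)
  qed
qed

lemma dense_Lg_iff:
  "dense_tuples (bounded_ops TYPE('a::complex_banach)) m (Lg (bounded_ops TYPE('a)) m) \<longleftrightarrow>
   (\<forall>T. (\<forall>i<m. T i \<in> clops TYPE('a)) \<longrightarrow> (\<forall>\<epsilon>>0.
      \<exists>T'. (\<forall>i<m. T' i \<in> clops TYPE('a)) \<and>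
      (\<exists>S. (\<forall>i<m. S i \<in> clops TYPE('a)) \<and> id_blinfun = (\<Sum>i<m. S i o\<^sub>L T' i)) \<and>
      (\<forall>i<m. norm (T' i - T i) < \<epsilon>)))"
  by (rule dense_tuples_bounded_ops) (auto simp: Lg_bounded_ops, auto simp: Lg_def)

lemma dense_Rg_iff:
  "dense_tuples (bounded_ops TYPE('a::complex_banach)) m (Rg (bounded_ops TYPE('a)) m) \<longleftrightarrow>
   (\<forall>T. (\<forall>i<m. T i \<in> clops TYPE('a)) \<longrightarrow> (\<forall>\<epsilon>>0.
      \<exists>T'. (\<forall>i<m. T' i \<in> clops TYPE('a)) \<and>
      (\<exists>S. (\<forall>i<m. S i \<in> clops TYPE('a)) \<and> id_blinfun = (\<Sum>i<m. T' i o\<^sub>L S i)) \<and>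
      (\<forall>i<m. norm (T' i - T i) < \<epsilon>)))"
  by (rule dense_tuples_bounded_ops) (auto simp: Rg_bounded_ops, auto simp: Rg_def)

abbreviation left_dense :: "'a::complex_banach itself \<Rightarrow> nat \<Rightarrow> bool"
  where "left_dense X m \<equiv> unital_normed_ring.left_invertibles_dense
    (clops X) (o\<^sub>L) id_blinfun m 1"

abbreviation right_dense :: "'a::complex_banach itself \<Rightarrow> nat \<Rightarrow> bool"
  where "right_dense X m \<equiv> unital_normed_ring.left_invertibles_dense
    (clops X) (\<lambda>S T. T o\<^sub>L S) id_blinfun m 1"

lemma (in unital_normed_ring) left_invertibles_dense_column:
  "left_invertibles_dense m 1 \<longleftrightarrow>
   (\<forall>T. (\<forall>i<m. T i \<in> C) \<longrightarrow> (\<forall>\<epsilon>>0. \<exists>T'. (\<forall>i<m. T' i \<in> C) \<and>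
      (\<exists>S. (\<forall>i<m. S i \<in> C) \<and> unit = (\<Sum>i<m. S i \<cdot> T' i)) \<and> (\<forall>i<m. norm (T' i - T i) < \<epsilon>)))"
    (is "?L \<longleftrightarrow> ?R")
proof
  assume L: ?L
  show ?R
  proof (intro allI impI)
    fix T and \<epsilon> :: real
    assume "\<forall>i<m. T i \<in> C" "\<epsilon> > 0"
    then obtain M where "\<forall>i<m. \<forall>k<1::nat. M i k \<in> C" "left_invertible M m 1"
      "\<forall>i<m. \<forall>k<1::nat. norm (M i k - T i) < \<epsilon>"
      using L[unfolded left_invertibles_dense_def, rule_format, of "\<lambda>i k. T i" \<epsilon>] by auto
    then show "\<exists>T'. (\<forall>i<m. T' i \<in> C) \<and> (\<exists>S. (\<forall>i<m. S i \<in> C) \<and> unit = (\<Sum>i<m. S i \<cdot> T' i)) \<and>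
        (\<forall>i<m. norm (T' i - T i) < \<epsilon>)"
      by (intro exI[of _ "\<lambda>i. M i 0"]) (auto simp: left_invertible_def row_span_def)
  qed
next
  assume R: ?R
  show ?L
    unfolding left_invertibles_dense_def
  proof (intro allI impI)
    fix M :: "nat \<Rightarrow> nat \<Rightarrow> 'r" and \<epsilon> :: real
    assume "\<forall>i<m. \<forall>k<1. M i k \<in> C" "\<epsilon> > 0"
    then obtain T where T: "\<forall>i<m. T i \<in> C" "\<exists>S. (\<forall>i<m. S i \<in> C) \<and> unit = (\<Sum>i<m. S i \<cdot> T i)"
       "\<forall>i<m. norm (T i - M i 0) < \<epsilon>"
      using R[rule_format, of "\<lambda>i. M i 0" \<epsilon>] by auto
    then show "\<exists>M'. (\<forall>i<m. \<forall>k<1. M' i k \<in> C) \<and> left_invertible M' m 1 \<and>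
       (\<forall>i<m. \<forall>k<1. norm (M' i k - M i k) < \<epsilon>)"
      by (intro exI[of _ "\<lambda>i k. T i"]) (auto simp: left_invertible_def row_span_def)
  qed
qed

lemma dense_Lg_iff_left_invertibles:
  "dense_tuples (bounded_ops TYPE('a::complex_banach)) m (Lg (bounded_ops TYPE('a)) m) \<longleftrightarrow>
    left_dense TYPE('a) m"
  unfolding dense_Lg_iff ops.left_invertibles_dense_column ..

lemma dense_Rg_iff_left_invertibles:
  "dense_tuples (bounded_ops TYPE('a::complex_banach)) m (Rg (bounded_ops TYPE('a)) m) \<longleftrightarrow>
    right_dense TYPE('a) m"
  unfolding dense_Rg_iff ops_op.left_invertibles_dense_column ..

text \<open>Coordinate projections and embeddings of the power \<open>X\<^sup>n\<close>; they cut an operator on \<open>X\<^sup>n\<close> into blocks.\<close>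

definition vproj :: "'n::finite \<Rightarrow> ('a::real_normed_vector ^ 'n) \<Rightarrow>\<^sub>L 'a"
  where "vproj i = Blinfun (\<lambda>x. x $ i)"

definition vinj :: "'n::finite \<Rightarrow> 'a::real_normed_vector \<Rightarrow>\<^sub>L ('a ^ 'n)"
  where "vinj i = Blinfun (axis i)"

lemma norm_axis_eq: "norm (axis i x :: ('a::real_normed_vector) ^ 'n::finite) = norm x"
proof -
  have "L2_set (\<lambda>j. norm (if j = i then x else 0)) UNIV = L2_set (\<lambda>j. if j = i then norm x else 0) UNIV"
    by (rule arg_cong[where f = "\<lambda>f. L2_set f UNIV"]) auto
  then show ?thesis
    by (simp add: norm_vec_def axis_def L2_set_def if_distrib[where f = "\<lambda>t. t\<^sup>2"] cong: if_cong)
qed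

lemma vproj_apply: "blinfun_apply (vproj i) x = x $ i"
  unfolding vproj_def by (simp add: bounded_linear_Blinfun_apply bounded_linear_vec_nth)

lemma vinj_apply: "blinfun_apply (vinj i) x = axis i x"
proof -
  have "bounded_linear (axis i :: 'a \<Rightarrow> 'a ^ 'b)"
    by (rule bounded_linear_intro[where K = 1]) (auto simp: axis_def vec_eq_iff norm_axis_eq[unfolded axis_def])
  then show ?thesis unfolding vinj_def by (simp add: bounded_linear_Blinfun_apply)
qed

lemma norm_vproj_le: "norm (vproj i) \<le> 1"
  by (rule norm_blinfun_bound) (auto simp: vproj_apply Finite_Cartesian_Product.norm_nth_le)

lemma norm_vinj_le: "norm (vinj i) \<le> 1"
  by (rule norm_blinfun_bound) (auto simp: vinj_apply norm_axis_eq)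

lemma sum_axis: "(\<Sum>i\<in>UNIV. axis i (x $ i)) = (x :: ('a::real_normed_vector) ^ 'n::finite)"
  by (simp add: vec_eq_iff axis_def)

definition block :: "(('a::real_normed_vector ^ 'n::finite) \<Rightarrow>\<^sub>L ('a ^ 'n)) \<Rightarrow> 'n \<Rightarrow> 'n \<Rightarrow> 'a \<Rightarrow>\<^sub>L 'a"
  where "block T i j = (vproj i o\<^sub>L T) o\<^sub>L vinj j"

lemma block_apply: "block T i j x = T (axis j x) $ i"
  by (simp add: block_def vproj_apply vinj_apply)

lemma block_diff: "block (S - T) i j = block S i j - block T i j"
  by (rule blinfun_eqI) (simp add: block_apply blinfun.diff_left)

lemma block_compose: "block (S o\<^sub>L T) i j = (\<Sum>k\<in>UNIV. block S i k o\<^sub>L block T k j)"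
proof (rule blinfun_eqI)
  fix x
  have "S (T (axis j x)) = (\<Sum>k\<in>UNIV. S (axis k (T (axis j x) $ k)))"
    by (subst sum_axis[of "T (axis j x)", symmetric]) (simp add: blinfun.sum_right)
  then show "block (S o\<^sub>L T) i j x = (\<Sum>k\<in>UNIV. block S i k o\<^sub>L block T k j) x"
    by (simp add: block_apply blinfun.sum_left)
qed

lemma block_id: "block id_blinfun i j = (if i = j then id_blinfun else 0)"
  by (rule blinfun_eqI) (auto simp: block_apply axis_def)

lemma norm_block_le: "norm (block T i j) \<le> norm T"
proof -
  have "norm (block T i j) \<le> norm (vproj i o\<^sub>L T) * norm (vinj j :: 'a \<Rightarrow>\<^sub>L ('a ^ 'b))"
    unfolding block_def by (rule norm_blinfun_compose)
  also have "\<dots> \<le> (norm (vproj i :: ('a ^ 'b) \<Rightarrow>\<^sub>L 'a) * norm T) * 1"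
    by (intro mult_mono norm_blinfun_compose norm_vinj_le) auto
  also have "\<dots> \<le> (1 * norm T) * 1"
    by (intro mult_right_mono norm_vproj_le) auto
  finally show ?thesis by simp
qed

lemma block_sum_apply: "(\<Sum>j\<in>UNIV. block T i j (x $ j)) = T x $ i"
proof -
  have "T x = (\<Sum>j\<in>UNIV. T (axis j (x $ j)))"
    by (subst sum_axis[of x, symmetric]) (simp add: blinfun.sum_right)
  then show ?thesis by (simp add: block_apply)
qed

lemma norm_le_block: "norm T \<le> (\<Sum>i\<in>UNIV. \<Sum>j\<in>UNIV. norm (block T i j))"
proof (rule norm_blinfun_bound)
  fix x
  have "norm (T x) \<le> (\<Sum>i\<in>UNIV. norm (T x $ i))"
    unfolding norm_vec_def by (rule L2_set_le_sum) simp
  also have "\<dots> \<le> (\<Sum>i\<in>UNIV. \<Sum>j\<in>UNIV. norm (block T i j) * norm x)"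
  proof (rule sum_mono)
    fix i
    have "norm (T x $ i) \<le> (\<Sum>j\<in>UNIV. norm (block T i j (x $ j)))"
      unfolding block_sum_apply[symmetric] by (rule norm_sum)
    also have "\<dots> \<le> (\<Sum>j\<in>UNIV. norm (block T i j) * norm x)"
      by (intro sum_mono order_trans[OF norm_blinfun] mult_left_mono Finite_Cartesian_Product.norm_nth_le) auto
    finally show "norm (T x $ i) \<le> (\<Sum>j\<in>UNIV. norm (block T i j) * norm x)" .
  qed
  finally show "norm (T x) \<le> (\<Sum>i\<in>UNIV. \<Sum>j\<in>UNIV. norm (block T i j)) * norm x"
    by (simp add: sum_distrib_right)
qed (auto intro!: sum_nonneg)

lemma block_mem:
  assumes "T \<in> clops TYPE('a::complex_normed_vector ^ 'n::finite)"
  shows "block T i j \<in> clops TYPE('a)"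
proof -
  have "axis j (c *\<^sub>C x) = c *\<^sub>C (axis j x :: 'a ^ 'n)" for c x
    by (auto simp: axis_def scaleC_vec_def vec_eq_iff)
  moreover have "(c *\<^sub>C y) $ i = c *\<^sub>C (y $ i)" for c and y :: "'a ^ 'n"
    by (simp add: scaleC_vec_def)
  ultimately show ?thesis
    using assms by (simp add: bounded_ops_simps block_apply)
qed

lemma block_surj:
  fixes F :: "'n::finite \<Rightarrow> 'n \<Rightarrow> 'a::complex_normed_vector \<Rightarrow>\<^sub>L 'a"
  assumes "\<And>i j. F i j \<in> clops TYPE('a)"
  shows "\<exists>T\<in>clops TYPE('a ^ 'n). \<forall>i j. block T i j = F i j"
proof -
  define T where "T = (\<Sum>i\<in>UNIV. \<Sum>j\<in>UNIV. (vinj i o\<^sub>L F i j) o\<^sub>L vproj j)"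
  have T: "T x $ k = (\<Sum>j\<in>UNIV. F k j (x $ j))" for x k
  proof -
    have "T x $ k = (\<Sum>i\<in>UNIV. \<Sum>j\<in>UNIV. if k = i then F i j (x $ j) else 0)"
      by (simp add: T_def blinfun.sum_left vinj_apply vproj_apply axis_def)
    also have "\<dots> = (\<Sum>i\<in>UNIV. if k = i then \<Sum>j\<in>UNIV. F k j (x $ j) else 0)"
      by (rule sum.cong) auto
    finally show ?thesis by simp
  qed
  have "T (c *\<^sub>C x) = c *\<^sub>C T x" for c x
    using assms by (simp add: vec_eq_iff T scaleC_vec_def bounded_ops_simps cvec.scale_sum_right)
  moreover have "block T i j = F i j" for i j
    by (rule blinfun_eqI)
      (simp add: block_apply T axis_def if_distrib[where f = "\<lambda>x. blinfun_apply _ x"] cong: if_cong)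
  ultimately show ?thesis
    by (auto simp: bounded_ops_simps)
qed

text \<open>The blocks make the operators on \<open>X\<^sup>n\<close> a matrix ring over those on \<open>X\<close>. For the opposite rings the
entry with indices \<open>a\<close>, \<open>b\<close> is the block with indices \<open>b\<close>, \<open>a\<close>.\<close>

lemma left_invertibles_dense_vec:
  assumes "0 < m"
  shows "left_dense TYPE('a::complex_banach ^ 'n::finite) m \<longleftrightarrow>
      left_dense TYPE('a) (CARD('n) * (m - 1) + 1)"
    and "right_dense TYPE('a ^ 'n) m \<longleftrightarrow>
      right_dense TYPE('a) (CARD('n) * (m - 1) + 1)"
proof -
  let ?n = "CARD('n)"
  obtain h :: "nat \<Rightarrow> 'n" where h: "bij_betw h {..<?n} UNIV"
    using ex_bij_betw_nat_finite[of "UNIV :: 'n set"] by (auto simp: lessThan_atLeast0)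
  define g where "g = the_inv_into {..<?n} h"
  have g: "g i < ?n" "h (g i) = i" for i
    using bij_betw_the_inv_into[OF h] f_the_inv_into_f_bij_betw[OF h, of i]
    by (auto simp: g_def bij_betw_def)
  have gh: "g (h a) = a" if "a < ?n" for a
    unfolding g_def using h that by (intro the_inv_into_f_f) (auto simp: bij_betw_def)
  have hinj: "h a = h b \<longleftrightarrow> a = b" if "a < ?n" "b < ?n" for a b
    using gh that by metis
  note hsum = sum.reindex_bij_betw[OF h]
  have surj: "\<exists>x\<in>clops TYPE('a ^ 'n). \<forall>a<?n. \<forall>b<?n. block x (h a) (h b) = F a b"
    if "\<And>a b. a < ?n \<Longrightarrow> b < ?n \<Longrightarrow> F a b \<in> clops TYPE('a)" for F
  proof -
    have "F (g i) (g j) \<in> clops TYPE('a)" for i j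
      using that g by blast
    then obtain T where "T \<in> clops TYPE('a ^ 'n)" "\<forall>i j. block T i j = F (g i) (g j)"
      using block_surj[of "\<lambda>i j. F (g i) (g j)"] by blast
    then show ?thesis using gh by (intro bexI[of _ T]) auto
  qed
  interpret L: matrix_ring "clops TYPE('a)" "(o\<^sub>L)" id_blinfun
    "clops TYPE('a ^ 'n)" "(o\<^sub>L)" id_blinfun ?n "\<lambda>T a b. block T (h a) (h b)"
  proof
    show "norm x \<le> (\<Sum>a<?n. \<Sum>b<?n. norm (block x (h a) (h b)))" for x :: "('a ^ 'n) \<Rightarrow>\<^sub>L ('a ^ 'n)"
      using norm_le_block[of x] by (simp add: hsum[of "\<lambda>i. \<Sum>j\<in>UNIV. norm (block x i j)"]
          hsum[of "\<lambda>j. norm (block x _ j)"])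
    show "block (x o\<^sub>L y) (h a) (h b) = (\<Sum>c<?n. block x (h a) (h c) o\<^sub>L block y (h c) (h b))" for x y a b
      using hsum[of "\<lambda>k. block x (h a) k o\<^sub>L block y k (h b)"] by (simp add: block_compose)
  qed (use surj in \<open>auto simp: block_diff block_id hinj block_mem norm_block_le\<close>)
  show "left_dense TYPE('a ^ 'n) m \<longleftrightarrow>
      left_dense TYPE('a) (?n * (m - 1) + 1)"
    by (rule L.left_invertibles_dense_big_iff) (use assms in auto)
  interpret R: matrix_ring "clops TYPE('a)" "\<lambda>S T. T o\<^sub>L S" id_blinfun
    "clops TYPE('a ^ 'n)" "\<lambda>S T. T o\<^sub>L S" id_blinfun ?n "\<lambda>T a b. block T (h b) (h a)"
  proof
    show "norm x \<le> (\<Sum>a<?n. \<Sum>b<?n. norm (block x (h b) (h a)))" for x :: "('a ^ 'n) \<Rightarrow>\<^sub>L ('a ^ 'n)"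
      using L.norm_le_E[of x] by (subst sum.swap)
    show "\<exists>x\<in>clops TYPE('a ^ 'n). \<forall>a<?n. \<forall>b<?n. block x (h b) (h a) = F a b"
      if "\<And>a b. a < ?n \<Longrightarrow> b < ?n \<Longrightarrow> F a b \<in> clops TYPE('a)" for F
    proof -
      have "\<exists>x\<in>clops TYPE('a ^ 'n). \<forall>a<?n. \<forall>b<?n. block x (h a) (h b) = F b a"
        using that by (intro surj)
      then obtain x where "x \<in> clops TYPE('a ^ 'n)"
        "\<forall>a<?n. \<forall>b<?n. block x (h a) (h b) = F b a" by blast
      then show ?thesis by (intro bexI[of _ x]) auto
    qed
  qed (use L.E_mul in \<open>auto simp: block_diff block_id hinj block_mem norm_block_le\<close>)
  show "right_dense TYPE('a ^ 'n) m \<longleftrightarrow>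
      right_dense TYPE('a) (?n * (m - 1) + 1)"
    by (rule R.left_invertibles_dense_big_iff) (use assms in auto)
qed

section \<open>Partial sums of a Schauder basis\<close>

text \<open>Baire's theorem for a countable union.\<close>

lemma complete_space_cover_interior:
  fixes A :: "nat \<Rightarrow> 'a::{complete_space} set"
  assumes "(\<Union>k. A k) = UNIV"
  obtains k x r where "0 < r" "ball x r \<subseteq> closure (A k)"
proof -
  have "\<exists>k. interior (closure (A k)) \<noteq> {}"
  proof (rule ccontr)
    assume "\<nexists>k. interior (closure (A k)) \<noteq> {}"
    then have "(euclidean :: 'a topology) interior_of \<Union>(range (\<lambda>k. closure (A k))) = {}"
      by (intro Baire_category_alt) (auto simp: completely_metrizable_space_euclidean)
    moreover have "\<Union>(range (\<lambda>k. closure (A k))) = UNIV"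
    proof -
      have "x \<in> \<Union>(range (\<lambda>k. closure (A k)))" for x
      proof -
        have "x \<in> (\<Union>k. A k)" using assms by simp
        then obtain k where "x \<in> A k" by blast
        then have "x \<in> closure (A k)" by (rule subsetD[OF closure_subset])
        then show ?thesis by blast
      qed
      then show ?thesis by blast
    qed
    ultimately show False by simp
  qed
  then obtain k x where "x \<in> interior (closure (A k))" by blast
  then obtain r where "0 < r" "ball x r \<subseteq> closure (A k)"
    unfolding mem_interior by blast
  then show thesis by (rule that)
qed

locale schauder_space =
  fixes b :: "nat \<Rightarrow> 'a::complex_banach"
  assumes schauder: "schauder_basis b"
begin

definition coord :: "'a \<Rightarrow> nat \<Rightarrow> complex"
  where "coord x = (THE a. (\<lambda>n. a n *\<^sub>C b n) sums x)"

definition partial :: "nat \<Rightarrow> 'a \<Rightarrow> 'a"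
  where "partial N x = (\<Sum>n<N. coord x n *\<^sub>C b n)"

lemma coord_sums: "(\<lambda>n. coord x n *\<^sub>C b n) sums x"
proof -
  have "\<exists>!a. (\<lambda>n. a n *\<^sub>C b n) sums x"
    using schauder by (simp add: schauder_basis_def)
  from theI'[OF this] show ?thesis
    unfolding coord_def .
qed

lemma coord_unique: "(\<lambda>n. a n *\<^sub>C b n) sums x \<Longrightarrow> coord x = a"
  using schauder coord_sums unfolding schauder_basis_def by blast

lemma partial_tendsto: "(\<lambda>N. partial N x) \<longlonglongrightarrow> x"
  using coord_sums unfolding sums_def partial_def .

lemma coord_add: "coord (x + y) = (\<lambda>n. coord x n + coord y n)"
  by (rule coord_unique) (use sums_add[OF coord_sums[of x] coord_sums[of y]] in \<open>simp add: scaleC_add_left\<close>)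

lemma coord_scaleC: "coord (c *\<^sub>C x) = (\<lambda>n. c * coord x n)"
  by (rule coord_unique)
    (use bounded_linear.sums[OF bounded_linear_scaleC coord_sums] in \<open>simp add: scaleC_scaleC\<close>)

lemma partial_add: "partial N (x + y) = partial N x + partial N y"
  by (simp add: partial_def coord_add scaleC_add_left sum.distrib)

lemma partial_scaleC: "partial N (c *\<^sub>C x) = c *\<^sub>C partial N x"
  by (simp add: partial_def coord_scaleC scaleC_scaleC cvec.scale_sum_right)

lemma partial_scaleR: "partial N (r *\<^sub>R x) = r *\<^sub>R partial N x"
  using partial_scaleC[of N "of_real r"] by (simp add: scaleC_of_real)

lemma partial_zero: "partial N 0 = 0"
  using partial_scaleR[of N 0 0] by simp

lemma partial_diff: "partial N (x - y) = partial N x - partial N y"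
  using partial_add[of N "x - y" y] by simp

lemma partial_sum: "partial N (sum f I) = (\<Sum>i\<in>I. partial N (f i))"
  by (induction I rule: infinite_finite_induct) (simp_all add: partial_zero partial_add)

lemma partial_Suc: "partial (Suc n) x = partial n x + coord x n *\<^sub>C b n"
  by (simp add: partial_def)

lemma basis_nonzero: "b n \<noteq> 0"
proof
  assume 0: "b n = 0"
  have "(\<lambda>k. (if k = n then 1 else 0) *\<^sub>C b k) = (\<lambda>k. 0)"
    using 0 by auto
  then have "coord 0 = (\<lambda>k. if k = n then 1 else 0)"
    by (intro coord_unique) simp
  from fun_cong[OF this, of n] have "coord 0 n = 1" by simp
  moreover have "coord 0 = (\<lambda>k. 0)"
    by (rule coord_unique) simp
  ultimately show False by simp
qed

text \<open>By Baire, the vectors whose partial sums are bounded by some \<open>k\<close> are dense in a ball. This set is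
symmetric and convex, so the ball may be centred at \<open>0\<close>, and scaling gives a bound proportional to the norm
on a dense set.\<close>

lemma partial_approximately_bounded:
  obtains K where "0 \<le> K" "\<And>x \<epsilon>. 0 < \<epsilon> \<Longrightarrow> \<exists>u. norm (x - u) < \<epsilon> \<and> (\<forall>N. norm (partial N u) \<le> K * norm x)"
proof -
  define A where "A k = {x. \<forall>N. norm (partial N x) \<le> real k}" for k :: nat
  have "(\<Union>k. A k) = UNIV"
  proof -
    have "\<exists>k. x \<in> A k" for x
    proof -
      have "Bseq (\<lambda>N. partial N x)"
        by (rule convergent_imp_Bseq[OF convergentI[OF partial_tendsto]])
      then obtain B where B: "\<And>N. norm (partial N x) \<le> B" unfolding Bseq_def by blast
      obtain k where "B \<le> real k" using real_arch_simple by blast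
      then show ?thesis unfolding A_def using B order_trans by blast
    qed
    then show ?thesis by blast
  qed
  then obtain k x0 r where r: "0 < r" "ball x0 r \<subseteq> closure (A k)"
    by (rule complete_space_cover_interior)
  have unit: "\<exists>u\<in>A k. norm (x - u) < \<epsilon>" if "norm x < r" "0 < \<epsilon>" for x \<epsilon>
  proof -
    have "x0 + x \<in> closure (A k)" "x0 - x \<in> closure (A k)"
      using that r(2) by (auto simp: dist_norm intro!: subsetD[OF r(2)])
    then obtain u v where uv: "u \<in> A k" "dist u (x0 + x) < \<epsilon>" "v \<in> A k" "dist v (x0 - x) < \<epsilon>"
      using \<open>0 < \<epsilon>\<close> unfolding closure_approachable by blast
    \<comment> \<open>\<open>x\<close> is the mean of \<open>x0 + x\<close> and \<open>-(x0 - x)\<close>\<close>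
    define w where "w = (1/2) *\<^sub>R (u - v)"
    have "x - w = (1/2) *\<^sub>R (((x0 + x) - u) - ((x0 - x) - v))"
      by (simp add: w_def scaleR_right_diff_distrib scaleR_right_distrib) (simp add: scaleR_add_left[symmetric])
    then have "norm (x - w) \<le> (1/2) * (norm ((x0 + x) - u) + norm ((x0 - x) - v))"
      using norm_triangle_ineq4[of "x0 + x - u" "x0 - x - v"] by (simp only: norm_scaleR) simp
    also have "\<dots> < \<epsilon>" using uv(2,4) by (simp add: dist_norm norm_minus_commute)
    finally have "norm (x - w) < \<epsilon>" .
    moreover have "w \<in> A k"
      unfolding A_def
    proof (intro CollectI allI)
      fix N
      have "norm (partial N w) \<le> (1/2) * (norm (partial N u) + norm (partial N v))"
        unfolding w_def partial_scaleR partial_diff by (simp add: norm_triangle_ineq4)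
      also have "\<dots> \<le> (1/2) * (real k + real k)"
        using uv unfolding A_def by (intro mult_left_mono add_mono) auto
      finally show "norm (partial N w) \<le> real k" by simp
    qed
    ultimately show ?thesis by blast
  qed
  show thesis
  proof (rule that[of "2 * real k / r"])
    fix x :: 'a and \<epsilon> :: real assume \<epsilon>: "0 < \<epsilon>"
    show "\<exists>u. norm (x - u) < \<epsilon> \<and> (\<forall>N. norm (partial N u) \<le> 2 * real k / r * norm x)"
    proof (cases "x = 0")
      case True
      then show ?thesis using \<epsilon> by (intro exI[of _ 0]) (simp add: partial_zero)
    next
      case False
      define s where "s = r / (2 * norm x)"
      have s: "0 < s" using False r(1) by (simp add: s_def)
      have "norm (s *\<^sub>R x) < r" using False r(1) by (simp add: s_def)
      then obtain u where u: "u \<in> A k" "norm (s *\<^sub>R x - u) < s * \<epsilon>"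
        using unit[of "s *\<^sub>R x" "s * \<epsilon>"] s \<epsilon> by auto
      have "x - (1/s) *\<^sub>R u = (1/s) *\<^sub>R (s *\<^sub>R x - u)"
        using s by (simp add: scaleR_right_diff_distrib)
      then have "norm (x - (1/s) *\<^sub>R u) < \<epsilon>"
        using u(2) s by (simp add: divide_less_eq mult.commute)
      moreover have "norm (partial N ((1/s) *\<^sub>R u)) \<le> 2 * real k / r * norm x" for N
      proof -
        have "norm (partial N ((1/s) *\<^sub>R u)) = (1/s) * norm (partial N u)"
          using s by (simp add: partial_scaleR)
        also have "\<dots> \<le> (1/s) * real k"
          using u(1) s by (intro mult_left_mono) (auto simp: A_def)
        finally show ?thesis by (simp add: s_def mult_ac)
      qed
      ultimately show ?thesis by blast
    qed
  qed (use r in auto)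
qed

text \<open>The argument of the open mapping theorem. Expand \<open>x\<close> into a series of vectors \<open>u\<^sub>j\<close> whose partial sums are
bounded by \<open>K * \<delta>\<^sub>j\<close> with \<open>\<delta>\<^sub>j = norm x / 2\<^sup>j\<close>. The coefficients of the \<open>u\<^sub>j\<close> add up to coefficients \<open>a\<close>, and
the tails are small uniformly in the length of the partial sum, so the expansion with coefficients \<open>a\<close>
converges to \<open>x\<close>. By uniqueness it is the basis expansion of \<open>x\<close>, which is therefore bounded by \<open>2 * K\<close>.\<close>

theorem partial_uniformly_bounded:
  obtains M where "0 \<le> M" "\<And>N x. norm (partial N x) \<le> M * norm x"
proof -
  obtain K where K: "0 \<le> K"
    "\<And>x \<epsilon>. 0 < \<epsilon> \<Longrightarrow> \<exists>u. norm (x - u) < \<epsilon> \<and> (\<forall>N. norm (partial N u) \<le> K * norm x)"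
    using partial_approximately_bounded by blast
  define pick where
    "pick x \<epsilon> = (SOME u. norm (x - u) < \<epsilon> \<and> (\<forall>N. norm (partial N u) \<le> K * norm x))" for x \<epsilon>
  have pick: "norm (x - pick x \<epsilon>) < \<epsilon>" "norm (partial N (pick x \<epsilon>)) \<le> K * norm x"
    if "0 < \<epsilon>" for x \<epsilon> N
    using someI_ex[OF K(2)[OF that, of x]] unfolding pick_def by blast+
  have main: "norm (partial N x) \<le> (2 * K) * norm x" if "x \<noteq> 0" for N x
  proof -
    define \<delta> where "\<delta> j = norm x * (1/2) ^ j" for j
    have \<delta>: "0 < \<delta> j" for j using that by (simp add: \<delta>_def)
    \<comment> \<open>the remainders \<open>x - (u\<^sub>0 + \<dots> + u\<^sub>j\<^sub>-\<^sub>1)\<close>\<close>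
    define r where "r = rec_nat x (\<lambda>j z. z - pick z (\<delta> (Suc j)))"
    define u where "u j = pick (r j) (\<delta> (Suc j))" for j
    have r0: "r 0 = x" and rSuc: "r (Suc j) = r j - u j" for j
      by (simp_all add: r_def u_def)
    have norm_r: "norm (r j) \<le> \<delta> j" for j
    proof (cases j)
      case (Suc i)
      then show ?thesis using pick(1)[OF \<delta>, of "r i" "Suc i"] by (simp add: rSuc u_def)
    qed (simp add: r0 \<delta>_def)
    have sum_u: "(\<Sum>j<J. u j) = x - r J" for J
      by (induction J) (simp_all add: r0 rSuc)
    have norm_u: "norm (partial n (u j)) \<le> K * \<delta> j" for n j
    proof -
      have "norm (partial n (u j)) \<le> K * norm (r j)"
        unfolding u_def by (rule pick(2)[OF \<delta>])
      also have "\<dots> \<le> K * \<delta> j" using norm_r K(1) by (rule mult_left_mono)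
      finally show ?thesis .
    qed
    have \<delta>_sums: "(\<lambda>j. K * \<delta> (j + J)) sums (2 * K * \<delta> J)" for J
    proof -
      have "(\<lambda>j. (K * norm x * (1/2) ^ J) * (1/2) ^ j) sums ((K * norm x * (1/2) ^ J) * (1 / (1 - 1/2)))"
        by (intro sums_mult geometric_sums) simp
      then show ?thesis by (simp add: \<delta>_def power_add mult_ac)
    qed
    have coord_le: "norm (coord (u j) n) \<le> 2 / norm (b n) * (K * \<delta> j)" for j n
    proof -
      have "coord (u j) n *\<^sub>C b n = partial (Suc n) (u j) - partial n (u j)"
        by (simp add: partial_Suc)
      then have "norm (coord (u j) n) * norm (b n) \<le> K * \<delta> j + K * \<delta> j"
        using norm_triangle_ineq4[of "partial (Suc n) (u j)" "partial n (u j)"] norm_u[of "Suc n" j] norm_u[of n j]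
        by (simp add: norm_scaleC[symmetric])
      then show ?thesis using basis_nonzero[of n] by (simp add: field_simps)
    qed
    have summable_coord: "summable (\<lambda>j. coord (u j) n)" for n
    proof (rule summable_comparison_test')
      show "summable (\<lambda>j. 2 / norm (b n) * (K * \<delta> j))"
        by (rule summable_mult) (use sums_summable[OF \<delta>_sums[of 0]] in \<open>simp only: add_0_right\<close>)
    qed (rule coord_le)
    define a where "a n = (\<Sum>j. coord (u j) n)" for n
    define S where "S n = (\<Sum>k<n. a k *\<^sub>C b k)" for n
    have S_lim: "(\<lambda>J. \<Sum>j<J. partial n (u j)) \<longlonglongrightarrow> S n" for n
    proof -
      have "(\<lambda>j. coord (u j) k *\<^sub>C b k) sums (a k *\<^sub>C b k)" for k
      proof -
        have "bounded_linear (\<lambda>c. c *\<^sub>C b k)"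
        proof (rule bounded_linear_intro[where K = "norm (b k)"])
          show "(r *\<^sub>R c) *\<^sub>C b k = r *\<^sub>R c *\<^sub>C b k" for r and c :: complex
            by (simp only: scaleR_conv_of_real[of r c] scaleC_scaleC[symmetric] scaleC_of_real)
        qed (simp_all add: scaleC_add_left norm_scaleC)
        from bounded_linear.sums[OF this summable_sums[OF summable_coord]] show ?thesis
          by (simp add: a_def)
      qed
      then have "(\<lambda>j. \<Sum>k<n. coord (u j) k *\<^sub>C b k) sums (\<Sum>k<n. a k *\<^sub>C b k)"
        by (intro sums_sum) auto
      then show ?thesis by (simp add: sums_def partial_def S_def)
    qed
    have tail: "norm (S n - (\<Sum>j<J. partial n (u j))) \<le> 2 * K * \<delta> J" for n J
    proof (rule LIMSEQ_le_const2)
      show "(\<lambda>J'. norm ((\<Sum>j<J'. partial n (u j)) - (\<Sum>j<J. partial n (u j)))) \<longlonglongrightarrow>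
          norm (S n - (\<Sum>j<J. partial n (u j)))"
        by (intro tendsto_intros S_lim)
      show "\<exists>N. \<forall>J'\<ge>N. norm ((\<Sum>j<J'. partial n (u j)) - (\<Sum>j<J. partial n (u j))) \<le> 2 * K * \<delta> J"
      proof (intro exI allI impI)
        fix J' assume "J \<le> J'"
        then have "(\<Sum>j<J'. partial n (u j)) - (\<Sum>j<J. partial n (u j)) =
            (\<Sum>j\<in>{J..<J'}. partial n (u j))"
          by (simp add: sum_diff_nat_ivl lessThan_atLeast0)
        also have "\<dots> = (\<Sum>j<J' - J. partial n (u (j + J)))"
          using sum.shift_bounds_nat_ivl[of "\<lambda>j. partial n (u j)" 0 J "J' - J"] \<open>J \<le> J'\<close>
          by (simp add: lessThan_atLeast0)
        finally have "norm ((\<Sum>j<J'. partial n (u j)) - (\<Sum>j<J. partial n (u j))) \<le>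
            (\<Sum>j<J' - J. norm (partial n (u (j + J))))"
          by (simp add: norm_sum)
        also have "\<dots> \<le> (\<Sum>j<J' - J. K * \<delta> (j + J))"
          by (intro sum_mono norm_u)
        also have "\<dots> \<le> (\<Sum>j. K * \<delta> (j + J))"
          by (intro sum_le_suminf sums_summable[OF \<delta>_sums]) (auto intro!: mult_nonneg_nonneg K(1) less_imp_le[OF \<delta>])
        also have "\<dots> = 2 * K * \<delta> J"
          by (rule sums_unique[OF \<delta>_sums, symmetric])
        finally show "norm ((\<Sum>j<J'. partial n (u j)) - (\<Sum>j<J. partial n (u j))) \<le> 2 * K * \<delta> J" .
      qed
    qed
    have \<delta>_lim: "\<delta> \<longlonglongrightarrow> 0"
      unfolding \<delta>_def by (intro tendsto_mult_right_zero LIMSEQ_power_zero) simp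
    have "S \<longlonglongrightarrow> x"
    proof (rule LIMSEQ_I)
      fix \<epsilon> :: real assume "0 < \<epsilon>"
      have "(\<lambda>J. 2 * K * \<delta> J + \<delta> J) \<longlonglongrightarrow> 2 * K * 0 + 0"
        by (intro tendsto_intros \<delta>_lim)
      then have "\<forall>\<^sub>F J in sequentially. 2 * K * \<delta> J + \<delta> J < \<epsilon> / 2"
        using \<open>0 < \<epsilon>\<close> by (intro order_tendstoD(2)) auto
      then obtain J where J: "2 * K * \<delta> J + \<delta> J < \<epsilon> / 2"
        using eventually_happens'[OF sequentially_bot] by blast
      define v where "v = x - r J"
      obtain n0 where n0: "\<And>n. n0 \<le> n \<Longrightarrow> norm (partial n v - v) < \<epsilon> / 2"
        using LIMSEQ_D[OF partial_tendsto, of "\<epsilon> / 2" v] \<open>0 < \<epsilon>\<close> by auto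
      have "norm (S n - x) < \<epsilon>" if "n0 \<le> n" for n
      proof -
        have "partial n v = (\<Sum>j<J. partial n (u j))"
          unfolding v_def sum_u[symmetric] by (rule partial_sum)
        then have "norm (S n - partial n v) \<le> 2 * K * \<delta> J"
          using tail by simp
        moreover have "norm (v - x) \<le> \<delta> J"
          using norm_r[of J] by (simp add: v_def)
        moreover have "norm (S n - x) \<le> norm (S n - partial n v) + norm (partial n v - v) + norm (v - x)"
          using norm_triangle_ineq[of "(S n - partial n v) + (partial n v - v)" "v - x"]
            norm_triangle_ineq[of "S n - partial n v" "partial n v - v"] by simp
        ultimately show ?thesis using J n0[OF that] by linarith
      qed
      then show "\<exists>n0. \<forall>n\<ge>n0. norm (S n - x) < \<epsilon>" by blast
    qed
    then have "coord x = a"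
      by (intro coord_unique) (simp add: sums_def S_def[symmetric])
    then have "partial N x = S N" by (simp add: partial_def S_def)
    then show ?thesis using tail[of N 0] by (simp add: \<delta>_def)
  qed
  show thesis
  proof (rule that)
    show "norm (partial N x) \<le> (2 * K) * norm x" for N x
      using main[of x N] by (cases "x = 0") (auto simp: partial_zero)
  qed (use K in simp)
qed

end

section \<open>Small perturbations of identity plus compact\<close>

context schauder_space
begin

text \<open>The partial sums are equicontinuous and converge pointwise to the identity, hence uniformly on the compact
closure of the image of the unit ball.\<close>

lemma compact_op_partial_approx:
  assumes C: "C \<in> compact_ops TYPE('a)" and \<epsilon>: "0 < \<epsilon>"
  shows "\<exists>N. \<forall>x. norm (partial N (C x) - C x) \<le> \<epsilon> * norm x"
proof -
  obtain M where M: "0 \<le> M" "\<And>N x. norm (partial N x) \<le> M * norm x"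
    using partial_uniformly_bounded by blast
  define \<delta> where "\<delta> = \<epsilon> / (M + 2)"
  have \<delta>: "0 < \<delta>" using M \<epsilon> by (simp add: \<delta>_def)
  let ?Z = "closure (blinfun_apply C ` cball 0 1)"
  have "compact ?Z" using C by (simp add: compact_ops_def)
  then have "\<forall>e>0. \<exists>F. finite F \<and> ?Z \<subseteq> (\<Union>y\<in>F. ball y e)"
    unfolding compact_eq_totally_bounded by simp
  then obtain F where F: "finite F" "?Z \<subseteq> (\<Union>y\<in>F. ball y \<delta>)"
    using \<delta> by blast
  have "\<forall>y\<in>F. \<forall>\<^sub>F N in sequentially. norm (partial N y - y) < \<delta>"
    using tendstoD[OF partial_tendsto \<delta>] by (simp add: dist_norm)
  then have "\<forall>\<^sub>F N in sequentially. \<forall>y\<in>F. norm (partial N y - y) < \<delta>"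
    using F(1) by (simp add: eventually_ball_finite_distrib)
  then obtain N where N: "\<And>y. y \<in> F \<Longrightarrow> norm (partial N y - y) < \<delta>"
    using eventually_happens'[OF sequentially_bot] by blast
  have unit: "norm (partial N z - z) \<le> \<epsilon>" if "z \<in> ?Z" for z
  proof -
    have "z \<in> (\<Union>y\<in>F. ball y \<delta>)" using F(2) that by (rule subsetD)
    then obtain y where y: "y \<in> F" "norm (z - y) < \<delta>"
      by (auto simp: dist_norm norm_minus_commute)
    have "partial N z - z = partial N (z - y) + (partial N y - y) - (z - y)"
      by (simp add: partial_diff)
    then have "norm (partial N z - z) \<le> norm (partial N (z - y)) + norm (partial N y - y) + norm (z - y)"
      using norm_triangle_ineq4[of "partial N (z - y) + (partial N y - y)" "z - y"]
        norm_triangle_ineq[of "partial N (z - y)" "partial N y - y"] by simp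
    also have "\<dots> \<le> M * \<delta> + \<delta> + \<delta>"
    proof (intro add_mono)
      show "norm (partial N (z - y)) \<le> M * \<delta>"
        using M(2)[of N "z - y"] mult_left_mono[OF less_imp_le[OF y(2)] M(1)] by simp
    qed (use y N in \<open>auto intro: less_imp_le\<close>)
    also have "\<dots> = (M + 2) * \<delta>" by (simp add: algebra_simps)
    also have "\<dots> = \<epsilon>" using M(1) by (simp add: \<delta>_def)
    finally show ?thesis .
  qed
  have "norm (partial N (C x) - C x) \<le> \<epsilon> * norm x" for x
  proof (cases "x = 0")
    case False
    define y where "y = (1 / norm x) *\<^sub>R x"
    have "C y \<in> ?Z"
      using False by (intro subsetD[OF closure_subset] imageI) (simp add: y_def)
    moreover have "partial N (C x) - C x = norm x *\<^sub>R (partial N (C y) - C y)"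
      using False by (simp add: y_def blinfun.scaleR_right partial_scaleR scaleR_diff_right)
    ultimately have "norm (partial N (C x) - C x) \<le> norm x * \<epsilon>"
      using unit mult_left_mono[of "norm (partial N (C y) - C y)" \<epsilon> "norm x"] by simp
    then show ?thesis by (simp add: mult.commute)
  qed (simp add: partial_zero)
  then show ?thesis by blast
qed

end

definition invertible_op :: "('a::complex_normed_vector \<Rightarrow>\<^sub>L 'a) \<Rightarrow> bool"
  where "invertible_op S \<longleftrightarrow> S \<in> clops TYPE('a) \<and>
    (\<exists>R\<in>clops TYPE('a). R o\<^sub>L S = id_blinfun \<and> S o\<^sub>L R = id_blinfun)"

lemma scaleR_mem_ops: "T \<in> clops TYPE('a::complex_normed_vector) \<Longrightarrow>
    r *\<^sub>R T \<in> clops TYPE('a)"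
  by (simp add: bounded_ops_simps blinfun.scaleR_left scaleC_of_real[symmetric] scaleC_scaleC mult.commute)

lemma scal_mem_ops: "T \<in> clops TYPE('a::complex_normed_vector) \<Longrightarrow>
    scal (bounded_ops TYPE('a)) c T \<in> clops TYPE('a)"
  by (auto simp: bounded_ops_simps(1) blinfun_apply_scal scaleC_scaleC mult.commute)

text \<open>The Sherman-Morrison formula: if \<open>F\<close> has rank one and \<open>F (R' v) = \<beta> v\<close>, then \<open>R + t F\<close> has the inverse
\<open>R' - s R' F R'\<close> with \<open>s = t / (1 + t \<beta>)\<close>. Only one value of \<open>t\<close> is excluded.\<close>

lemma invertible_op_rank_one_perturbation:
  fixes R F :: "'a::complex_banach \<Rightarrow>\<^sub>L 'a"
  assumes R: "invertible_op R" and F: "F \<in> clops TYPE('a)"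
    and rank1: "\<And>x. \<exists>c. F x = c *\<^sub>C v" and \<delta>: "0 < \<delta>"
  shows "\<exists>t. \<bar>t - 1\<bar> < \<delta> \<and> invertible_op (R + t *\<^sub>R F)"
proof -
  obtain R' where Rc: "R \<in> clops TYPE('a)" and R': "R' \<in> clops TYPE('a)"
    "R' o\<^sub>L R = id_blinfun" "R o\<^sub>L R' = id_blinfun"
    using R by (auto simp: invertible_op_def)
  have inv: "R' (R x) = x" "R (R' x) = x" for x
    using R'(2,3) by (metis blinfun_apply_blinfun_compose id_blinfun.rep_eq id_apply)+
  have lin: "R' (c *\<^sub>C x) = c *\<^sub>C R' x" "F (c *\<^sub>C x) = c *\<^sub>C F x" "R (c *\<^sub>C x) = c *\<^sub>C R x" for c x
    using R' F Rc by (simp_all add: bounded_ops_simps)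
  obtain \<beta> where \<beta>: "F (R' v) = \<beta> *\<^sub>C v" using rank1 by blast
  have FRF: "F (R' (F x)) = \<beta> *\<^sub>C F x" for x
  proof -
    obtain c where "F x = c *\<^sub>C v" using rank1 by blast
    then show ?thesis by (simp add: lin \<beta> scaleC_scaleC mult.commute)
  qed
  \<comment> \<open>if \<open>t = 1\<close> is the excluded value, any other value near 1 will do\<close>
  obtain t :: real where t: "\<bar>t - 1\<bar> < \<delta>" "1 + of_real t * \<beta> \<noteq> 0"
  proof (cases "1 + \<beta> = 0")
    case True
    then have "\<beta> = -1" by (simp add: add_eq_0_iff)
    then have "1 + of_real (1 + \<delta>/2) * \<beta> = - complex_of_real (\<delta>/2)" by simp
    then show thesis using that[of "1 + \<delta>/2"] \<delta> by simp
  qed (use that[of 1] \<delta> in simp)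
  define s where "s = of_real t / (1 + of_real t * \<beta>)"
  have s: "s + s * of_real t * \<beta> = of_real t"
  proof -
    have "s + s * of_real t * \<beta> = s * (1 + of_real t * \<beta>)" by (simp add: algebra_simps)
    then show ?thesis using t(2) by (simp add: s_def)
  qed
  define Q where "Q = R' - scal (bounded_ops TYPE('a)) s (R' o\<^sub>L (F o\<^sub>L R'))"
  have Q: "Q x = R' x - s *\<^sub>C R' (F (R' x))" for x
    by (simp add: Q_def blinfun.diff_left blinfun_apply_scal)
  have Qc: "Q \<in> clops TYPE('a)"
    unfolding Q_def using R' F by (intro ops.diff_mem scal_mem_ops ops.mul_mem)
  have cancel: "of_real t *\<^sub>C w - (s *\<^sub>C w + (of_real t * s * \<beta>) *\<^sub>C w) = 0" for w :: 'a
  proof -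
    have "of_real t *\<^sub>C w - (s *\<^sub>C w + (of_real t * s * \<beta>) *\<^sub>C w) =
        (of_real t - (s + s * of_real t * \<beta>)) *\<^sub>C w"
      by (simp add: cvec.scale_left_diff_distrib scaleC_add_left mult_ac)
    then show ?thesis by (simp add: s)
  qed
  have "(R + t *\<^sub>R F) o\<^sub>L Q = id_blinfun"
  proof (rule blinfun_eqI)
    fix x
    have "((R + t *\<^sub>R F) o\<^sub>L Q) x = x + (of_real t *\<^sub>C F (R' x) -
        (s *\<^sub>C F (R' x) + (of_real t * s * \<beta>) *\<^sub>C F (R' x)))"
      by (simp add: Q blinfun.add_left blinfun.diff_right blinfun.scaleR_left lin inv FRF
          scaleC_of_real[symmetric] scaleC_scaleC cvec.scale_right_diff_distrib mult_ac)
    then show "((R + t *\<^sub>R F) o\<^sub>L Q) x = id_blinfun x" by (simp add: cancel)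
  qed
  moreover have "Q o\<^sub>L (R + t *\<^sub>R F) = id_blinfun"
  proof (rule blinfun_eqI)
    fix x
    have "(Q o\<^sub>L (R + t *\<^sub>R F)) x = x + (of_real t *\<^sub>C R' (F x) -
        (s *\<^sub>C R' (F x) + (of_real t * s * \<beta>) *\<^sub>C R' (F x)))"
      by (simp add: Q blinfun.add_left blinfun.add_right blinfun.scaleR_left lin inv FRF
          scaleC_of_real[symmetric] scaleC_scaleC scaleC_add_right mult_ac)
    then show "(Q o\<^sub>L (R + t *\<^sub>R F)) x = id_blinfun x" by (simp add: cancel)
  qed
  moreover have "R + t *\<^sub>R F \<in> clops TYPE('a)"
    using Rc F by (intro ops.add_mem scaleR_mem_ops)
  ultimately show ?thesis
    using t(1) Qc unfolding invertible_op_def by blast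
qed

lemma invertible_op_finite_rank_perturbation:
  fixes R :: "'a::complex_banach \<Rightarrow>\<^sub>L 'a" and N :: nat
  assumes R: "invertible_op R"
    and F: "\<And>n. F n \<in> clops TYPE('a)" "\<And>n x. \<exists>c. F n x = c *\<^sub>C v n" and \<delta>: "0 < \<delta>"
  shows "\<exists>t. (\<forall>n<N. \<bar>t n - 1\<bar> < \<delta>) \<and> invertible_op (R + (\<Sum>n<N. t n *\<^sub>R F n))"
proof (induction N)
  case (Suc N)
  then obtain t where t: "\<forall>n<N. \<bar>t n - 1\<bar> < \<delta>" "invertible_op (R + (\<Sum>n<N. t n *\<^sub>R F n))"
    by blast
  obtain s where s: "\<bar>s - 1\<bar> < \<delta>" "invertible_op (R + (\<Sum>n<N. t n *\<^sub>R F n) + s *\<^sub>R F N)"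
    using invertible_op_rank_one_perturbation[OF t(2) F(1)[of N] F(2)[of N] \<delta>] by blast
  have "(\<Sum>n<N. (t(N := s)) n *\<^sub>R F n) = (\<Sum>n<N. t n *\<^sub>R F n)"
    by (rule sum.cong) auto
  then show ?case
    using t(1) s by (intro exI[of _ "t(N := s)"]) (auto simp: less_Suc_eq add.assoc)
qed (use R in simp)

text \<open>Split \<open>C\<close> into the finite-rank operator \<open>P\<^sub>N C\<close> and a remainder of norm at most \<open>1/2\<close>. Identity plus
remainder is invertible, and the rank-one summands \<open>F\<^sub>n\<close> of \<open>P\<^sub>N C\<close> are added with factors \<open>t\<^sub>n\<close> close to 1,
chosen in turn such that invertibility persists. The deviation from \<open>C\<close> is \<open>E = \<Sum> (t\<^sub>n - 1) F\<^sub>n\<close>.\<close>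

theorem (in schauder_space) compact_perturbation_of_id:
  assumes C: "C \<in> compact_ops TYPE('a)" and \<delta>: "0 < \<delta>"
  shows "\<exists>E\<in>clops TYPE('a). norm E < \<delta> \<and> invertible_op (id_blinfun + C + E)"
proof -
  have Cc: "C \<in> clops TYPE('a)" using C by (simp add: compact_ops_def)
  obtain N where N: "\<And>x. norm (partial N (C x) - C x) \<le> 1/2 * norm x"
    using compact_op_partial_approx[OF C, of "1/2"] by auto
  obtain M where M: "0 \<le> M" "\<And>N x. norm (partial N x) \<le> M * norm x"
    using partial_uniformly_bounded by blast
  define P where "P n = Blinfun (partial n)" for n
  have P: "blinfun_apply (P n) = partial n" for n
    unfolding P_def using M
    by (intro bounded_linear_Blinfun_apply bounded_linear_intro[where K = M])
      (auto simp: partial_add partial_scaleR mult.commute)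
  have Pc: "P n \<in> clops TYPE('a)" for n
    by (simp add: bounded_ops_simps P partial_scaleC)
  define F where "F n = (P (Suc n) - P n) o\<^sub>L C" for n
  have Fx: "F n x = coord (C x) n *\<^sub>C b n" for n x
    by (simp add: F_def blinfun.diff_left P partial_Suc)
  have Fc: "F n \<in> clops TYPE('a)" for n
    unfolding F_def using Pc Cc by (intro ops.mul_mem ops.diff_mem)
  have PC: "P N o\<^sub>L C = (\<Sum>n<N. F n)"
    by (rule blinfun_eqI) (simp add: P Fx blinfun.sum_left partial_def)
  define R where "R = id_blinfun + (C - (P N o\<^sub>L C))"
  have "R \<in> clops TYPE('a)"
    unfolding R_def using Cc Pc by (intro ops.add_mem ops.diff_mem ops.mul_mem ops.unit_mem)
  moreover have "norm (R - id_blinfun) \<le> 1/2"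
    using N by (intro norm_blinfun_bound)
      (auto simp: R_def blinfun.diff_left P norm_minus_commute mult.commute)
  ultimately have "invertible_op R"
    using inverse_near_id unfolding invertible_op_def by blast
  moreover define \<eta> where "\<eta> = \<delta> / (1 + (\<Sum>n<N. norm (F n)))"
  have pos: "0 < 1 + (\<Sum>n<N. norm (F n))"
    by (intro add_pos_nonneg sum_nonneg) auto
  have \<eta>: "0 < \<eta>" using \<delta> pos by (simp add: \<eta>_def)
  have "\<exists>c. F n x = c *\<^sub>C b n" for n x using Fx by blast
  ultimately obtain t where t: "\<And>n. n < N \<Longrightarrow> \<bar>t n - 1\<bar> < \<eta>" "invertible_op (R + (\<Sum>n<N. t n *\<^sub>R F n))"
    using invertible_op_finite_rank_perturbation[of R F b \<eta> N] Fc \<eta> by blast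
  define E where "E = (\<Sum>n<N. (t n - 1) *\<^sub>R F n)"
  have "norm E \<le> (\<Sum>n<N. \<eta> * norm (F n))"
    unfolding E_def using less_imp_le[OF t(1)]
    by (intro sum_norm_le) (auto intro!: mult_right_mono)
  also have "\<dots> < \<eta> * (1 + (\<Sum>n<N. norm (F n)))"
    using \<eta> by (simp add: sum_distrib_left[symmetric])
  also have "\<dots> = \<delta>" using pos by (simp add: \<eta>_def)
  finally have "norm E < \<delta>" .
  moreover have "E \<in> clops TYPE('a)"
    unfolding E_def using Fc by (intro ops.sum_mem scaleR_mem_ops)
  moreover have "R + (\<Sum>n<N. t n *\<^sub>R F n) = id_blinfun + C + E"
    by (simp add: R_def E_def PC scaleR_left_diff_distrib sum_subtractf)
  ultimately show ?thesis using t(2) by auto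
qed

section \<open>Lipschitz functions on a compact metric space\<close>

abbreviation lipschitz_fun :: "'k metric \<Rightarrow> ('k \<Rightarrow> 'b::metric_space) \<Rightarrow> bool"
  where "lipschitz_fun \<rho> f \<equiv> Lipschitz_continuous_map \<rho> euclidean_metric f"

lemma lipschitz_funI:
  assumes "\<And>x y. x \<in> mspace \<rho> \<Longrightarrow> y \<in> mspace \<rho> \<Longrightarrow> dist (f x) (f y) \<le> L * mdist \<rho> x y"
  shows "lipschitz_fun \<rho> f"
  using assms unfolding Lipschitz_continuous_map_def by auto

lemma lipschitz_funE:
  assumes "lipschitz_fun \<rho> f"
  obtains L where "L > 0" "\<forall>x\<in>mspace \<rho>. \<forall>y\<in>mspace \<rho>. dist (f x) (f y) \<le> L * mdist \<rho> x y"
  using assms unfolding Lipschitz_continuous_map_pos by auto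

lemma lipschitz_fun_continuous: "lipschitz_fun \<rho> f \<Longrightarrow> continuous_map (mtopology_of \<rho>) euclidean f"
  using Lipschitz_continuous_imp_continuous_map[of \<rho> euclidean_metric f] by simp

lemma lipschitz_fun_const: "lipschitz_fun \<rho> (\<lambda>x. c)"
  by (rule lipschitz_funI[where L = 0]) simp

lemma lipschitz_fun_add:
  fixes f g :: "'k \<Rightarrow> 'b::real_normed_vector"
  assumes "lipschitz_fun \<rho> f" "lipschitz_fun \<rho> g"
  shows "lipschitz_fun \<rho> (\<lambda>x. f x + g x)"
proof -
  obtain A where A: "A > 0" "\<forall>x\<in>mspace \<rho>. \<forall>y\<in>mspace \<rho>. dist (f x) (f y) \<le> A * mdist \<rho> x y"
    by (rule lipschitz_funE[OF assms(1)])
  note A = A(1) A(2)[rule_format]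
  obtain B where B: "B > 0" "\<forall>x\<in>mspace \<rho>. \<forall>y\<in>mspace \<rho>. dist (g x) (g y) \<le> B * mdist \<rho> x y"
    by (rule lipschitz_funE[OF assms(2)])
  note B = B(1) B(2)[rule_format]
  show ?thesis
  proof (rule lipschitz_funI[where L = "A + B"])
    fix x y assume "x \<in> mspace \<rho>" "y \<in> mspace \<rho>"
    then show "dist (f x + g x) (f y + g y) \<le> (A + B) * mdist \<rho> x y"
      using A(2)[of x y] B(2)[of x y] dist_triangle_add[of "f x" "g x" "f y" "g y"] by (simp add: algebra_simps)
  qed
qed

lemma lipschitz_fun_bounded_linear:
  assumes "bounded_linear h" "lipschitz_fun \<rho> f"
  shows "lipschitz_fun \<rho> (\<lambda>x. h (f x))"
proof -
  obtain A where A: "A > 0" "\<forall>x\<in>mspace \<rho>. \<forall>y\<in>mspace \<rho>. dist (f x) (f y) \<le> A * mdist \<rho> x y"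
    by (rule lipschitz_funE[OF assms(2)])
  note A = A(1) A(2)[rule_format]
  obtain B where B: "0 \<le> B" "\<And>x. norm (h x) \<le> norm x * B"
    using bounded_linear.nonneg_bounded[OF assms(1)] by blast
  show ?thesis
  proof (rule lipschitz_funI[where L = "A * B"])
    fix x y assume "x \<in> mspace \<rho>" "y \<in> mspace \<rho>"
    then have "norm (f x - f y) * B \<le> (A * mdist \<rho> x y) * B"
      using A(2)[of x y] B(1) by (intro mult_right_mono) (auto simp: dist_norm)
    moreover have "dist (h (f x)) (h (f y)) \<le> norm (f x - f y) * B"
      using B(2)[of "f x - f y"] linear_diff[OF bounded_linear.linear[OF assms(1)], of "f x" "f y"] by (simp add: dist_norm)
    ultimately show "dist (h (f x)) (h (f y)) \<le> A * B * mdist \<rho> x y"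
      by (simp add: mult_ac)
  qed
qed

lemmas lipschitz_fun_minus = lipschitz_fun_bounded_linear[OF bounded_linear_minus[OF bounded_linear_ident]]

lemma lipschitz_fun_diff:
  fixes f g :: "'k \<Rightarrow> 'b::real_normed_vector"
  assumes "lipschitz_fun \<rho> f" "lipschitz_fun \<rho> g"
  shows "lipschitz_fun \<rho> (\<lambda>x. f x - g x)"
  using lipschitz_fun_add[OF assms(1) lipschitz_fun_minus[OF assms(2)]] by simp

lemma lipschitz_fun_sum:
  fixes f :: "'i \<Rightarrow> 'k \<Rightarrow> 'b::real_normed_vector"
  assumes "\<And>i. i \<in> I \<Longrightarrow> lipschitz_fun \<rho> (f i)"
  shows "lipschitz_fun \<rho> (\<lambda>x. \<Sum>i\<in>I. f i x)"
  using assms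
  by (induction I rule: infinite_finite_induct) (simp_all add: lipschitz_fun_const lipschitz_fun_add)

lemma lipschitz_fun_max:
  fixes f g :: "'k \<Rightarrow> real"
  assumes "lipschitz_fun \<rho> f" "lipschitz_fun \<rho> g"
  shows "lipschitz_fun \<rho> (\<lambda>x. max (f x) (g x))"
proof -
  obtain A where A: "A > 0" "\<forall>x\<in>mspace \<rho>. \<forall>y\<in>mspace \<rho>. dist (f x) (f y) \<le> A * mdist \<rho> x y"
    by (rule lipschitz_funE[OF assms(1)])
  note A = A(1) A(2)[rule_format]
  obtain B where B: "B > 0" "\<forall>x\<in>mspace \<rho>. \<forall>y\<in>mspace \<rho>. dist (g x) (g y) \<le> B * mdist \<rho> x y"
    by (rule lipschitz_funE[OF assms(2)])
  note B = B(1) B(2)[rule_format]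
  show ?thesis
  proof (rule lipschitz_funI[where L = "max A B"])
    fix x y assume xy: "x \<in> mspace \<rho>" "y \<in> mspace \<rho>"
    have "A * mdist \<rho> x y \<le> max A B * mdist \<rho> x y" "B * mdist \<rho> x y \<le> max A B * mdist \<rho> x y"
      by (auto intro!: mult_right_mono)
    moreover have "dist (max (f x) (g x)) (max (f y) (g y)) \<le> max (dist (f x) (f y)) (dist (g x) (g y))"
      by (auto simp: dist_real_def max_def abs_real_def)
    ultimately show "dist (max (f x) (g x)) (max (f y) (g y)) \<le> max A B * mdist \<rho> x y"
      using A(2)[OF xy] B(2)[OF xy] by linarith
  qed
qed

lemma lipschitz_fun_min:
  fixes f g :: "'k \<Rightarrow> real"
  assumes "lipschitz_fun \<rho> f" "lipschitz_fun \<rho> g"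
  shows "lipschitz_fun \<rho> (\<lambda>x. min (f x) (g x))"
proof -
  have "min a b = - max (- a) (- b)" for a b :: real by simp
  then show ?thesis
    using lipschitz_fun_minus[OF lipschitz_fun_max[OF lipschitz_fun_minus[OF assms(1)] lipschitz_fun_minus[OF assms(2)]]]
    by simp
qed

lemma lipschitz_fun_Max:
  fixes f :: "'i \<Rightarrow> 'k \<Rightarrow> real"
  assumes "finite I" "I \<noteq> {}" "\<And>i. i \<in> I \<Longrightarrow> lipschitz_fun \<rho> (f i)"
  shows "lipschitz_fun \<rho> (\<lambda>x. Max ((\<lambda>i. f i x) ` I))"
  using assms by (induction I rule: finite_ne_induct) (auto intro!: lipschitz_fun_max)

lemma lipschitz_fun_Min:
  fixes f :: "'i \<Rightarrow> 'k \<Rightarrow> real"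
  assumes "finite I" "I \<noteq> {}" "\<And>i. i \<in> I \<Longrightarrow> lipschitz_fun \<rho> (f i)"
  shows "lipschitz_fun \<rho> (\<lambda>x. Min ((\<lambda>i. f i x) ` I))"
  using assms by (induction I rule: finite_ne_induct) (auto intro!: lipschitz_fun_min)

locale compact_metric =
  fixes \<rho> :: "'k metric"
  assumes compact: "compact_space (mtopology_of \<rho>)" and nonempty: "mspace \<rho> \<noteq> {}"
begin

abbreviation M where "M \<equiv> mspace \<rho>"
abbreviation d where "d \<equiv> mdist \<rho>"
abbreviation "cont f \<equiv> continuous_map (mtopology_of \<rho>) euclidean f"

lemma cont_compact_image: "cont f \<Longrightarrow> compact (f ` M)"
  using image_compactin[of "mtopology_of \<rho>" M euclidean f] compact
  by (simp add: compact_space_def)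

lemma cont_bounded:
  fixes f :: "'k \<Rightarrow> 'b::real_normed_vector"
  assumes "cont f"
  obtains B where "0 \<le> B" "\<And>x. x \<in> M \<Longrightarrow> norm (f x) \<le> B"
proof -
  have "bounded (f ` M)" using cont_compact_image[OF assms] by (rule compact_imp_bounded)
  then obtain B where "\<And>x. x \<in> M \<Longrightarrow> norm (f x) \<le> B" unfolding bounded_iff by blast
  then show thesis using that[of "max 0 B"] by (simp add: le_max_iff_disj)
qed

lemma cont_positive:
  fixes f :: "'k \<Rightarrow> real"
  assumes "cont f" "\<And>x. x \<in> M \<Longrightarrow> 0 < f x"
  obtains c where "0 < c" "\<And>x. x \<in> M \<Longrightarrow> c \<le> f x"
proof -
  obtain y where "y \<in> f ` M" "\<forall>z\<in>f ` M. y \<le> z"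
    using compact_attains_inf[OF cont_compact_image[OF assms(1)]] nonempty by blast
  then show thesis using that[of y] assms(2) by auto
qed

lemma lipschitz_fun_mult:
  fixes f g :: "'k \<Rightarrow> 'b::real_normed_algebra"
  assumes "lipschitz_fun \<rho> f" "lipschitz_fun \<rho> g"
  shows "lipschitz_fun \<rho> (\<lambda>x. f x * g x)"
proof -
  obtain A where A: "A > 0" "\<forall>x\<in>M. \<forall>y\<in>M. dist (f x) (f y) \<le> A * d x y"
    by (rule lipschitz_funE[OF assms(1)])
  note A = A(1) A(2)[rule_format]
  obtain B where B: "B > 0" "\<forall>x\<in>M. \<forall>y\<in>M. dist (g x) (g y) \<le> B * d x y"
    by (rule lipschitz_funE[OF assms(2)])
  note B = B(1) B(2)[rule_format]
  obtain S where S: "0 \<le> S" "\<And>x. x \<in> M \<Longrightarrow> norm (f x) \<le> S"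
    by (rule cont_bounded[OF lipschitz_fun_continuous[OF assms(1)]]) blast
  obtain T where T: "0 \<le> T" "\<And>x. x \<in> M \<Longrightarrow> norm (g x) \<le> T"
    by (rule cont_bounded[OF lipschitz_fun_continuous[OF assms(2)]]) blast
  show ?thesis
  proof (rule lipschitz_funI[where L = "S * B + A * T"])
    fix x y assume xy: "x \<in> M" "y \<in> M"
    have "f x * g x - f y * g y = f x * (g x - g y) + (f x - f y) * g y"
      by (simp add: algebra_simps)
    then have "dist (f x * g x) (f y * g y) \<le> norm (f x) * norm (g x - g y) + norm (f x - f y) * norm (g y)"
      unfolding dist_norm by (simp add: norm_triangle_le[OF add_mono] norm_mult_ineq)
    also have "\<dots> \<le> S * (B * d x y) + (A * d x y) * T"
      using A B S T xy by (intro add_mono mult_mono) (auto simp: dist_norm[symmetric])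
    finally show "dist (f x * g x) (f y * g y) \<le> (S * B + A * T) * d x y"
      by (simp add: algebra_simps)
  qed
qed

lemma lipschitz_fun_inverse:
  fixes f :: "'k \<Rightarrow> 'b::real_normed_field"
  assumes f: "lipschitz_fun \<rho> f" and nz: "\<And>x. x \<in> M \<Longrightarrow> f x \<noteq> 0"
  shows "lipschitz_fun \<rho> (\<lambda>x. inverse (f x))"
proof -
  obtain A where A: "A > 0" "\<forall>x\<in>M. \<forall>y\<in>M. dist (f x) (f y) \<le> A * d x y"
    by (rule lipschitz_funE[OF f])
  note A = A(1) A(2)[rule_format]
  have "cont (\<lambda>x. norm (f x))" using lipschitz_fun_continuous[OF f] by (rule continuous_map_norm)
  then obtain c where c: "0 < c" "\<And>x. x \<in> M \<Longrightarrow> c \<le> norm (f x)"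
    by (rule cont_positive) (use nz in auto)
  show ?thesis
  proof (rule lipschitz_funI[where L = "A / (c * c)"])
    fix x y assume xy: "x \<in> M" "y \<in> M"
    have "inverse (f x) - inverse (f y) = - ((f x - f y) / (f x * f y))"
      using nz[OF xy(1)] nz[OF xy(2)] by (simp add: field_simps)
    then have "dist (inverse (f x)) (inverse (f y)) = norm (f x - f y) / (norm (f x) * norm (f y))"
      by (simp add: dist_norm norm_divide norm_mult)
    also have "\<dots> \<le> (A * d x y) / (c * c)"
      using A(2)[OF xy] c(1) c(2)[OF xy(1)] c(2)[OF xy(2)] A(1)
      by (intro frac_le mult_mono) (auto simp: dist_norm)
    finally show "dist (inverse (f x)) (inverse (f y)) \<le> A / (c * c) * d x y" by simp
  qed
qed

text \<open>The distance to the complement of \<open>V\<close>, with value \<open>1\<close> where that complement is empty.\<close>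

definition gap :: "'k set \<Rightarrow> 'k \<Rightarrow> real"
  where "gap V x = (if M \<subseteq> V then 1 else INF y\<in>M - V. d x y)"

lemma gap_lower: "y \<in> M \<Longrightarrow> y \<notin> V \<Longrightarrow> gap V x \<le> d x y"
  unfolding gap_def by (auto intro!: cINF_lower bdd_belowI[where m = 0])

lemma gap_greatest:
  assumes "\<not> M \<subseteq> V" "\<And>y. y \<in> M \<Longrightarrow> y \<notin> V \<Longrightarrow> c \<le> d x y"
  shows "c \<le> gap V x"
  using assms unfolding gap_def by (auto intro!: cINF_greatest)

lemma gap_nonneg: "0 \<le> gap V x"
  using gap_greatest[of V 0 x] by (cases "M \<subseteq> V") (auto simp: gap_def)

lemma mdist_self: "x \<in> M \<Longrightarrow> d x x = 0"
  by simp

lemma gap_outside: "x \<in> M \<Longrightarrow> x \<notin> V \<Longrightarrow> gap V x = 0"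
  using gap_lower[of x V x] gap_nonneg[of V x] mdist_self[of x] by linarith

lemma gap_inside:
  assumes V: "openin (mtopology_of \<rho>) V" and x: "x \<in> V"
  shows "0 < gap V x"
proof (cases "M \<subseteq> V")
  case False
  obtain r where r: "0 < r" "Metric_space.mball M d x r \<subseteq> V"
    using V x Metric_space.openin_mtopology[OF Metric_space_mspace_mdist, of \<rho> V]
    by (auto simp: mtopology_of_def)
  have xM: "x \<in> M" using openin_subset[OF V] x by auto
  have "r \<le> gap V x"
  proof (rule gap_greatest[OF False])
    fix y assume "y \<in> M" "y \<notin> V"
    then have "y \<notin> Metric_space.mball M d x r" using r by blast
    then show "r \<le> d x y"
      using xM \<open>y \<in> M\<close> by (simp add: Metric_space.in_mball[OF Metric_space_mspace_mdist])
  qed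
  then show ?thesis using r by linarith
qed (simp add: gap_def)

lemma gap_lipschitz: "lipschitz_fun \<rho> (gap V)"
proof (cases "M \<subseteq> V")
  case True
  then have "gap V = (\<lambda>x. 1)" by (auto simp: gap_def)
  then show ?thesis by (simp add: lipschitz_fun_const)
next
  case False
  have 1: "gap V x - d x y \<le> gap V y" if "x \<in> M" "y \<in> M" for x y
  proof (rule gap_greatest[OF False])
    fix z assume z: "z \<in> M" "z \<notin> V"
    have "d x z \<le> d x y + d y z" using that z by (intro mdist_triangle)
    then show "gap V x - d x y \<le> d y z" using gap_lower[OF z, of x] by linarith
  qed
  show ?thesis
  proof (rule lipschitz_funI[where L = 1])
    fix x y assume "x \<in> M" "y \<in> M"
    then show "dist (gap V x) (gap V y) \<le> 1 * d x y"
      using 1[of x y] 1[of y x] mdist_commute[of \<rho> x y] by (simp add: dist_real_def abs_le_iff)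
  qed
qed

lemma cont_gap: "cont (gap V)"
  by (rule lipschitz_fun_continuous[OF gap_lipschitz])

text \<open>The infimal convolution of \<open>f\<close> with \<open>L * d\<close> is \<open>L\<close>-Lipschitz and lies below \<open>f\<close>. For points at
distance at least \<open>\<delta>\<close> the penalty \<open>L * \<delta> = 2 * B\<close> outweighs the oscillation of \<open>f\<close>, so only nearby points count.\<close>

lemma lipschitz_dense_real:
  fixes f :: "'k \<Rightarrow> real"
  assumes f: "cont f" and \<epsilon>: "0 < \<epsilon>"
  shows "\<exists>g. lipschitz_fun \<rho> g \<and> (\<forall>x\<in>M. \<bar>g x - f x\<bar> < \<epsilon>)"
proof -
  obtain B where B: "0 \<le> B" "\<And>x. x \<in> M \<Longrightarrow> \<bar>f x\<bar> \<le> B"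
    by (rule cont_bounded[OF f]) (simp add: real_norm_def)
  have "uniformly_continuous_map \<rho> euclidean_metric f"
    using continuous_imp_uniformly_continuous_map[of \<rho> euclidean_metric f] compact f by simp
  then obtain \<delta> where \<delta>: "0 < \<delta>" "\<And>x y. x \<in> M \<Longrightarrow> y \<in> M \<Longrightarrow> d y x < \<delta> \<Longrightarrow> dist (f y) (f x) < \<epsilon> / 2"
  proof -
    have "0 < \<epsilon> / 2" using \<epsilon> by simp
    with \<open>uniformly_continuous_map \<rho> euclidean_metric f\<close> show thesis
      unfolding uniformly_continuous_map_def mdist_euclidean_metric by (blast intro: that)
  qed
  define L where "L = 2 * B / \<delta>"
  have L: "0 \<le> L" using B \<delta> by (simp add: L_def)
  define g where "g x = (INF y\<in>M. f y + L * d x y)" for x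
  have bdd: "bdd_below ((\<lambda>y. f y + L * d x y) ` M)" for x
  proof (rule bdd_belowI2)
    fix y assume "y \<in> M"
    then show "- B \<le> f y + L * d x y"
      using B(2)[of y] mult_nonneg_nonneg[OF L, of "d x y"] by (simp add: abs_le_iff)
  qed
  have lower: "g x \<le> f y + L * d x y" if "y \<in> M" for x y
    unfolding g_def by (rule cINF_lower[OF bdd that])
  have greatest: "c \<le> g x" if "\<And>y. y \<in> M \<Longrightarrow> c \<le> f y + L * d x y" for c x
    unfolding g_def using nonempty that by (rule cINF_greatest)
  have 1: "g x - L * d x y \<le> g y" if "x \<in> M" "y \<in> M" for x y
  proof (rule greatest)
    fix z assume z: "z \<in> M"
    have "L * d x z \<le> L * (d x y + d y z)" using that z L by (intro mult_left_mono mdist_triangle)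
    then show "g x - L * d x y \<le> f z + L * d y z"
      using lower[OF z, of x] by (simp add: distrib_left)
  qed
  have "lipschitz_fun \<rho> g"
  proof (rule lipschitz_funI[where L = L])
    fix x y assume "x \<in> M" "y \<in> M"
    then show "dist (g x) (g y) \<le> L * d x y"
      using 1[of x y] 1[of y x] mdist_commute[of \<rho> x y] by (simp add: dist_real_def abs_le_iff)
  qed
  moreover have "\<bar>g x - f x\<bar> < \<epsilon>" if x: "x \<in> M" for x
  proof -
    have "g x \<le> f x" using lower[OF x, of x] by (simp only: mdist_self[OF x] mult_zero_right add_0_right)
    moreover have "f x - \<epsilon> / 2 \<le> g x"
    proof (rule greatest)
      fix y assume y: "y \<in> M"
      show "f x - \<epsilon> / 2 \<le> f y + L * d x y"
      proof (cases "d x y < \<delta>")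
        case True
        then show ?thesis
          using \<delta>(2)[OF y x] mult_nonneg_nonneg[OF L, of "d x y"] by (simp add: dist_real_def abs_if split: if_splits)
      next
        case False
        then have "L * \<delta> \<le> L * d x y" using L by (intro mult_left_mono) auto
        moreover have "L * \<delta> = 2 * B" using \<delta> by (simp add: L_def)
        ultimately show ?thesis using B(2)[OF x] B(2)[OF y] \<epsilon> by (simp add: abs_le_iff)
      qed
    qed
    ultimately show ?thesis using \<epsilon> by (simp add: abs_if)
  qed
  ultimately show ?thesis by blast
qed

lemma openin_less:
  fixes f g :: "'k \<Rightarrow> real"
  assumes "cont f" "cont g"
  shows "openin (mtopology_of \<rho>) {x \<in> M. f x < g x}"
proof -
  have "openin (mtopology_of \<rho>) {x \<in> topspace (mtopology_of \<rho>). g x - f x \<in> {0<..}}"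
    by (rule openin_continuous_map_preimage[OF continuous_map_diff[OF assms(2,1)]]) auto
  then show ?thesis by simp
qed

end

section \<open>Removable zeros bound the covering dimension\<close>

context compact_metric
begin

text \<open>In dimension theory: every map into Euclidean \<open>N\<close>-space is unstable at the origin.\<close>

definition zeros_removable :: "nat \<Rightarrow> bool"
  where "zeros_removable N \<longleftrightarrow>
    (\<forall>h :: nat \<Rightarrow> 'k \<Rightarrow> real. (\<forall>j<N. cont (h j)) \<longrightarrow> (\<forall>\<epsilon>>0. \<exists>h'. (\<forall>j<N. cont (h' j)) \<and>
      (\<forall>j<N. \<forall>x\<in>M. \<bar>h' j x - h j x\<bar> < \<epsilon>) \<and> (\<forall>x\<in>M. \<exists>j<N. h' j x \<noteq> 0)))"

text \<open>Let \<open>g\<^sub>i\<close> be positive exactly on \<open>V\<^sub>i\<close>. Perturbing the \<open>N\<close> differences \<open>g\<^sub>j - g\<^sub>N\<close> such that they have no common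
zero means perturbing the \<open>g\<^sub>i\<close> such that the \<open>N + 1\<close> values are nowhere all equal. Then let \<open>W\<^sub>i\<close> be the set
where \<open>g\<^sub>i\<close> exceeds a threshold and is not minimal: at each point some index is minimal, so the
intersection is empty, and the maximal value is not minimal, so the sets still cover.\<close>

lemma shrink_cover:
  fixes V :: "nat \<Rightarrow> 'k set"
  assumes approx: "zeros_removable N"
    and V: "\<And>i. i \<le> N \<Longrightarrow> openin (mtopology_of \<rho>) (V i)" "(\<Union>i\<le>N. V i) = M"
  shows "\<exists>W. (\<forall>i\<le>N. openin (mtopology_of \<rho>) (W i) \<and> W i \<subseteq> V i) \<and> (\<Union>i\<le>N. W i) = M \<and>
      (\<Inter>i\<le>N. W i) = {}"
proof -
  have "cont (\<lambda>x. \<Sum>i\<le>N. gap (V i) x)"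
    by (intro continuous_map_sum cont_gap) auto
  moreover have "0 < (\<Sum>i\<le>N. gap (V i) x)" if "x \<in> M" for x
  proof -
    have "x \<in> (\<Union>i\<le>N. V i)" using V(2) that by simp
    then obtain i where i: "i \<le> N" "x \<in> V i" by blast
    then have "0 < gap (V i) x" using V(1) by (intro gap_inside) auto
    then show ?thesis using i gap_nonneg by (intro sum_pos2[of _ i]) auto
  qed
  ultimately have "\<exists>c>0. \<forall>x\<in>M. c \<le> (\<Sum>i\<le>N. gap (V i) x)"
    by (rule cont_positive) auto
  then obtain c where c: "0 < c" "\<And>x. x \<in> M \<Longrightarrow> c \<le> (\<Sum>i\<le>N. gap (V i) x)"
    by blast
  \<comment> \<open>some \<open>gap (V i) x\<close> is at least \<open>2 * \<epsilon>\<close>, so the threshold \<open>\<epsilon>\<close> survives a perturbation by \<open>\<epsilon>\<close>\<close>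
  define \<epsilon> where "\<epsilon> = c / (2 * (real N + 1))"
  have \<epsilon>: "0 < \<epsilon>" using c by (simp add: \<epsilon>_def)
  define h where "h j x = gap (V j) x - gap (V N) x" for j x
  have "\<forall>j<N. cont (h j)"
    unfolding h_def by (intro allI impI continuous_map_diff cont_gap)
  then obtain h' :: "nat \<Rightarrow> 'k \<Rightarrow> real" where h': "\<forall>j<N. cont (h' j)" "\<forall>j<N. \<forall>x\<in>M. \<bar>h' j x - h j x\<bar> < \<epsilon>"
    "\<forall>x\<in>M. \<exists>j<N. h' j x \<noteq> 0"
    using approx \<epsilon> unfolding zeros_removable_def by blast
  \<comment> \<open>perturbed gap functions, with the \<open>N\<close>-th one unchanged\<close>
  define g where "g j x = gap (V N) x + (if j < N then h' j x else 0)" for j x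
  have cont_g: "cont (g j)" for j
    using h'(1) unfolding g_def by (cases "j < N") (auto intro!: continuous_map_add cont_gap)
  have near: "\<bar>g j x - gap (V j) x\<bar> < \<epsilon>" if "j \<le> N" "x \<in> M" for j x
    using h'(2) that \<epsilon> by (cases "j < N") (auto simp: g_def h_def algebra_simps)
  define W where "W i = (\<Union>j\<le>N. {x \<in> M. g j x < g i x} \<inter> {x \<in> M. \<epsilon> < g i x})" for i
  have "openin (mtopology_of \<rho>) (W i)" for i
  proof -
    have "openin (mtopology_of \<rho>) ({x \<in> M. g j x < g i x} \<inter> {x \<in> M. \<epsilon> < g i x})" for j
      by (intro openin_Int openin_less cont_g) auto
    then show ?thesis unfolding W_def by blast
  qed
  moreover have "W i \<subseteq> V i" if "i \<le> N" for i
  proof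
    fix x assume "x \<in> W i"
    then have x: "x \<in> M" "\<epsilon> < g i x" by (auto simp: W_def)
    then have "gap (V i) x \<noteq> 0" using near[OF that x(1)] by auto
    then show "x \<in> V i" using gap_outside x(1) by blast
  qed
  moreover have "(\<Union>i\<le>N. W i) = M"
  proof
    show "M \<subseteq> (\<Union>i\<le>N. W i)"
    proof
      fix x assume x: "x \<in> M"
      have "\<exists>i\<le>N. 2 * \<epsilon> \<le> gap (V i) x"
      proof (rule ccontr)
        assume "\<not> ?thesis"
        then have "(\<Sum>i\<le>N. gap (V i) x) < (\<Sum>i\<le>N. 2 * \<epsilon>)"
          by (intro sum_strict_mono) auto
        also have "\<dots> = c" by (simp add: \<epsilon>_def field_simps)
        finally show False using c(2)[OF x] by simp
      qed
      then obtain i0 where i0: "i0 \<le> N" "2 * \<epsilon> \<le> gap (V i0) x" by blast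
      define m where "m = Max ((\<lambda>j. g j x) ` {..N})"
      have m_ge: "g j x \<le> m" if "j \<le> N" for j
        unfolding m_def using that by (intro Max_ge) auto
      have "m \<in> (\<lambda>j. g j x) ` {..N}" unfolding m_def by (intro Max_in) auto
      then obtain i where i: "i \<le> N" "g i x = m" by auto
      have "\<epsilon> < g i x"
        using near[OF i0(1) x] i0(2) m_ge[OF i0(1)] i(2) by linarith
      moreover have "\<exists>j\<le>N. g j x < g i x"
      proof (rule ccontr)
        assume "\<not> ?thesis"
        then have eq: "g j x = m" if "j \<le> N" for j using m_ge[OF that] i(2) that by force
        obtain j where "j < N" "h' j x \<noteq> 0" using h'(3) x by blast
        then show False using eq[of j] eq[of N] by (simp add: g_def)
      qed
      ultimately show "x \<in> (\<Union>i\<le>N. W i)" using i(1) x unfolding W_def by blast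
    qed
  qed (auto simp: W_def)
  moreover have "(\<Inter>i\<le>N. W i) = {}"
  proof (rule ccontr)
    assume "(\<Inter>i\<le>N. W i) \<noteq> {}"
    then obtain x where x: "\<And>i. i \<le> N \<Longrightarrow> x \<in> W i" by blast
    define m where "m = Min ((\<lambda>j. g j x) ` {..N})"
    have "m \<in> (\<lambda>j. g j x) ` {..N}" unfolding m_def by (intro Min_in) auto
    then obtain i where i: "i \<le> N" "g i x = m" by auto
    have "m \<le> g j x" if "j \<le> N" for j
      unfolding m_def using that by (intro Min_le) auto
    then show False using x[OF i(1)] i(2) by (force simp: W_def)
  qed
  ultimately show ?thesis by blast
qed

text \<open>Merge all members outside \<open>S\<close> into one member of \<open>S\<close> to get a cover with \<open>N + 1\<close> members, shrink it, and
distribute the shrinking back. The map \<open>\<sigma>\<close> records into which member an index is merged.\<close>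

lemma shrink_subfamily:
  fixes V :: "'i \<Rightarrow> 'k set"
  assumes approx: "zeros_removable N"
    and V: "\<And>i. i \<in> I \<Longrightarrow> openin (mtopology_of \<rho>) (V i)" "(\<Union>i\<in>I. V i) = M"
    and S: "S \<subseteq> I" "finite S" "card S = Suc N"
  shows "\<exists>W. (\<forall>i\<in>I. openin (mtopology_of \<rho>) (W i) \<and> W i \<subseteq> V i) \<and> (\<Union>i\<in>I. W i) = M \<and>
      (\<Inter>i\<in>S. W i) = {}"
proof -
  obtain h where h: "bij_betw h {..N} S"
    using ex_bij_betw_nat_finite[OF S(2)] S(3) by (auto simp: atLeast0LessThan lessThan_Suc_atMost)
  define \<sigma> where "\<sigma> i = (if i \<in> S then the_inv_into {..N} h i else N)" for i
  have \<sigma>: "\<sigma> i \<le> N" for i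
    using bij_betw_the_inv_into[OF h] by (auto simp: \<sigma>_def bij_betw_def)
  have \<sigma>h: "\<sigma> (h j) = j" if "j \<le> N" for j
    unfolding \<sigma>_def using h that by (auto simp: bij_betw_def intro!: the_inv_into_f_f)
  have h\<sigma>: "h (\<sigma> i) = i" if "i \<in> S" for i
    unfolding \<sigma>_def using h that by (auto simp: bij_betw_def intro!: f_the_inv_into_f)
  have hS: "h j \<in> S" if "j \<le> N" for j using h that by (auto simp: bij_betw_def)
  define U where "U j = (\<Union>i\<in>{i \<in> I. \<sigma> i = j}. V i)" for j
  have "\<exists>W. (\<forall>j\<le>N. openin (mtopology_of \<rho>) (W j) \<and> W j \<subseteq> U j) \<and> (\<Union>j\<le>N. W j) = M \<and> (\<Inter>j\<le>N. W j) = {}"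
  proof (rule shrink_cover[OF approx])
    show "openin (mtopology_of \<rho>) (U j)" for j
      unfolding U_def using V(1) by (intro openin_Union) auto
    have "(\<Union>j\<le>N. U j) = (\<Union>i\<in>I. V i)"
    proof (intro subset_antisym subsetI)
      fix x assume "x \<in> (\<Union>i\<in>I. V i)"
      then obtain i where "i \<in> I" "x \<in> V i" by blast
      then have "x \<in> U (\<sigma> i)" unfolding U_def by blast
      then show "x \<in> (\<Union>j\<le>N. U j)" using \<sigma>[of i] by blast
    qed (auto simp: U_def)
    then show "(\<Union>j\<le>N. U j) = M" using V(2) by simp
  qed
  then obtain W where W: "\<And>j. j \<le> N \<Longrightarrow> openin (mtopology_of \<rho>) (W j)" "\<And>j. j \<le> N \<Longrightarrow> W j \<subseteq> U j"
    "(\<Union>j\<le>N. W j) = M" "(\<Inter>j\<le>N. W j) = {}"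
    by (elim exE conjE) (rule that, simp_all)
  define W' where "W' i = V i \<inter> W (\<sigma> i)" for i
  have "(\<Union>i\<in>I. W' i) = M"
  proof
    show "(\<Union>i\<in>I. W' i) \<subseteq> M" using V(2) by (auto simp: W'_def)
    show "M \<subseteq> (\<Union>i\<in>I. W' i)"
    proof
      fix x assume "x \<in> M"
      then obtain j where j: "j \<le> N" "x \<in> W j" using W(3) by blast
      then obtain i where "i \<in> I" "\<sigma> i = j" "x \<in> V i" using W(2)[OF j(1)] unfolding U_def by blast
      then show "x \<in> (\<Union>i\<in>I. W' i)" using j by (auto simp: W'_def)
    qed
  qed
  moreover have "(\<Inter>i\<in>S. W' i) \<subseteq> (\<Inter>j\<le>N. W j)"
  proof
    fix x assume x: "x \<in> (\<Inter>i\<in>S. W' i)"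
    have "x \<in> W j" if "j \<le> N" for j
      using x hS[OF that] \<sigma>h[OF that] by (auto simp: W'_def)
    then show "x \<in> (\<Inter>j\<le>N. W j)" by blast
  qed
  ultimately show ?thesis
    using V(1) W(1,4) \<sigma> by (intro exI[of _ W']) (auto simp: W'_def)
qed

end

context compact_metric
begin

text \<open>Shrinking for one subfamily of \<open>N + 1\<close> members after the other keeps what was achieved before, because
members only get smaller. At the end no point lies in more than \<open>N\<close> members.\<close>

theorem covering_dim_le_if_zeros_removable:
  assumes approx: "zeros_removable N"
    and N: "N \<le> Suc D"
  shows "covering_dim_le (mtopology_of \<rho>) D"
  unfolding covering_dim_le_def
proof (intro allI impI, elim conjE)
  fix \<U> assume \<U>: "finite \<U>" "\<forall>U\<in>\<U>. openin (mtopology_of \<rho>) U" "\<Union>\<U> = topspace (mtopology_of \<rho>)"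
  have "\<exists>V. (\<forall>U\<in>\<U>. openin (mtopology_of \<rho>) (V U) \<and> V U \<subseteq> U) \<and> (\<Union>U\<in>\<U>. V U) = M \<and>
      (\<forall>S\<in>\<S>. (\<Inter>U\<in>S. V U) = {})"
    if "finite \<S>" "\<S> \<subseteq> {S. S \<subseteq> \<U> \<and> card S = Suc N}" for \<S>
    using that
  proof (induction \<S> rule: finite_induct)
    case empty
    then show ?case using \<U> by (intro exI[of _ "\<lambda>U. U"]) auto
  next
    case (insert S \<S>)
    then obtain V where V: "\<forall>U\<in>\<U>. openin (mtopology_of \<rho>) (V U) \<and> V U \<subseteq> U" "(\<Union>U\<in>\<U>. V U) = M"
      "\<forall>S\<in>\<S>. (\<Inter>U\<in>S. V U) = {}" by auto
    have S: "S \<subseteq> \<U>" "card S = Suc N" "finite S"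
      using insert.prems finite_subset[OF _ \<U>(1)] by auto
    have "\<exists>W. (\<forall>U\<in>\<U>. openin (mtopology_of \<rho>) (W U) \<and> W U \<subseteq> V U) \<and> (\<Union>U\<in>\<U>. W U) = M \<and>
        (\<Inter>U\<in>S. W U) = {}"
      by (rule shrink_subfamily[OF approx]) (use V S in auto)
    then obtain W where W: "\<forall>U\<in>\<U>. openin (mtopology_of \<rho>) (W U) \<and> W U \<subseteq> V U" "(\<Union>U\<in>\<U>. W U) = M"
      "(\<Inter>U\<in>S. W U) = {}" by blast
    have "(\<Inter>U\<in>T. W U) = {}" if "T \<in> \<S>" for T
    proof -
      have "T \<subseteq> \<U>" using insert.prems that by auto
      then have "(\<Inter>U\<in>T. W U) \<subseteq> (\<Inter>U\<in>T. V U)" using W(1) by (intro INF_mono) auto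
      then show ?thesis using V(3) that by auto
    qed
    moreover have "W U \<subseteq> U" if "U \<in> \<U>" for U
      using W(1) V(1) that by blast
    ultimately show ?case using W by (intro exI[of _ W]) auto
  qed
  from this[of "{S. S \<subseteq> \<U> \<and> card S = Suc N}"] obtain V where
    V: "\<forall>U\<in>\<U>. openin (mtopology_of \<rho>) (V U) \<and> V U \<subseteq> U" "(\<Union>U\<in>\<U>. V U) = M"
      "\<And>S. S \<subseteq> \<U> \<Longrightarrow> card S = Suc N \<Longrightarrow> (\<Inter>U\<in>S. V U) = {}"
    using \<U>(1) by auto
  have card: "card {W \<in> V ` \<U>. x \<in> W} \<le> D + 1" for x
  proof -
    let ?S = "{U \<in> \<U>. x \<in> V U}"
    have fin: "finite ?S" using \<U>(1) by simp
    have "card ?S \<le> N"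
    proof (rule ccontr)
      assume "\<not> card ?S \<le> N"
      then have "Suc N \<le> card ?S" by simp
      then obtain S where S: "S \<subseteq> ?S" "card S = Suc N"
        by (rule obtain_subset_with_card_n)
      then have "S \<subseteq> \<U>" by auto
      then have "(\<Inter>U\<in>S. V U) = {}" using S(2) by (rule V(3))
      moreover have "x \<in> (\<Inter>U\<in>S. V U)" using S by auto
      ultimately show False by blast
    qed
    moreover have "{W \<in> V ` \<U>. x \<in> W} \<subseteq> V ` ?S" by auto
    then have "card {W \<in> V ` \<U>. x \<in> W} \<le> card ?S"
      by (rule order_trans[OF card_mono[OF finite_imageI[OF fin]] card_image_le[OF fin]])
    ultimately show ?thesis using N by simp
  qed
  show "\<exists>\<V>. finite \<V> \<and> (\<forall>V\<in>\<V>. openin (mtopology_of \<rho>) V) \<and> \<Union>\<V> = topspace (mtopology_of \<rho>) \<and>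
      (\<forall>V\<in>\<V>. \<exists>U\<in>\<U>. V \<subseteq> U) \<and> (\<forall>x\<in>topspace (mtopology_of \<rho>). card {V \<in> \<V>. x \<in> V} \<le> D + 1)"
    using V(1,2) \<U>(1) card by (intro exI[of _ "V ` \<U>"]) auto
qed

end

section \<open>Small covering dimension makes zeros removable\<close>

context compact_metric
begin

text \<open>The stars of the barycentres in the first barycentric subdivision. For a subfamily \<open>S\<close>, let \<open>\<psi> S x\<close> be the
amount by which the values \<open>gap V x\<close> for \<open>V\<close> in \<open>S\<close> exceed those for all other \<open>V\<close>. For two different
subfamilies of the same size this cannot be positive for both at once, and at every point the family of all
\<open>V\<close> with maximal gap works. Compactness bounds the best \<open>\<psi> S x\<close> below by some \<open>c\<close>; dividing by \<open>c\<close> and cutting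
off at \<open>1\<close> gives the bumps.\<close>

lemma barycentric_bumps:
  assumes \<V>: "finite \<V>" "\<forall>V\<in>\<V>. openin (mtopology_of \<rho>) V" "\<Union>\<V> = M"
    and order: "\<forall>x\<in>M. card {V\<in>\<V>. x \<in> V} \<le> N"
  shows "\<exists>\<S> \<beta>. finite \<S> \<and> (\<forall>S\<in>\<S>. S \<subseteq> \<V> \<and> S \<noteq> {} \<and> finite S \<and> card S \<le> N \<and> lipschitz_fun \<rho> (\<beta> S)) \<and>
    (\<forall>S x. 0 \<le> \<beta> S x \<and> \<beta> S x \<le> (1::real)) \<and>
    (\<forall>S\<in>\<S>. \<forall>V\<in>S. \<forall>x\<in>M. 0 < \<beta> S x \<longrightarrow> x \<in> V) \<and>
    (\<forall>S\<in>\<S>. \<forall>S'\<in>\<S>. \<forall>x. card S = card S' \<longrightarrow> 0 < \<beta> S x \<longrightarrow> 0 < \<beta> S' x \<longrightarrow> S = S') \<and>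
    (\<forall>x\<in>M. \<exists>S\<in>\<S>. \<beta> S x = 1)"
proof -
  have gap_pos: "0 < gap V x \<longleftrightarrow> x \<in> V" if "V \<in> \<V>" "x \<in> M" for V x
    using gap_inside[of V x] gap_outside[of x V] that \<V>(2) by fastforce
  have "\<V> \<noteq> {}" using \<V>(3) nonempty by auto
  define lo where "lo S x = Min ((\<lambda>V. gap V x) ` S)" for S x
  define hi where "hi S x = Max ((\<lambda>V. if V \<in> S then 0 else gap V x) ` \<V>)" for S x
  define \<psi> where "\<psi> S x = max 0 (lo S x - hi S x)" for S x
  define \<S> where "\<S> = {S. S \<subseteq> \<V> \<and> S \<noteq> {} \<and> card S \<le> N}"
  have \<S>: "finite \<S>" "\<And>S. S \<in> \<S> \<Longrightarrow> finite S \<and> S \<noteq> {} \<and> S \<subseteq> \<V>"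
    using \<V>(1) finite_subset by (auto simp: \<S>_def)
  have \<psi>_lip: "lipschitz_fun \<rho> (\<psi> S)" if "S \<in> \<S>" for S
  proof -
    have 0: "lipschitz_fun \<rho> (\<lambda>x. if V \<in> S then 0 else gap V x)" for V
      by (cases "V \<in> S") (simp_all add: lipschitz_fun_const gap_lipschitz)
    show ?thesis
      unfolding \<psi>_def lo_def hi_def
      by (intro lipschitz_fun_max lipschitz_fun_diff lipschitz_fun_Min lipschitz_fun_Max
          lipschitz_fun_const gap_lipschitz 0) (use \<S>(2)[OF that] \<V>(1) \<open>\<V> \<noteq> {}\<close> in auto)
  qed
  have hi_ge: "gap V x \<le> hi S x" if "V \<in> \<V>" "V \<notin> S" for V S x
    unfolding hi_def using that \<V>(1) by (intro Max_ge) auto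
  have hi_nonneg: "0 \<le> hi S x" for S x
  proof -
    obtain V where "V \<in> \<V>" using \<open>\<V> \<noteq> {}\<close> by blast
    then have "(if V \<in> S then 0 else gap V x) \<le> hi S x"
      unfolding hi_def using \<V>(1) by (intro Max_ge) auto
    then show ?thesis using gap_nonneg[of V x] by (auto split: if_splits)
  qed
  have lo_le: "lo S x \<le> gap V x" if "S \<in> \<S>" "V \<in> S" for S V x
    unfolding lo_def using that \<S>(2) by (intro Min_le) auto
  have \<psi>_pos: "hi S x < lo S x" if "0 < \<psi> S x" for S x
    using that by (auto simp: \<psi>_def max_def split: if_splits)
  have \<psi>_disjoint: "S = S'"
    if S: "S \<in> \<S>" "S' \<in> \<S>" "card S = card S'" "0 < \<psi> S x" "0 < \<psi> S' x" for S S' x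
  proof (rule ccontr)
    assume "S \<noteq> S'"
    then have "\<not> S \<subseteq> S'" "\<not> S' \<subseteq> S"
      using S(3) \<S>(2)[OF S(1)] \<S>(2)[OF S(2)] card_subset_eq[of S' S] card_subset_eq[of S S'] by auto
    then obtain V V' where V: "V \<in> S" "V \<notin> S'" "V' \<in> S'" "V' \<notin> S" by blast
    then have "V \<in> \<V>" "V' \<in> \<V>" using \<S>(2)[OF S(1)] \<S>(2)[OF S(2)] by auto
    then show False
      using lo_le[OF S(1) V(1), of x] hi_ge[of V' S x] \<psi>_pos[OF S(4)]
        lo_le[OF S(2) V(3), of x] hi_ge[of V S' x] \<psi>_pos[OF S(5)] V by linarith
  qed
  have \<psi>_cover: "\<exists>S\<in>\<S>. 0 < \<psi> S x" if x: "x \<in> M" for x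
  proof -
    define m where "m = Max ((\<lambda>V. gap V x) ` \<V>)"
    \<comment> \<open>the family of all members with maximal gap at \<open>x\<close>\<close>
    define T where "T = {V \<in> \<V>. gap V x = m}"
    have m_ge: "gap V x \<le> m" if "V \<in> \<V>" for V
      unfolding m_def using that \<V>(1) by (intro Max_ge) auto
    obtain V where "V \<in> \<V>" "x \<in> V" using \<V>(3) x by blast
    then have m: "0 < m" using gap_pos[of V x] m_ge[of V] x by auto
    have "m \<in> (\<lambda>V. gap V x) ` \<V>" unfolding m_def using \<V>(1) \<open>\<V> \<noteq> {}\<close> by (intro Max_in) auto
    then have T: "T \<noteq> {}" "finite T" using \<V>(1) by (auto simp: T_def)
    have "T \<subseteq> {V\<in>\<V>. x \<in> V}" using gap_pos x m by (auto simp: T_def)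
    then have "card T \<le> card {V\<in>\<V>. x \<in> V}" using \<V>(1) by (intro card_mono) auto
    then have "card T \<le> N" using bspec[OF order x] by linarith
    then have "T \<in> \<S>" using T by (auto simp: \<S>_def T_def)
    moreover have "lo T x = m"
    proof -
      have "(\<lambda>V. gap V x) ` T = {m}" using T by (auto simp: T_def)
      then show ?thesis by (simp add: lo_def)
    qed
    moreover have "hi T x < m"
      unfolding hi_def using m m_ge \<V>(1) \<open>\<V> \<noteq> {}\<close>
      by (subst Max_less_iff) (auto simp: T_def less_le)
    ultimately show ?thesis by (intro bexI[of _ T]) (auto simp: \<psi>_def)
  qed
  have "cont (\<lambda>x. \<Sum>S\<in>\<S>. \<psi> S x)"
    by (intro lipschitz_fun_continuous lipschitz_fun_sum \<psi>_lip)
  moreover have "0 < (\<Sum>S\<in>\<S>. \<psi> S x)" if x: "x \<in> M" for x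
  proof -
    obtain S where "S \<in> \<S>" "0 < \<psi> S x" using \<psi>_cover[OF x] by blast
    then show ?thesis using \<S>(1) by (intro sum_pos2[of _ S]) (auto simp: \<psi>_def)
  qed
  ultimately have "\<exists>c>0. \<forall>x\<in>M. c \<le> (\<Sum>S\<in>\<S>. \<psi> S x)"
    by (rule cont_positive) auto
  then obtain c0 where c0: "0 < c0" "\<And>x. x \<in> M \<Longrightarrow> c0 \<le> (\<Sum>S\<in>\<S>. \<psi> S x)"
    by blast
  define c where "c = c0 / (real (card \<S>) + 1)"
  have c: "0 < c" using c0 by (simp add: c_def)
  have big: "\<exists>S\<in>\<S>. c \<le> \<psi> S x" if x: "x \<in> M" for x
  proof (rule ccontr)
    assume "\<not> ?thesis"
    then have "(\<Sum>S\<in>\<S>. \<psi> S x) \<le> (\<Sum>S\<in>\<S>. c)" by (intro sum_mono) auto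
    also have "\<dots> < (real (card \<S>) + 1) * c" using c by (simp add: algebra_simps)
    also have "\<dots> = c0" by (simp add: c_def)
    finally show False using c0(2)[OF x] by simp
  qed
  define \<beta> where "\<beta> S x = min 1 ((1 / c) * \<psi> S x)" for S x
  have \<beta>_lip: "lipschitz_fun \<rho> (\<beta> S)" if "S \<in> \<S>" for S
    unfolding \<beta>_def by (intro lipschitz_fun_min lipschitz_fun_mult lipschitz_fun_const \<psi>_lip that)
  have \<beta>_range: "0 \<le> \<beta> S x" "\<beta> S x \<le> 1" for S x
    using c by (auto simp: \<beta>_def \<psi>_def)
  have \<beta>_zero: "\<beta> S x = 0" if "\<not> 0 < \<psi> S x" for S x
    using that by (simp add: \<beta>_def \<psi>_def max_def split: if_splits)
  have \<beta>_one: "\<beta> S x = 1" if "c \<le> \<psi> S x" for S x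
    using that c by (simp add: \<beta>_def)
  have \<beta>_pos: "0 < \<psi> S x" if "0 < \<beta> S x" for S x
    using that \<beta>_zero[of S x] by force
  have \<beta>_inside: "x \<in> V" if "S \<in> \<S>" "V \<in> S" "x \<in> M" "0 < \<beta> S x" for S V x
  proof -
    have "V \<in> \<V>" using \<S>(2)[OF that(1)] that(2) by blast
    then show ?thesis
      using gap_pos[of V x] that(3) lo_le[OF that(1,2), of x] \<psi>_pos[OF \<beta>_pos[OF that(4)]] hi_nonneg[of S x]
      by linarith
  qed
  have \<beta>_disjoint: "S = S'"
    if "S \<in> \<S>" "S' \<in> \<S>" "card S = card S'" "0 < \<beta> S x" "0 < \<beta> S' x" for S S' x
    using \<psi>_disjoint[OF that(1-3)] \<beta>_pos that(4,5) by blast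
  have \<beta>_cover: "\<exists>S\<in>\<S>. \<beta> S x = 1" if "x \<in> M" for x
    using big[OF that] \<beta>_one by blast
  have \<S>_props: "S \<subseteq> \<V> \<and> S \<noteq> {} \<and> finite S \<and> card S \<le> N \<and> lipschitz_fun \<rho> (\<beta> S)"
    if "S \<in> \<S>" for S
    using \<S>(2)[OF that] \<beta>_lip[OF that] that by (simp add: \<S>_def)
  show ?thesis
    by (intro exI[of _ \<S>] exI[of _ \<beta>] conjI ballI allI impI \<S>(1) \<beta>_range)
      (use \<S>_props \<beta>_inside \<beta>_disjoint \<beta>_cover in auto)
qed

text \<open>Bumps belonging to subfamilies of size \<open>i + 1\<close> are disjoint, and each lives on a set where the \<open>i\<close>-th function
hardly varies. There the \<open>i\<close>-th function is replaced by a nonzero constant close to its values. Every point is in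
the plateau of some bump, and so one of the functions is nonzero at it.\<close>

theorem remove_zeros:
  fixes f :: "nat \<Rightarrow> 'k \<Rightarrow> real"
  assumes dim: "covering_dim_le (mtopology_of \<rho>) D" and N: "Suc D \<le> N"
    and f: "\<And>i. i < N \<Longrightarrow> cont (f i)" and \<epsilon>: "0 < \<epsilon>"
  shows "\<exists>g. (\<forall>i<N. lipschitz_fun \<rho> (g i)) \<and> (\<forall>i<N. \<forall>x\<in>M. \<bar>g i x - f i x\<bar> < \<epsilon>) \<and>
      (\<forall>x\<in>M. \<exists>i<N. g i x \<noteq> 0)"
proof -
  define \<eta> where "\<eta> = \<epsilon> / 3"
  have \<eta>: "0 < \<eta>" using \<epsilon> by (simp add: \<eta>_def)
  have "\<forall>i. \<exists>g. i < N \<longrightarrow> lipschitz_fun \<rho> g \<and> (\<forall>x\<in>M. \<bar>g x - f i x\<bar> < \<eta>)"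
    using lipschitz_dense_real[OF f \<eta>] by blast
  from choice[OF this] obtain g where g: "\<And>i. i < N \<Longrightarrow> lipschitz_fun \<rho> (g i)"
    "\<And>i x. i < N \<Longrightarrow> x \<in> M \<Longrightarrow> \<bar>g i x - f i x\<bar> < \<eta>" by blast
  \<comment> \<open>a finite cover by open sets on which all \<open>g i\<close> oscillate by less than \<open>\<eta>\<close>\<close>
  define small where "small U \<longleftrightarrow> (\<forall>i<N. \<forall>x\<in>U. \<forall>y\<in>U. \<bar>g i x - g i y\<bar> < \<eta>)" for U
  define nb where "nb z = (\<Inter>i<N. {x \<in> M. \<bar>g i x - g i z\<bar> < \<eta> / 2}) \<inter> M" for z
  have nb_open: "openin (mtopology_of \<rho>) (nb z)" for z
  proof -
    have *: "openin (mtopology_of \<rho>) {x \<in> M. \<bar>g i x - g i z\<bar> < \<eta> / 2}" if "i < N" for i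
      using lipschitz_fun_continuous[OF g(1)[OF that]]
      by (intro openin_less continuous_map_real_abs continuous_map_diff) auto
    have "openin (mtopology_of \<rho>)
        ((\<Inter>i<N. {x \<in> M. \<bar>g i x - g i z\<bar> < \<eta> / 2}) \<inter> topspace (mtopology_of \<rho>))"
      by (rule openin_INT[OF finite_lessThan], rule *) simp
    then show ?thesis by (simp only: nb_def topspace_mtopology_of)
  qed
  have nb_small: "small (nb z)" for z
    unfolding small_def
  proof (intro allI impI ballI)
    fix i x y assume "i < N" "x \<in> nb z" "y \<in> nb z"
    then have "x \<in> {x \<in> M. \<bar>g i x - g i z\<bar> < \<eta> / 2}" "y \<in> {x \<in> M. \<bar>g i x - g i z\<bar> < \<eta> / 2}"
      unfolding nb_def by blast+
    then have "\<bar>g i x - g i z\<bar> < \<eta> / 2" "\<bar>g i y - g i z\<bar> < \<eta> / 2"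
      by blast+
    then show "\<bar>g i x - g i y\<bar> < \<eta>" by linarith
  qed
  obtain \<U> where \<U>: "finite \<U>" "\<U> \<subseteq> nb ` M" "M \<subseteq> \<Union>\<U>"
  proof -
    have "M \<subseteq> \<Union>(nb ` M)" using \<eta> by (auto simp: nb_def)
    moreover have "\<forall>\<U>. (\<forall>U\<in>\<U>. openin (mtopology_of \<rho>) U) \<and> M \<subseteq> \<Union>\<U> \<longrightarrow>
        (\<exists>\<F>. finite \<F> \<and> \<F> \<subseteq> \<U> \<and> M \<subseteq> \<Union>\<F>)"
      using compact by (simp add: compact_space_def compactin_def)
    ultimately have "\<exists>\<F>. finite \<F> \<and> \<F> \<subseteq> nb ` M \<and> M \<subseteq> \<Union>\<F>"
      using nb_open by simp
    then show thesis using that by blast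
  qed
  have \<U>_props: "\<forall>U\<in>\<U>. openin (mtopology_of \<rho>) U" "\<Union>\<U> = topspace (mtopology_of \<rho>)"
    using \<U>(2,3) nb_open by (auto simp: nb_def)
  obtain \<V> where \<V>: "finite \<V>" "\<forall>V\<in>\<V>. openin (mtopology_of \<rho>) V" "\<Union>\<V> = M"
    "\<forall>V\<in>\<V>. \<exists>U\<in>\<U>. V \<subseteq> U" "\<forall>x\<in>M. card {V\<in>\<V>. x \<in> V} \<le> D + 1"
    using dim[unfolded covering_dim_le_def, rule_format, of \<U>] \<U>(1) \<U>_props by auto
  have \<V>_small: "small V" if "V \<in> \<V>" for V
  proof -
    have "\<exists>U\<in>\<U>. V \<subseteq> U" using \<V>(4) that by simp
    then obtain U where U: "U \<in> \<U>" "V \<subseteq> U" by blast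
    from subsetD[OF \<U>(2) U(1)] obtain z where z: "U = nb z" by (rule imageE)
    show ?thesis
      using nb_small[of z] subsetD[OF U(2)] unfolding small_def z by simp
  qed
  have "\<forall>x\<in>M. card {V\<in>\<V>. x \<in> V} \<le> N" using \<V>(5) N by force
  from barycentric_bumps[OF \<V>(1-3) this]
  obtain \<S> \<beta> where \<S>: "finite \<S>"
      "\<forall>S\<in>\<S>. S \<subseteq> \<V> \<and> S \<noteq> {} \<and> finite S \<and> card S \<le> N \<and> lipschitz_fun \<rho> (\<beta> S)"
    and \<beta>: "\<forall>S x. 0 \<le> \<beta> S x \<and> \<beta> S x \<le> (1::real)"
      "\<forall>S\<in>\<S>. \<forall>V\<in>S. \<forall>x\<in>M. 0 < \<beta> S x \<longrightarrow> x \<in> V"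
      "\<forall>S\<in>\<S>. \<forall>S'\<in>\<S>. \<forall>x. card S = card S' \<longrightarrow> 0 < \<beta> S x \<longrightarrow> 0 < \<beta> S' x \<longrightarrow> S = S'"
      "\<forall>x\<in>M. \<exists>S\<in>\<S>. \<beta> S x = 1"
    by (elim exE conjE)
  have "\<exists>v. v \<noteq> 0 \<and> (\<forall>x\<in>M. 0 < \<beta> S x \<longrightarrow> \<bar>v - g i x\<bar> < 2 * \<eta>)" if S: "S \<in> \<S>" and i: "i < N" for S i
  proof (cases "\<exists>x\<in>M. 0 < \<beta> S x")
    case True
    then obtain x0 where x0: "x0 \<in> M" "0 < \<beta> S x0" by blast
    obtain V where V: "V \<in> S" "V \<in> \<V>" using bspec[OF \<S>(2) S] by blast
    have osc: "\<bar>g i x0 - g i x\<bar> < \<eta>" if "x \<in> M" "0 < \<beta> S x" for x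
    proof -
      have "x \<in> V" "x0 \<in> V" using \<beta>(2) S V(1) that x0 by auto
      then show ?thesis using \<V>_small[OF V(2)] i by (simp add: small_def)
    qed
    show ?thesis
    proof (cases "g i x0 = 0")
      case True
      have "\<bar>\<eta> - g i x\<bar> < 2 * \<eta>" if "x \<in> M" "0 < \<beta> S x" for x
        using osc[OF that] True \<eta> by linarith
      then show ?thesis using \<eta> by (intro exI[of _ \<eta>]) auto
    next
      case False
      have "\<bar>g i x0 - g i x\<bar> < 2 * \<eta>" if "x \<in> M" "0 < \<beta> S x" for x
        using osc[OF that] \<eta> by linarith
      then show ?thesis using False by blast
    qed
  qed (auto intro: exI[of _ 1])
  then have "\<forall>p. \<exists>v. fst p \<in> \<S> \<longrightarrow> snd p < N \<longrightarrow>
      v \<noteq> 0 \<and> (\<forall>x\<in>M. 0 < \<beta> (fst p) x \<longrightarrow> \<bar>v - g (snd p) x\<bar> < 2 * \<eta>)" by blast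
  from choice[OF this] obtain v where v: "\<And>S i. S \<in> \<S> \<Longrightarrow> i < N \<Longrightarrow> v (S, i) \<noteq> 0"
    "\<And>S i x. S \<in> \<S> \<Longrightarrow> i < N \<Longrightarrow> x \<in> M \<Longrightarrow> 0 < \<beta> S x \<Longrightarrow> \<bar>v (S, i) - g i x\<bar> < 2 * \<eta>"
    by auto
  define \<C> where "\<C> i = {S \<in> \<S>. card S = Suc i}" for i
  define g' where "g' i x = g i x + (\<Sum>S\<in>\<C> i. \<beta> S x * (v (S, i) - g i x))" for i x
  have single: "(\<Sum>S\<in>\<C> i. \<beta> S x * (v (S, i) - g i x)) = \<beta> S x * (v (S, i) - g i x)"
    if "S \<in> \<C> i" "0 < \<beta> S x" for S i x
  proof -
    have "\<beta> T x * (v (T, i) - g i x) = 0" if "T \<in> \<C> i - {S}" for T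
    proof -
      have "\<not> 0 < \<beta> T x"
        using \<beta>(3) that \<open>S \<in> \<C> i\<close> \<open>0 < \<beta> S x\<close> by (fastforce simp: \<C>_def)
      then have "\<beta> T x = 0" using \<beta>(1) by (meson order.antisym not_less)
      then show ?thesis by simp
    qed
    then have "(\<Sum>S\<in>\<C> i - {S}. \<beta> S x * (v (S, i) - g i x)) = 0"
      by (rule sum.neutral[OF ballI])
    moreover have "finite (\<C> i)" using \<S>(1) by (simp add: \<C>_def)
    ultimately show ?thesis using that(1) by (simp add: sum.remove)
  qed
  have "lipschitz_fun \<rho> (g' i)" if "i < N" for i
    unfolding g'_def using that
    by (intro lipschitz_fun_add lipschitz_fun_sum lipschitz_fun_mult lipschitz_fun_diff
        lipschitz_fun_const g(1)) (use \<S>(2) in \<open>auto simp: \<C>_def\<close>)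
  moreover have "\<bar>g' i x - f i x\<bar> < \<epsilon>" if i: "i < N" and x: "x \<in> M" for i x
  proof -
    have "\<bar>g' i x - g i x\<bar> < 2 * \<eta>"
    proof (cases "\<exists>S\<in>\<C> i. 0 < \<beta> S x")
      case True
      then obtain S where S: "S \<in> \<C> i" "0 < \<beta> S x" by blast
      have "\<bar>g' i x - g i x\<bar> = \<beta> S x * \<bar>v (S, i) - g i x\<bar>"
        using single[OF S] \<beta>(1) by (simp add: g'_def abs_mult)
      also have "\<dots> \<le> 1 * \<bar>v (S, i) - g i x\<bar>"
        using \<beta>(1) by (intro mult_right_mono) auto
      finally show ?thesis using v(2)[OF _ i x S(2)] S(1) by (simp add: \<C>_def)
    next
      case False
      then have "(\<Sum>S\<in>\<C> i. \<beta> S x * (v (S, i) - g i x)) = 0"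
        using \<beta>(1) by (intro sum.neutral) (metis mult_zero_left order.antisym not_less)
      then show ?thesis using \<eta> by (simp add: g'_def)
    qed
    then have "\<bar>g' i x - f i x\<bar> < 3 * \<eta>" using g(2)[OF i x] by linarith
    then show ?thesis by (simp add: \<eta>_def)
  qed
  moreover have "\<exists>i<N. g' i x \<noteq> 0" if x: "x \<in> M" for x
  proof -
    obtain S where S: "S \<in> \<S>" "\<beta> S x = 1" using bspec[OF \<beta>(4) x] by blast
    define i where "i = card S - 1"
    have "0 < card S" "card S \<le> N" using bspec[OF \<S>(2) S(1)] by (auto simp: card_gt_0_iff)
    then have i: "i < N" "S \<in> \<C> i" using S(1) by (auto simp: i_def \<C>_def)
    have "g' i x = v (S, i)"
      using single[OF i(2), of x] S(2) by (simp add: g'_def)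
    then show ?thesis using v(1)[OF S(1) i(1)] i(1) by auto
  qed
  ultimately show ?thesis by blast
qed

end

section \<open>Stable rank of the algebra of continuous functions\<close>

context compact_metric
begin

lemma cont_compose: "cont f \<Longrightarrow> continuous_on UNIV h \<Longrightarrow> cont (\<lambda>x. h (f x))"
  using continuous_map_compose[of "mtopology_of \<rho>" euclidean f euclidean h]
  by (simp add: o_def)

lemma cont_Re: "cont f \<Longrightarrow> cont (\<lambda>x. Re (f x))"
  by (rule cont_compose[of f Re]) (auto intro: continuous_intros)

lemma cont_Im: "cont f \<Longrightarrow> cont (\<lambda>x. Im (f x))"
  by (rule cont_compose[of f Im]) (auto intro: continuous_intros)

lemma cont_cnj: "cont f \<Longrightarrow> cont (\<lambda>x. cnj (f x))"
  by (rule cont_compose[of f cnj]) (auto intro: continuous_intros)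

lemma cont_of_real: "cont f \<Longrightarrow> cont (\<lambda>x. complex_of_real (f x))"
  by (rule cont_compose[of f complex_of_real]) (auto intro: continuous_intros)

lemma remove_complex_zeros:
  fixes f :: "nat \<Rightarrow> 'k \<Rightarrow> complex"
  assumes dim: "covering_dim_le (mtopology_of \<rho>) (2 * m - 1)" and m: "1 \<le> m"
    and f: "\<And>j. j < m \<Longrightarrow> cont (f j)" and \<epsilon>: "0 < \<epsilon>"
  shows "\<exists>g. (\<forall>j<m. lipschitz_fun \<rho> (g j)) \<and> (\<forall>j<m. \<forall>x\<in>M. cmod (g j x - f j x) < \<epsilon>) \<and>
      (\<forall>x\<in>M. \<exists>j<m. g j x \<noteq> 0)"
proof -
  \<comment> \<open>real parts first, then imaginary parts\<close>
  define F where "F i x = (if i < m then Re (f i x) else Im (f (i - m) x))" for i x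
  have F: "cont (F i)" if "i < 2 * m" for i
    unfolding F_def using that
    by (cases "i < m") (auto intro!: cont_Re cont_Im f)
  have N: "Suc (2 * m - 1) \<le> 2 * m" using m by simp
  have "\<exists>G. (\<forall>i<2 * m. lipschitz_fun \<rho> (G i)) \<and> (\<forall>i<2 * m. \<forall>x\<in>M. \<bar>G i x - F i x\<bar> < \<epsilon> / 2) \<and>
      (\<forall>x\<in>M. \<exists>i<2 * m. G i x \<noteq> 0)"
    by (rule remove_zeros[OF dim N]) (use F \<epsilon> in auto)
  then obtain G where G: "\<forall>i<2 * m. lipschitz_fun \<rho> (G i)" "\<forall>i<2 * m. \<forall>x\<in>M. \<bar>G i x - F i x\<bar> < \<epsilon> / 2"
    "\<forall>x\<in>M. \<exists>i<2 * m. G i x \<noteq> 0"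
    by blast
  define g where "g j x = complex_of_real (G j x) + \<i> * complex_of_real (G (j + m) x)" for j x
  have "lipschitz_fun \<rho> (g j)" if "j < m" for j
    unfolding g_def using that G(1)
    by (intro lipschitz_fun_add lipschitz_fun_mult lipschitz_fun_const
        lipschitz_fun_bounded_linear[OF bounded_linear_of_real]) auto
  moreover have "cmod (g j x - f j x) < \<epsilon>" if j: "j < m" and x: "x \<in> M" for j x
  proof -
    have "\<bar>G j x - F j x\<bar> < \<epsilon> / 2" "\<bar>G (j + m) x - F (j + m) x\<bar> < \<epsilon> / 2"
      using G(2) j x by auto
    moreover have "cmod (g j x - f j x) \<le> \<bar>Re (g j x - f j x)\<bar> + \<bar>Im (g j x - f j x)\<bar>"
      by (rule cmod_le)
    ultimately show ?thesis using j by (simp add: g_def F_def)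
  qed
  moreover have "\<exists>j<m. g j x \<noteq> 0" if x: "x \<in> M" for x
  proof -
    obtain i where i: "i < 2 * m" "G i x \<noteq> 0" using G(3) x by blast
    show ?thesis
    proof (cases "i < m")
      case True
      then show ?thesis using i by (intro exI[of _ i]) (auto simp: g_def complex_eq_iff)
    next
      case False
      then show ?thesis using i by (intro exI[of _ "i - m"]) (auto simp: g_def complex_eq_iff)
    qed
  qed
  ultimately show ?thesis by blast
qed

lemma covering_dim_le_if_complex_zeros_removable:
  assumes approx: "\<And>f \<epsilon>. \<lbrakk>\<forall>j<m. cont (f j); 0 < \<epsilon>\<rbrakk> \<Longrightarrow>
      \<exists>g :: nat \<Rightarrow> 'k \<Rightarrow> complex. (\<forall>j<m. cont (g j)) \<and> (\<forall>j<m. \<forall>x\<in>M. cmod (g j x - f j x) < \<epsilon>) \<and>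
        (\<forall>x\<in>M. \<exists>j<m. g j x \<noteq> 0)"
  shows "covering_dim_le (mtopology_of \<rho>) (2 * m - 1)"
proof (rule covering_dim_le_if_zeros_removable[of "2 * m"], unfold zeros_removable_def, intro allI impI)
  fix h :: "nat \<Rightarrow> 'k \<Rightarrow> real" and \<epsilon> :: real
  assume h: "\<forall>j<2 * m. cont (h j)" and \<epsilon>: "0 < \<epsilon>"
  define f where "f j x = complex_of_real (h j x) + \<i> * complex_of_real (h (j + m) x)" for j x
  have "cont (f j)" if "j < m" for j
  proof -
    have "cont (\<lambda>x. complex_of_real (h j x))"
      using h that by (intro cont_of_real) auto
    moreover have "cont (\<lambda>x. \<i> * complex_of_real (h (j + m) x))"
      using h that by (intro continuous_map_complex_mult cont_of_real) auto
    ultimately show ?thesis unfolding f_def by (rule continuous_map_add)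
  qed
  then obtain g :: "nat \<Rightarrow> 'k \<Rightarrow> complex" where g: "\<forall>j<m. cont (g j)"
    "\<forall>j<m. \<forall>x\<in>M. cmod (g j x - f j x) < \<epsilon>" "\<forall>x\<in>M. \<exists>j<m. g j x \<noteq> 0"
    using approx[of f \<epsilon>] \<epsilon> by blast
  define h' where "h' i x = (if i < m then Re (g i x) else Im (g (i - m) x))" for i x
  have "cont (h' i)" if "i < 2 * m" for i
    unfolding h'_def using that g(1)
    by (cases "i < m") (auto intro!: cont_Re cont_Im)
  moreover have "\<bar>h' i x - h i x\<bar> < \<epsilon>" if i: "i < 2 * m" and x: "x \<in> M" for i x
  proof (cases "i < m")
    case True
    then have "cmod (g i x - f i x) < \<epsilon>" using g(2) x by blast
    then show ?thesis using abs_Re_le_cmod[of "g i x - f i x"] True by (simp add: h'_def f_def)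
  next
    case False
    then have "i - m < m" using i by simp
    then have "cmod (g (i - m) x - f (i - m) x) < \<epsilon>" using g(2) x by blast
    then show ?thesis using abs_Im_le_cmod[of "g (i - m) x - f (i - m) x"] False by (simp add: h'_def f_def)
  qed
  moreover have "\<exists>i<2 * m. h' i x \<noteq> 0" if x: "x \<in> M" for x
  proof -
    obtain j where j: "j < m" "g j x \<noteq> 0" using g(3) x by blast
    then consider "Re (g j x) \<noteq> 0" | "Im (g j x) \<noteq> 0" by (auto simp: complex_eq_iff)
    then show ?thesis
    proof cases
      case 1
      then show ?thesis using j by (intro exI[of _ j]) (auto simp: h'_def)
    next
      case 2
      then show ?thesis using j by (intro exI[of _ "j + m"]) (auto simp: h'_def)
    qed
  qed
  ultimately show "\<exists>h'. (\<forall>j<2 * m. cont (h' j)) \<and>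
      (\<forall>j<2 * m. \<forall>x\<in>M. \<bar>h' j x - h j x\<bar> < \<epsilon>) \<and> (\<forall>x\<in>M. \<exists>j<2 * m. h' j x \<noteq> 0)"
    by blast
qed simp

abbreviation CK where "CK \<equiv> cont_algebra (mtopology_of \<rho>)"

lemma CK_simps:
  "carrier CK = {f \<in> extensional M. cont f}"
  "f \<otimes>\<^bsub>CK\<^esub> g = (\<lambda>x\<in>M. f x * g x)" "\<one>\<^bsub>CK\<^esub> = (\<lambda>x\<in>M. 1)" "\<zero>\<^bsub>CK\<^esub> = (\<lambda>x\<in>M. 0)"
  "f \<oplus>\<^bsub>CK\<^esub> g = (\<lambda>x\<in>M. f x + g x)" "nrm CK f = (SUP x\<in>M. cmod (f x))"
  by (simp_all add: cont_algebra_def)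

lemma CK_closed: "f \<in> carrier CK \<Longrightarrow> g \<in> carrier CK \<Longrightarrow> f \<oplus>\<^bsub>CK\<^esub> g \<in> carrier CK"
  "f \<in> carrier CK \<Longrightarrow> g \<in> carrier CK \<Longrightarrow> f \<otimes>\<^bsub>CK\<^esub> g \<in> carrier CK" "\<one>\<^bsub>CK\<^esub> \<in> carrier CK"
  using ring.ring_simprules(1,5,6)[OF ring_cont_algebra] by blast+

lemma restrict_mem_CK: "cont f \<Longrightarrow> restrict f M \<in> carrier CK"
  using continuous_map_restrict_topspace[of "mtopology_of \<rho>" euclidean f] by (simp add: CK_simps)

lemma finsum_CK:
  assumes "finite I" "\<And>i. i \<in> I \<Longrightarrow> f i \<in> carrier CK"
  shows "(\<Oplus>\<^bsub>CK\<^esub>i\<in>I. f i) = (\<lambda>x\<in>M. \<Sum>i\<in>I. f i x)"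
proof -
  interpret ring CK by (rule ring_cont_algebra)
  show ?thesis
    using assms by (induction I rule: finite_induct) (auto simp: CK_simps(4,5) Pi_iff)
qed

lemma minus_CK:
  assumes "f \<in> carrier CK" "g \<in> carrier CK"
  shows "f \<ominus>\<^bsub>CK\<^esub> g = (\<lambda>x\<in>M. f x - g x)"
proof -
  interpret ring CK by (rule ring_cont_algebra)
  have neg: "(\<lambda>x\<in>M. - g x) \<in> carrier CK"
    using assms by (intro restrict_mem_CK) (auto simp: CK_simps intro: continuous_map_minus)
  have "\<ominus>\<^bsub>CK\<^esub> g = (\<lambda>x\<in>M. - g x)"
    using assms neg by (intro minus_equality) (auto simp: CK_simps)
  then show ?thesis
    by (auto simp: a_minus_def CK_simps)
qed

lemma nrm_CK_le:
  assumes "0 < \<epsilon>" "\<And>x. x \<in> M \<Longrightarrow> cmod (f x) \<le> \<epsilon>"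
  shows "nrm CK f \<le> \<epsilon>"
  unfolding CK_simps using assms nonempty by (intro cSUP_least) auto

lemma cmod_le_nrm_CK:
  assumes "cont f" "x \<in> M"
  shows "cmod (f x) \<le> nrm CK f"
proof -
  have "\<exists>B. \<forall>x\<in>M. cmod (f x) \<le> B"
    by (rule cont_bounded[OF assms(1)]) blast
  then have "bdd_above ((\<lambda>x. cmod (f x)) ` M)"
    by (auto intro: bdd_aboveI2)
  then show ?thesis
    unfolding CK_simps using assms(2) by (intro cSUP_upper)
qed

text \<open>Without common zero, \<open>cnj a\<^sub>i / \<Sum>|a\<^sub>j|\<^sup>2\<close> are the coefficients that combine the \<open>a\<^sub>i\<close> to \<open>1\<close>.\<close>

lemma Lg_CK:
  assumes a: "a \<in> {..<m} \<rightarrow>\<^sub>E carrier CK"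
  shows "a \<in> Lg CK m \<longleftrightarrow> (\<forall>x\<in>M. \<exists>j<m. a j x \<noteq> 0)"
proof
  have ac: "\<And>j. j < m \<Longrightarrow> a j \<in> carrier CK" using a by auto
  assume "a \<in> Lg CK m"
  then have "\<one>\<^bsub>CK\<^esub> \<in> {\<Oplus>\<^bsub>CK\<^esub>i\<in>{..<m}. b i \<otimes>\<^bsub>CK\<^esub> a i | b. b \<in> {..<m} \<rightarrow> carrier CK}"
    unfolding Lg_def using CK_closed(3) by simp
  then obtain b where b: "b \<in> {..<m} \<rightarrow> carrier CK" "\<one>\<^bsub>CK\<^esub> = (\<Oplus>\<^bsub>CK\<^esub>i\<in>{..<m}. b i \<otimes>\<^bsub>CK\<^esub> a i)"
    by blast
  have one_eq: "\<one>\<^bsub>CK\<^esub> = (\<lambda>x\<in>M. \<Sum>i<m. (b i \<otimes>\<^bsub>CK\<^esub> a i) x)"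
    unfolding b(2) using b(1) ac by (intro finsum_CK CK_closed(2)) auto
  have sum1: "(\<Sum>i<m. b i x * a i x) = 1" if "x \<in> M" for x
    using fun_cong[OF one_eq, of x] that by (simp add: CK_simps(2,3))
  show "\<forall>x\<in>M. \<exists>j<m. a j x \<noteq> 0"
  proof (intro ballI, rule ccontr)
    fix x assume "x \<in> M" "\<not> (\<exists>j<m. a j x \<noteq> 0)"
    then show False using sum1[of x] by simp
  qed
next
  assume nz: "\<forall>x\<in>M. \<exists>j<m. a j x \<noteq> 0"
  have ac: "\<And>j. j < m \<Longrightarrow> a j \<in> carrier CK" using a by auto
  define w where "w x = (\<Sum>j<m. (cmod (a j x))\<^sup>2)" for x
  have w: "0 < w x" if "x \<in> M" for x
  proof -
    obtain j where "j < m" "a j x \<noteq> 0" using bspec[OF nz \<open>x \<in> M\<close>] by blast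
    then show ?thesis unfolding w_def by (intro sum_pos2[of _ j]) auto
  qed
  have cont_w: "cont w"
    unfolding w_def using ac by (intro continuous_map_sum continuous_map_real_pow continuous_map_norm) (auto simp: CK_simps)
  have cont_iw: "cont (\<lambda>x. complex_of_real (inverse (w x)))"
  proof (rule cont_of_real, rule continuous_map_real_inverse[OF cont_w])
    fix x assume "x \<in> topspace (mtopology_of \<rho>)"
    then have "0 < w x" by (intro w) simp
    then show "w x \<noteq> 0" by simp
  qed
  have "{\<Oplus>\<^bsub>CK\<^esub>i\<in>{..<m}. b i \<otimes>\<^bsub>CK\<^esub> a i | b. b \<in> {..<m} \<rightarrow> carrier CK} = carrier CK" (is "?I = _")
  proof
    show "?I \<subseteq> carrier CK"
    proof
      interpret ring CK by (rule ring_cont_algebra)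
      fix z assume "z \<in> ?I"
      then show "z \<in> carrier CK" using ac by (auto intro!: finsum_closed)
    qed
    show "carrier CK \<subseteq> ?I"
    proof
      fix f assume f: "f \<in> carrier CK"
      define b where "b i = (\<lambda>x\<in>M. f x * (cnj (a i x) * complex_of_real (inverse (w x))))" for i
      have b: "b i \<in> carrier CK" if "i < m" for i
        unfolding b_def using f ac[OF that] cont_iw
        by (intro restrict_mem_CK continuous_map_complex_mult cont_cnj)
          (auto simp: CK_simps)
      have "(\<Oplus>\<^bsub>CK\<^esub>i\<in>{..<m}. b i \<otimes>\<^bsub>CK\<^esub> a i) = (\<lambda>x\<in>M. \<Sum>i<m. (b i \<otimes>\<^bsub>CK\<^esub> a i) x)"
        using b ac by (intro finsum_CK CK_closed(2)) auto
      also have "\<dots> = f"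
      proof
        fix x
        show "(\<lambda>x\<in>M. \<Sum>i<m. (b i \<otimes>\<^bsub>CK\<^esub> a i) x) x = f x"
        proof (cases "x \<in> M")
          case True
          have "(\<Sum>i<m. (b i \<otimes>\<^bsub>CK\<^esub> a i) x) =
              (\<Sum>i<m. f x * complex_of_real (inverse (w x)) * complex_of_real ((cmod (a i x))\<^sup>2))"
          proof (rule sum.cong)
            fix i
            have "complex_of_real ((cmod (a i x))\<^sup>2) = a i x * cnj (a i x)"
              by (rule complex_norm_square)
            then show "(b i \<otimes>\<^bsub>CK\<^esub> a i) x =
                f x * complex_of_real (inverse (w x)) * complex_of_real ((cmod (a i x))\<^sup>2)"
              using True by (simp only: CK_simps(2) b_def restrict_apply' mult_ac)
          qed simp
          also have "\<dots> = f x * complex_of_real (inverse (w x)) * complex_of_real (w x)"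
            by (simp add: w_def sum_distrib_left)
          also have "\<dots> = f x" using w[OF True] by simp
          finally show ?thesis using True by simp
        qed (use f in \<open>auto simp: CK_simps extensional_def\<close>)
      qed
      finally show "f \<in> ?I" using b by blast
    qed
  qed
  then show "a \<in> Lg CK m" using a by (simp add: Lg_def)
qed

theorem dense_Lg_CK_iff:
  assumes m: "1 \<le> m"
  shows "dense_tuples CK m (Lg CK m) \<longleftrightarrow> covering_dim_le (mtopology_of \<rho>) (2 * m - 1)"
proof
  assume dense: "dense_tuples CK m (Lg CK m)"
  show "covering_dim_le (mtopology_of \<rho>) (2 * m - 1)"
  proof (rule covering_dim_le_if_complex_zeros_removable)
    fix f :: "nat \<Rightarrow> 'k \<Rightarrow> complex" and \<epsilon> :: real
    assume f: "\<forall>j<m. cont (f j)" and \<epsilon>: "0 < \<epsilon>"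
    define a where "a = (\<lambda>j\<in>{..<m}. restrict (f j) M)"
    have a: "a \<in> {..<m} \<rightarrow>\<^sub>E carrier CK"
      using f by (auto simp: a_def intro!: restrict_mem_CK)
    then obtain b where b: "b \<in> Lg CK m" "\<forall>i<m. nrm CK (b i \<ominus>\<^bsub>CK\<^esub> a i) < \<epsilon>"
      using dense \<epsilon> unfolding dense_tuples_def by blast
    have bE: "b \<in> {..<m} \<rightarrow>\<^sub>E carrier CK" using b(1) by (simp add: Lg_def)
    then have cont_b: "cont (b j)" if "j < m" for j using that by (auto simp: CK_simps)
    have "cmod (b j x - f j x) < \<epsilon>" if j: "j < m" and x: "x \<in> M" for j x
    proof -
      have eq: "b j \<ominus>\<^bsub>CK\<^esub> a j = (\<lambda>x\<in>M. b j x - a j x)"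
        using a bE j by (intro minus_CK) auto
      have "cont (\<lambda>x. b j x - f j x)" using cont_b[OF j] f j by (intro continuous_map_diff) auto
      moreover have "nrm CK (b j \<ominus>\<^bsub>CK\<^esub> a j) = nrm CK (\<lambda>x. b j x - f j x)"
        unfolding CK_simps eq using j by (intro SUP_cong) (auto simp: a_def)
      ultimately show ?thesis using cmod_le_nrm_CK[of "\<lambda>x. b j x - f j x" x] x b(2) j by force
    qed
    then show "\<exists>g :: nat \<Rightarrow> 'k \<Rightarrow> complex. (\<forall>j<m. cont (g j)) \<and>
        (\<forall>j<m. \<forall>x\<in>M. cmod (g j x - f j x) < \<epsilon>) \<and> (\<forall>x\<in>M. \<exists>j<m. g j x \<noteq> 0)"
      using cont_b b(1) Lg_CK[OF bE] by (intro exI[of _ b]) auto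
  qed
next
  assume dim: "covering_dim_le (mtopology_of \<rho>) (2 * m - 1)"
  show "dense_tuples CK m (Lg CK m)"
    unfolding dense_tuples_def
  proof (intro ballI allI impI)
    fix a and \<epsilon> :: real assume a: "a \<in> {..<m} \<rightarrow>\<^sub>E carrier CK" and \<epsilon>: "0 < \<epsilon>"
    have "\<And>j. j < m \<Longrightarrow> cont (a j)" using a by (auto simp: CK_simps)
    then have "\<exists>g. (\<forall>j<m. lipschitz_fun \<rho> (g j)) \<and> (\<forall>j<m. \<forall>x\<in>M. cmod (g j x - a j x) < \<epsilon> / 2) \<and>
        (\<forall>x\<in>M. \<exists>j<m. g j x \<noteq> 0)"
      using \<epsilon> by (intro remove_complex_zeros[OF dim m]) auto
    then obtain g where g: "\<forall>j<m. lipschitz_fun \<rho> (g j)" "\<forall>j<m. \<forall>x\<in>M. cmod (g j x - a j x) < \<epsilon> / 2"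
      "\<forall>x\<in>M. \<exists>j<m. g j x \<noteq> 0" by blast
    define b where "b = (\<lambda>j\<in>{..<m}. restrict (g j) M)"
    have b: "b \<in> {..<m} \<rightarrow>\<^sub>E carrier CK"
      using g(1) by (auto simp: b_def intro!: restrict_mem_CK lipschitz_fun_continuous)
    have "b \<in> Lg CK m" unfolding Lg_CK[OF b] using g(3) by (auto simp: b_def)
    moreover have "nrm CK (b j \<ominus>\<^bsub>CK\<^esub> a j) < \<epsilon>" if j: "j < m" for j
    proof -
      have eq: "b j \<ominus>\<^bsub>CK\<^esub> a j = (\<lambda>x\<in>M. b j x - a j x)"
        using a b j by (intro minus_CK) auto
      have "nrm CK (b j \<ominus>\<^bsub>CK\<^esub> a j) \<le> \<epsilon> / 2"
        unfolding eq
      proof (rule nrm_CK_le)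
        fix x assume x: "x \<in> M"
        have "cmod (g j x - a j x) < \<epsilon> / 2" using g(2) j x by blast
        then show "cmod ((\<lambda>x\<in>M. b j x - a j x) x) \<le> \<epsilon> / 2"
          using x j by (simp add: b_def)
      qed (use \<epsilon> in simp)
      then show ?thesis using \<epsilon> by simp
    qed
    ultimately show "\<exists>b\<in>Lg CK m. \<forall>i<m. nrm CK (b i \<ominus>\<^bsub>CK\<^esub> a i) < \<epsilon>" by blast
  qed
qed

end

section \<open>Lifting unimodular tuples from the Calkin algebra\<close>

lemma compact_ops_mem: "C \<in> compact_ops TYPE('a::complex_normed_vector) \<Longrightarrow> C \<in> clops TYPE('a)"
  by (simp add: compact_ops_def)

lemma compact_ops_closed:
  fixes C T :: "'a::complex_banach \<Rightarrow>\<^sub>L 'a"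
  assumes C: "C \<in> compact_ops TYPE('a)"
  shows "C' \<in> compact_ops TYPE('a) \<Longrightarrow> C + C' \<in> compact_ops TYPE('a)"
    and "- C \<in> compact_ops TYPE('a)"
    and "T \<in> clops TYPE('a) \<Longrightarrow> T o\<^sub>L C \<in> compact_ops TYPE('a)"
    and "T \<in> clops TYPE('a) \<Longrightarrow> C o\<^sub>L T \<in> compact_ops TYPE('a)"
proof -
  interpret ideal "compact_ops TYPE('a)" "bounded_ops TYPE('a)" by (rule ideal_compact_ops)
  show "C + C' \<in> compact_ops TYPE('a)" if "C' \<in> compact_ops TYPE('a)"
    using additive_subgroup.a_closed[OF additive_subgroup_axioms C that] by (simp add: bounded_ops_simps)
  show l: "T o\<^sub>L C \<in> compact_ops TYPE('a)" if "T \<in> clops TYPE('a)" for T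
    using I_l_closed[OF C that] by (simp add: bounded_ops_simps)
  show "C o\<^sub>L T \<in> compact_ops TYPE('a)" if "T \<in> clops TYPE('a)"
    using I_r_closed[OF C that] by (simp add: bounded_ops_simps)
  have "(- id_blinfun) o\<^sub>L C = - C"
    by (rule blinfun_eqI) (simp add: blinfun.minus_left)
  then show "- C \<in> compact_ops TYPE('a)"
    using l[OF ops.minus_mem[OF ops.unit_mem]] by simp
qed

lemma zero_mem_compact_ops: "0 \<in> compact_ops TYPE('a::complex_normed_vector)"
  using additive_subgroup.zero_closed[OF ideal.axioms(1)[OF ideal_compact_ops[of "TYPE('a)"]]]
  by (simp add: bounded_ops_simps)

lemma compact_ops_sum:
  fixes m :: nat
  assumes "\<And>i. i < m \<Longrightarrow> C i \<in> compact_ops TYPE('a::complex_banach)"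
  shows "(\<Sum>i<m. C i) \<in> compact_ops TYPE('a)"
  using assms by (induction m) (auto intro: compact_ops_closed zero_mem_compact_ops)

lemma calkin_map_eq: "calkin_map T = {C + T | C. C \<in> compact_ops TYPE('a)}"
  for T :: "'a::complex_normed_vector \<Rightarrow>\<^sub>L 'a"
  by (auto simp: calkin_map_def a_r_coset_def' bounded_ops_simps)

lemma calkin_simps:
  "carrier (calkin TYPE('a::complex_normed_vector)) = calkin_map ` clops TYPE('a)"
  "nrm (calkin TYPE('a)) = (\<lambda>Q. Inf (norm ` Q))"
  by (auto simp: calkin_def ring.defs FactRing_def A_RCOSETS_def' calkin_map_def)

lemma calkin_map_hom: "calkin_map \<in> ring_hom (bounded_ops TYPE('a::complex_normed_vector)) (calkin TYPE('a))"
proof -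
  have "(+>\<^bsub>bounded_ops TYPE('a)\<^esub>) (compact_ops TYPE('a)) \<in>
      ring_hom (bounded_ops TYPE('a)) (bounded_ops TYPE('a) Quot compact_ops TYPE('a))"
    by (rule ideal.rcos_ring_hom[OF ideal_compact_ops])
  then show ?thesis
    by (auto simp: ring_hom_def calkin_def ring.defs calkin_map_def Pi_iff)
qed

locale compact_motakis = motakis_realisation K \<rho> \<Gamma> e d \<kappa> \<Psi> + compact_metric \<rho>
  for K :: "'k topology" and \<rho> :: "'k metric" and \<Gamma> :: "'g set" and e :: "nat \<Rightarrow> 'g"
    and d :: "'g \<Rightarrow> 'a::complex_banach" and \<kappa> :: "'g \<Rightarrow> 'k"
    and \<Psi> :: "('k \<Rightarrow> complex) \<Rightarrow> ('a \<Rightarrow>\<^sub>L 'a) set"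
begin

abbreviation Ops :: "('a \<Rightarrow>\<^sub>L 'a) set"
  where "Ops \<equiv> clops TYPE('a)"

sublocale schauder_space "d \<circ> e"
  by unfold_locales (rule basis)

lemma Psi_hom: "\<Psi> \<in> ring_hom CK (calkin TYPE('a))"
  and Psi_bij: "bij_betw \<Psi> (carrier CK) (carrier (calkin TYPE('a)))"
  using Psi_iso metric by (auto simp: banach_algebra_iso_def algebra_hom_def)

text \<open>The homomorphism from the bounded operators to the continuous functions whose kernel is the compact
operators.\<close>

definition symbol :: "('a \<Rightarrow>\<^sub>L 'a) \<Rightarrow> 'k \<Rightarrow> complex"
  where "symbol T = the_inv_into (carrier CK) \<Psi> (calkin_map T)"

lemma symbol: "T \<in> Ops \<Longrightarrow> symbol T \<in> carrier CK \<and> \<Psi> (symbol T) = calkin_map T"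
proof -
  assume "T \<in> Ops"
  then have T: "calkin_map T \<in> carrier (calkin TYPE('a))" by (simp add: calkin_simps)
  show ?thesis
    using bij_betw_the_inv_into[OF Psi_bij] f_the_inv_into_f_bij_betw[OF Psi_bij] T
    unfolding symbol_def by (auto simp: bij_betw_def)
qed

lemma symbol_unique:
  assumes "f \<in> carrier CK" "\<Psi> f = calkin_map T"
  shows "symbol T = f"
  unfolding symbol_def assms(2)[symmetric]
  using Psi_bij assms(1) by (intro the_inv_into_f_f) (auto simp: bij_betw_def)

lemma cont_symbol: "T \<in> Ops \<Longrightarrow> cont (symbol T)"
  using symbol by (auto simp: CK_simps)

lemma symbol_add: "S \<in> Ops \<Longrightarrow> T \<in> Ops \<Longrightarrow> symbol (S + T) = symbol S \<oplus>\<^bsub>CK\<^esub> symbol T"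
  using symbol[of S] symbol[of T] ring_hom_add[OF Psi_hom, of "symbol S" "symbol T"]
    ring_hom_add[OF calkin_map_hom, of S T]
  by (intro symbol_unique CK_closed) (auto simp: bounded_ops_simps)

lemma symbol_mult: "S \<in> Ops \<Longrightarrow> T \<in> Ops \<Longrightarrow> symbol (S o\<^sub>L T) = symbol S \<otimes>\<^bsub>CK\<^esub> symbol T"
  using symbol[of S] symbol[of T] ring_hom_mult[OF Psi_hom, of "symbol S" "symbol T"]
    ring_hom_mult[OF calkin_map_hom, of S T]
  by (intro symbol_unique CK_closed) (auto simp: bounded_ops_simps)

lemma symbol_id: "symbol id_blinfun = \<one>\<^bsub>CK\<^esub>"
  using ring_hom_one[OF Psi_hom] ring_hom_one[OF calkin_map_hom]
  by (intro symbol_unique CK_closed) (auto simp: bounded_ops_simps)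

lemma symbol_diff_apply:
  assumes "S \<in> Ops" "T \<in> Ops" "x \<in> M"
  shows "symbol (S - T) x = symbol S x - symbol T x"
proof -
  have "symbol ((S - T) + T) x = symbol (S - T) x + symbol T x"
    using assms by (subst symbol_add) (auto simp: CK_simps ops.diff_mem)
  then show ?thesis by simp
qed

lemma symbol_sum_apply:
  fixes n :: nat
  assumes "\<And>i. i < n \<Longrightarrow> T i \<in> Ops" "x \<in> M"
  shows "symbol (\<Sum>i<n. T i) x = (\<Sum>i<n. symbol (T i) x)"
  using assms(1)
proof (induction n)
  case 0
  then show ?case using symbol_diff_apply[OF ops.unit_mem ops.unit_mem assms(2)] by simp
next
  case (Suc n)
  have "(\<Sum>i<n. T i) \<in> Ops" "T n \<in> Ops" using Suc.prems by (auto intro: ops.sum_mem)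
  then have "symbol (\<Sum>i<Suc n. T i) = symbol (\<Sum>i<n. T i) \<oplus>\<^bsub>CK\<^esub> symbol (T n)"
    by (simp add: symbol_add)
  then show ?case using Suc assms(2) by (simp add: CK_simps)
qed

lemma symbol_surj:
  assumes "f \<in> carrier CK"
  shows "\<exists>T\<in>Ops. symbol T = f"
proof -
  have "\<Psi> f \<in> calkin_map ` Ops"
    using Psi_bij assms by (auto simp: bij_betw_def calkin_simps(1)[symmetric])
  then show ?thesis using symbol_unique[OF assms] by blast
qed

lemma symbol_bounded:
  obtains B where "0 < B" "\<forall>T\<in>Ops. \<forall>x\<in>M. cmod (symbol T x) \<le> B * norm T"
proof -
  obtain B where B: "\<And>f. f \<in> carrier CK \<Longrightarrow> nrm CK f \<le> B * nrm (calkin TYPE('a)) (\<Psi> f)"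
    using Psi_iso metric by (auto simp: banach_algebra_iso_def)
  have "cmod (symbol T x) \<le> (\<bar>B\<bar> + 1) * norm T" if T: "T \<in> Ops" and x: "x \<in> M" for T x
  proof -
    have "0 + T \<in> calkin_map T" unfolding calkin_map_eq using zero_mem_compact_ops by blast
    then have "T \<in> calkin_map T" by simp
    then have le: "Inf (norm ` calkin_map T) \<le> norm T"
      by (intro cInf_lower) (auto intro: bdd_belowI[where m = 0])
    have nonneg: "0 \<le> Inf (norm ` calkin_map T)"
      using \<open>T \<in> calkin_map T\<close> by (intro cInf_greatest) auto
    have "cmod (symbol T x) \<le> nrm CK (symbol T)"
      by (rule cmod_le_nrm_CK[OF cont_symbol[OF T] x])
    also have "\<dots> \<le> B * Inf (norm ` calkin_map T)"
      using B[of "symbol T"] symbol[OF T] by (simp add: calkin_simps)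
    also have "\<dots> \<le> (\<bar>B\<bar> + 1) * Inf (norm ` calkin_map T)"
      using nonneg by (intro mult_right_mono) auto
    also have "\<dots> \<le> (\<bar>B\<bar> + 1) * norm T"
      using le by (intro mult_left_mono) auto
    finally show ?thesis .
  qed
  then show thesis using that[of "\<bar>B\<bar> + 1"] by simp
qed

text \<open>Boundedness of the isomorphism \<open>\<Psi>\<close> and the definition of the quotient norm.\<close>

lemma small_symbol_small_mod_compact:
  obtains B where "0 < B" "\<forall>T\<in>Ops. \<forall>\<delta>>0. (\<forall>x\<in>M. cmod (symbol T x) \<le> \<delta>) \<longrightarrow>
      (\<exists>R\<in>Ops. norm R \<le> B * \<delta> \<and> T - R \<in> compact_ops TYPE('a))"
proof -
  obtain B where B: "\<And>f. f \<in> carrier CK \<Longrightarrow> nrm (calkin TYPE('a)) (\<Psi> f) \<le> B * nrm CK f"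
    using Psi_iso metric by (auto simp: banach_algebra_iso_def)
  have "\<exists>R\<in>Ops. norm R \<le> (\<bar>B\<bar> + 1) * \<delta> \<and> T - R \<in> compact_ops TYPE('a)"
    if T: "T \<in> Ops" and \<delta>: "0 < \<delta>" and small: "\<forall>x\<in>M. cmod (symbol T x) \<le> \<delta>" for T \<delta>
  proof -
    have "nrm CK (symbol T) \<le> \<delta>" using \<delta> small by (intro nrm_CK_le) auto
    moreover have "0 \<le> nrm CK (symbol T)"
    proof -
      obtain x where "x \<in> M" using nonempty by blast
      then show ?thesis using cmod_le_nrm_CK[OF cont_symbol[OF T]] norm_ge_zero order_trans by blast
    qed
    ultimately have "B * nrm CK (symbol T) \<le> \<bar>B\<bar> * \<delta>"
      by (intro mult_mono) auto
    then have "Inf (norm ` calkin_map T) < (\<bar>B\<bar> + 1) * \<delta>"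
      using B[of "symbol T"] symbol[OF T] \<delta> by (simp add: calkin_simps algebra_simps)
    moreover have "calkin_map T \<noteq> {}"
      unfolding calkin_map_eq using zero_mem_compact_ops by blast
    ultimately obtain R where R: "R \<in> calkin_map T" "norm R < (\<bar>B\<bar> + 1) * \<delta>"
      by (subst (asm) cInf_less_iff) (auto intro: bdd_belowI[where m = 0])
    then obtain C where C: "C \<in> compact_ops TYPE('a)" "R = C + T" by (auto simp: calkin_map_eq)
    then have "T - R = - C" by simp
    moreover have "R \<in> Ops" using C T compact_ops_mem ops.add_mem by blast
    ultimately show ?thesis using R(2) compact_ops_closed(2)[OF C(1)] by (intro bexI[of _ R]) auto
  qed
  then show thesis using that[of "\<bar>B\<bar> + 1"] by simp
qed

text \<open>Lift the functions to operators, perturb there, and take symbols again.\<close>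

lemma covering_dim_le_if_dense:
  assumes dense: "\<And>T \<epsilon>. \<lbrakk>\<forall>i<m. T i \<in> Ops; 0 < \<epsilon>\<rbrakk> \<Longrightarrow> \<exists>T'. (\<forall>i<m. T' i \<in> Ops) \<and>
      (\<forall>x\<in>M. \<exists>i<m. symbol (T' i) x \<noteq> 0) \<and> (\<forall>i<m. norm (T' i - T i) < \<epsilon>)"
  shows "covering_dim_le (mtopology_of \<rho>) (2 * m - 1)"
proof (rule covering_dim_le_if_complex_zeros_removable)
  fix f :: "nat \<Rightarrow> 'k \<Rightarrow> complex" and \<epsilon> :: real
  assume f: "\<forall>j<m. cont (f j)" and \<epsilon>: "0 < \<epsilon>"
  obtain B where B: "0 < B" "\<forall>T\<in>Ops. \<forall>x\<in>M. cmod (symbol T x) \<le> B * norm T"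
    by (rule symbol_bounded)
  have "\<forall>j. \<exists>T. j < m \<longrightarrow> T \<in> Ops \<and> symbol T = restrict (f j) M"
    using f symbol_surj[OF restrict_mem_CK] by blast
  from choice[OF this] obtain T where T: "\<forall>j<m. T j \<in> Ops" "\<forall>j<m. symbol (T j) = restrict (f j) M"
    by blast
  have "0 < \<epsilon> / B" using \<epsilon> B(1) by simp
  from dense[OF T(1) this] obtain T' where T': "\<forall>i<m. T' i \<in> Ops"
    "\<forall>x\<in>M. \<exists>i<m. symbol (T' i) x \<noteq> 0" "\<forall>i<m. norm (T' i - T i) < \<epsilon> / B" by blast
  have "cmod (symbol (T' j) x - f j x) < \<epsilon>" if j: "j < m" and x: "x \<in> M" for j x
  proof -
    have mem: "T' j \<in> Ops" "T j \<in> Ops" using j T T' by auto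
    have "symbol (T' j) x - f j x = symbol (T' j - T j) x"
      using symbol_diff_apply[OF mem x] T(2) j x by simp
    then have "cmod (symbol (T' j) x - f j x) \<le> B * norm (T' j - T j)"
      using B(2) ops.diff_mem[OF mem] x by simp
    also have "\<dots> < B * (\<epsilon> / B)"
      using T'(3) j B(1) by (intro mult_strict_left_mono) auto
    finally show ?thesis using B(1) by simp
  qed
  then show "\<exists>g :: nat \<Rightarrow> 'k \<Rightarrow> complex. (\<forall>j<m. cont (g j)) \<and>
      (\<forall>j<m. \<forall>x\<in>M. cmod (g j x - f j x) < \<epsilon>) \<and> (\<forall>x\<in>M. \<exists>j<m. g j x \<noteq> 0)"
    using T'(1,2) cont_symbol by (intro exI[of _ "\<lambda>j. symbol (T' j)"]) auto
qed

lemma unimodular_symbols: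
  fixes m :: nat
  assumes T: "\<forall>i<m. T i \<in> Ops" and S: "\<forall>i<m. S i \<in> Ops" and one: "id_blinfun = (\<Sum>i<m. S i o\<^sub>L T i)"
  shows "\<forall>x\<in>M. \<exists>i<m. symbol (T i) x \<noteq> 0 \<and> symbol (S i) x \<noteq> 0"
proof (rule ballI, rule ccontr)
  fix x assume x: "x \<in> M" "\<not> (\<exists>i<m. symbol (T i) x \<noteq> 0 \<and> symbol (S i) x \<noteq> 0)"
  have "1 = symbol id_blinfun x" using x by (simp add: symbol_id CK_simps)
  also have "\<dots> = (\<Sum>i<m. symbol (S i o\<^sub>L T i) x)"
    unfolding one using S T x by (intro symbol_sum_apply ops.mul_mem) auto
  also have "\<dots> = (\<Sum>i<m. symbol (S i) x * symbol (T i) x)"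
    using S T x(1) by (intro sum.cong) (auto simp: symbol_mult CK_simps)
  also have "\<dots> = 0" using x(2) by (intro sum.neutral) auto
  finally show False by simp
qed

lemma covering_dim_le_if_left_dense:
  assumes "left_dense TYPE('a) m"
  shows "covering_dim_le (mtopology_of \<rho>) (2 * m - 1)"
proof (rule covering_dim_le_if_dense)
  fix T and \<epsilon> :: real assume "\<forall>i<m. T i \<in> Ops" "0 < \<epsilon>"
  then obtain T' S where "\<forall>i<m. T' i \<in> Ops" "\<forall>i<m. S i \<in> Ops"
    "id_blinfun = (\<Sum>i<m. S i o\<^sub>L T' i)" "\<forall>i<m. norm (T' i - T i) < \<epsilon>"
    using assms[unfolded ops.left_invertibles_dense_column, rule_format, of T \<epsilon>] by blast
  then show "\<exists>T'. (\<forall>i<m. T' i \<in> Ops) \<and>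
      (\<forall>x\<in>M. \<exists>i<m. symbol (T' i) x \<noteq> 0) \<and> (\<forall>i<m. norm (T' i - T i) < \<epsilon>)"
    using unimodular_symbols[of m T' S] by (intro exI[of _ T']) blast
qed

lemma covering_dim_le_if_right_dense:
  assumes "right_dense TYPE('a) m"
  shows "covering_dim_le (mtopology_of \<rho>) (2 * m - 1)"
proof (rule covering_dim_le_if_dense)
  fix T and \<epsilon> :: real assume "\<forall>i<m. T i \<in> Ops" "0 < \<epsilon>"
  then obtain T' S where "\<forall>i<m. T' i \<in> Ops" "\<forall>i<m. S i \<in> Ops"
    "id_blinfun = (\<Sum>i<m. T' i o\<^sub>L S i)" "\<forall>i<m. norm (T' i - T i) < \<epsilon>"
    using assms[unfolded ops_op.left_invertibles_dense_column, rule_format, of T \<epsilon>] by blast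
  then show "\<exists>T'. (\<forall>i<m. T' i \<in> Ops) \<and>
      (\<forall>x\<in>M. \<exists>i<m. symbol (T' i) x \<noteq> 0) \<and> (\<forall>i<m. norm (T' i - T i) < \<epsilon>)"
    using unimodular_symbols[of m S T'] by (intro exI[of _ T']) blast
qed

text \<open>The lift of Lipschitz functions, extended to functions that are not restricted to the carrier.\<close>

lemma lipschitz_lift_pointwise:
  obtains hat where "\<forall>f. lipschitz_fun \<rho> f \<longrightarrow> hat f \<in> Ops \<and> (\<forall>x\<in>M. symbol (hat f) x = f x)"
    "\<forall>f g. lipschitz_fun \<rho> f \<longrightarrow> lipschitz_fun \<rho> g \<longrightarrow> hat (\<lambda>x. f x + g x) = hat f + hat g"
    "\<forall>f g. lipschitz_fun \<rho> f \<longrightarrow> lipschitz_fun \<rho> g \<longrightarrow> hat (\<lambda>x. f x * g x) = hat f o\<^sub>L hat g"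
    "\<forall>f. (\<forall>x\<in>M. f x = 1) \<longrightarrow> hat f = id_blinfun"
proof -
  obtain h where h: "h \<in> algebra_hom (lip_algebra \<rho>) (bounded_ops TYPE('a))"
    "\<forall>f\<in>carrier (lip_algebra \<rho>). calkin_map (h f) = \<Psi> f"
    using lipschitz_lift by blast
  then have hom: "h \<in> ring_hom (lip_algebra \<rho>) (bounded_ops TYPE('a))"
    by (simp add: algebra_hom_def)
  have mem: "restrict f M \<in> carrier (lip_algebra \<rho>)" if lf: "lipschitz_fun \<rho> f" for f :: "'k \<Rightarrow> complex"
  proof -
    have "lipschitz_fun \<rho> (restrict f M)"
    proof -
      obtain L where "L > 0" "\<forall>x\<in>M. \<forall>y\<in>M. dist (f x) (f y) \<le> L * mdist \<rho> x y"
        by (rule lipschitz_funE[OF lf])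
      then show ?thesis by (intro lipschitz_funI[where L = L]) simp
    qed
    then show ?thesis
      using restrict_mem_CK[OF lipschitz_fun_continuous[OF lf]] by (simp add: lip_algebra_def)
  qed
  define hat where "hat f = h (restrict f M)" for f
  show thesis
  proof (rule that[of hat]; intro allI impI)
    fix f g :: "'k \<Rightarrow> complex" assume f: "lipschitz_fun \<rho> f" and g: "lipschitz_fun \<rho> g"
    show "hat (\<lambda>x. f x + g x) = hat f + hat g"
      using ring_hom_add[OF hom mem[OF f] mem[OF g]]
      by (simp add: hat_def lip_algebra_def cont_algebra_def bounded_ops_simps restrict_def cong: if_cong)
    show "hat (\<lambda>x. f x * g x) = hat f o\<^sub>L hat g"
      using ring_hom_mult[OF hom mem[OF f] mem[OF g]]
      by (simp add: hat_def lip_algebra_def cont_algebra_def bounded_ops_simps restrict_def cong: if_cong)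
  next
    fix f :: "'k \<Rightarrow> complex" assume f: "lipschitz_fun \<rho> f"
    have "hat f \<in> Ops"
      using ring_hom_closed[OF hom mem[OF f]] by (simp add: hat_def)
    moreover have "symbol (hat f) = restrict f M"
      using h(2) mem[OF f] restrict_mem_CK[OF lipschitz_fun_continuous[OF f]]
      by (intro symbol_unique) (auto simp: hat_def)
    ultimately show "hat f \<in> Ops \<and> (\<forall>x\<in>M. symbol (hat f) x = f x)" by simp
  next
    fix f :: "'k \<Rightarrow> complex" assume "\<forall>x\<in>M. f x = 1"
    then have "restrict f M = \<one>\<^bsub>lip_algebra \<rho>\<^esub>"
      by (auto simp: lip_algebra_def cont_algebra_def)
    then show "hat f = id_blinfun"
      using ring_hom_one[OF hom] by (simp add: hat_def bounded_ops_simps)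
  qed
qed

text \<open>Approximate the symbols by a Lipschitz tuple \<open>g\<close> without common zero. With \<open>w = \<Sum> g\<^sub>j cnj g\<^sub>j\<close>
and \<open>h\<^sub>j = cnj g\<^sub>j / w\<close>, the lifts \<open>G\<close> and \<open>H\<close> satisfy the unimodularity relation exactly and commute.
The symbol of \<open>T\<^sub>j - G\<^sub>j\<close> is small, so this operator is compact up to a small error.\<close>

lemma lift_unimodular:
  assumes dim: "covering_dim_le (mtopology_of \<rho>) (2 * m - 1)" and m: "1 \<le> m"
    and T: "\<forall>i<m. T i \<in> Ops" and \<epsilon>: "0 < \<epsilon>"
  shows "\<exists>G H C. (\<forall>i<m. G i \<in> Ops \<and> H i \<in> Ops \<and> C i \<in> compact_ops TYPE('a) \<and>
        norm (G i + C i - T i) \<le> \<epsilon>) \<and>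
      (\<Sum>i<m. H i o\<^sub>L G i) = id_blinfun \<and> (\<Sum>i<m. G i o\<^sub>L H i) = id_blinfun"
proof -
  obtain B where B: "0 < B" "\<forall>T\<in>Ops. \<forall>\<delta>>0. (\<forall>x\<in>M. cmod (symbol T x) \<le> \<delta>) \<longrightarrow>
      (\<exists>R\<in>Ops. norm R \<le> B * \<delta> \<and> T - R \<in> compact_ops TYPE('a))"
    by (rule small_symbol_small_mod_compact)
  obtain hat where hats: "\<forall>f. lipschitz_fun \<rho> f \<longrightarrow> hat f \<in> Ops \<and> (\<forall>x\<in>M. symbol (hat f) x = f x)"
    "\<forall>f g. lipschitz_fun \<rho> f \<longrightarrow> lipschitz_fun \<rho> g \<longrightarrow> hat (\<lambda>x. f x + g x) = hat f + hat g"
    "\<forall>f g. lipschitz_fun \<rho> f \<longrightarrow> lipschitz_fun \<rho> g \<longrightarrow> hat (\<lambda>x. f x * g x) = hat f o\<^sub>L hat g"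
    "\<forall>f. (\<forall>x\<in>M. f x = 1) \<longrightarrow> hat f = id_blinfun"
    by (rule lipschitz_lift_pointwise)
  have hat: "hat f \<in> Ops" "x \<in> M \<Longrightarrow> symbol (hat f) x = f x" if "lipschitz_fun \<rho> f" for f x
    using hats(1)[rule_format, OF that] by auto
  note hat_add = hats(2)[rule_format] and hat_mult = hats(3)[rule_format]
    and hat_one = hats(4)[rule_format]
  have hat_zero: "hat (\<lambda>x. 0) = 0"
    using hat_add[OF lipschitz_fun_const lipschitz_fun_const, of 0 0] by simp
  have hat_sum: "hat (\<lambda>x. \<Sum>i<n. f i x) = (\<Sum>i<n. hat (f i))"
    if "\<And>i. i < n \<Longrightarrow> lipschitz_fun \<rho> (f i)" for n :: nat and f
    using that
  proof (induction n)
    case (Suc n)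
    have "hat (\<lambda>x. (\<Sum>i<n. f i x) + f n x) = hat (\<lambda>x. \<Sum>i<n. f i x) + hat (f n)"
      using Suc.prems by (intro hat_add lipschitz_fun_sum) auto
    then show ?case using Suc by simp
  qed (simp add: hat_zero)
  have "0 < \<epsilon> / B" using \<epsilon> B(1) by simp
  then have "\<exists>g. (\<forall>j<m. lipschitz_fun \<rho> (g j)) \<and> (\<forall>j<m. \<forall>x\<in>M. cmod (g j x - symbol (T j) x) < \<epsilon> / B) \<and>
      (\<forall>x\<in>M. \<exists>j<m. g j x \<noteq> 0)"
    using T cont_symbol by (intro remove_complex_zeros[OF dim m]) auto
  then obtain g where g: "\<And>j. j < m \<Longrightarrow> lipschitz_fun \<rho> (g j)"
    "\<And>j x. j < m \<Longrightarrow> x \<in> M \<Longrightarrow> cmod (g j x - symbol (T j) x) < \<epsilon> / B"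
    "\<forall>x\<in>M. \<exists>j<m. g j x \<noteq> 0" by blast
  define w where "w x = (\<Sum>j<m. g j x * cnj (g j x))" for x
  have w_nz: "w x \<noteq> 0" if x: "x \<in> M" for x
  proof -
    obtain j where j: "j < m" "g j x \<noteq> 0" using bspec[OF g(3) x] by blast
    have "w x = complex_of_real (\<Sum>j<m. (cmod (g j x))\<^sup>2)"
      by (simp add: w_def complex_norm_square del: of_real_power)
    moreover have "0 < (\<Sum>j<m. (cmod (g j x))\<^sup>2)"
      using j by (intro sum_pos2[of _ j]) auto
    ultimately show ?thesis by (metis less_irrefl of_real_eq_0_iff)
  qed
  have cnj_lip: "lipschitz_fun \<rho> (\<lambda>x. cnj (g j x))" if "j < m" for j
    by (rule lipschitz_fun_bounded_linear[OF bounded_linear_cnj g(1)[OF that]])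
  have "lipschitz_fun \<rho> w"
    unfolding w_def using g(1) cnj_lip by (intro lipschitz_fun_sum lipschitz_fun_mult) auto
  then have w_lip: "lipschitz_fun \<rho> (\<lambda>x. inverse (w x))"
    using w_nz by (rule lipschitz_fun_inverse)
  define h where "h j x = cnj (g j x) * inverse (w x)" for j x
  have h_lip: "lipschitz_fun \<rho> (h j)" if "j < m" for j
    unfolding h_def using w_lip cnj_lip[OF that] by (intro lipschitz_fun_mult)
  have gh: "(\<Sum>j<m. g j x * h j x) = 1" if x: "x \<in> M" for x
  proof -
    have "(\<Sum>j<m. g j x * h j x) = w x * inverse (w x)"
      unfolding w_def h_def sum_distrib_right by (simp add: mult.assoc)
    then show ?thesis using w_nz[OF x] by simp
  qed
  have GH: "(\<Sum>j<m. hat (g j) o\<^sub>L hat (h j)) = id_blinfun"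
  proof -
    have "(\<Sum>j<m. hat (g j) o\<^sub>L hat (h j)) = (\<Sum>j<m. hat (\<lambda>x. g j x * h j x))"
      using g(1) h_lip by (intro sum.cong) (auto simp: hat_mult)
    also have "\<dots> = hat (\<lambda>x. \<Sum>j<m. g j x * h j x)"
      using g(1) h_lip by (intro hat_sum[symmetric] lipschitz_fun_mult) auto
    also have "\<dots> = id_blinfun" using gh by (intro hat_one) auto
    finally show ?thesis .
  qed
  have HG: "(\<Sum>j<m. hat (h j) o\<^sub>L hat (g j)) = id_blinfun"
  proof -
    have "hat (h j) o\<^sub>L hat (g j) = hat (g j) o\<^sub>L hat (h j)" if "j < m" for j
      using hat_mult[OF g(1) h_lip, of j j] hat_mult[OF h_lip g(1), of j j] that
      by (simp add: mult.commute)
    then have "(\<Sum>j<m. hat (h j) o\<^sub>L hat (g j)) = (\<Sum>j<m. hat (g j) o\<^sub>L hat (h j))"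
      by (intro sum.cong) auto
    then show ?thesis using GH by simp
  qed
  have "\<exists>C. j < m \<longrightarrow> C \<in> compact_ops TYPE('a) \<and> norm (hat (g j) + C - T j) \<le> \<epsilon>" for j
  proof (cases "j < m")
    case True
    have mem: "T j - hat (g j) \<in> Ops" using T True hat(1)[OF g(1)] by (intro ops.diff_mem) auto
    have "\<forall>x\<in>M. cmod (symbol (T j - hat (g j)) x) \<le> \<epsilon> / B"
    proof
      fix x assume x: "x \<in> M"
      have "symbol (T j - hat (g j)) x = - (g j x - symbol (T j) x)"
        using T True hat[OF g(1)[OF True]] x by (simp add: symbol_diff_apply)
      then show "cmod (symbol (T j - hat (g j)) x) \<le> \<epsilon> / B"
        using g(2)[OF True x] by (simp only: norm_minus_cancel less_imp_le)
    qed
    then obtain R where R: "R \<in> Ops" "norm R \<le> B * (\<epsilon> / B)" "T j - hat (g j) - R \<in> compact_ops TYPE('a)"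
      using B(2) mem \<open>0 < \<epsilon> / B\<close> by blast
    have "hat (g j) + (T j - hat (g j) - R) - T j = - R" by simp
    then show ?thesis using R B(1) by (intro exI[of _ "T j - hat (g j) - R"]) (simp only: norm_minus_cancel, simp)
  qed simp
  then obtain C where "\<And>j. j < m \<Longrightarrow> C j \<in> compact_ops TYPE('a)"
    "\<And>j. j < m \<Longrightarrow> norm (hat (g j) + C j - T j) \<le> \<epsilon>" by metis
  then show ?thesis
    using HG GH hat(1) g(1) h_lip
    by (intro exI[of _ "\<lambda>j. hat (g j)"] exI[of _ "\<lambda>j. hat (h j)"] exI[of _ C]) auto
qed

text \<open>For the right-hand version, the same computation runs in the opposite ring with \<open>\<Sum> C\<^sub>i H\<^sub>i\<close> as the compact
operator.\<close>

theorem left_dense_if_covering_dim_le: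
  assumes dim: "covering_dim_le (mtopology_of \<rho>) (2 * m - 1)" and m: "1 \<le> m"
  shows "left_dense TYPE('a) m"
  unfolding ops.left_invertibles_dense_column
proof (intro allI impI)
  fix T and \<epsilon> :: real assume T: "\<forall>i<m. T i \<in> Ops" and \<epsilon>: "0 < \<epsilon>"
  obtain G H C where GHC: "\<And>i. i < m \<Longrightarrow> G i \<in> Ops" "\<And>i. i < m \<Longrightarrow> H i \<in> Ops"
      "\<And>i. i < m \<Longrightarrow> C i \<in> compact_ops TYPE('a)" "\<And>i. i < m \<Longrightarrow> norm (G i + C i - T i) \<le> \<epsilon> / 2"
    and unimodular: "(\<Sum>i<m. H i o\<^sub>L G i) = id_blinfun"
    using lift_unimodular[OF dim m T half_gt_zero[OF \<epsilon>]] by blast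
  have compact: "(\<Sum>i<m. H i o\<^sub>L C i) \<in> compact_ops TYPE('a)"
    using GHC by (intro compact_ops_sum compact_ops_closed(3))
  have "\<exists>E\<in>Ops. norm E < \<delta> \<and> (\<exists>Q\<in>Ops. Q o\<^sub>L (id_blinfun + (\<Sum>i<m. H i o\<^sub>L C i) + E) = id_blinfun)"
    if "0 < \<delta>" for \<delta>
    using compact_perturbation_of_id[OF compact that] unfolding invertible_op_def by blast
  from ops.perturb_to_left_invertible[OF GHC(1,2) compact_ops_mem[OF GHC(3)] unimodular this half_gt_zero[OF \<epsilon>]]
  obtain T' S where T': "\<forall>i<m. T' i \<in> Ops" "\<forall>i<m. S i \<in> Ops" "id_blinfun = (\<Sum>i<m. S i o\<^sub>L T' i)"
    "\<forall>i<m. norm (T' i - (G i + C i)) < \<epsilon> / 2" by blast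
  have "norm (T' i - T i) < \<epsilon>" if i: "i < m" for i
  proof -
    have "norm (T' i - T i) \<le> norm (T' i - (G i + C i)) + norm (G i + C i - T i)"
      using norm_triangle_ineq[of "T' i - (G i + C i)" "G i + C i - T i"] by simp
    moreover have "norm (T' i - (G i + C i)) < \<epsilon> / 2" using T'(4) i by blast
    ultimately show ?thesis using GHC(4)[OF i] by linarith
  qed
  then show "\<exists>T'. (\<forall>i<m. T' i \<in> Ops) \<and>
      (\<exists>S. (\<forall>i<m. S i \<in> Ops) \<and> id_blinfun = (\<Sum>i<m. S i o\<^sub>L T' i)) \<and> (\<forall>i<m. norm (T' i - T i) < \<epsilon>)"
    using T'(1-3) by blast
qed

theorem right_dense_if_covering_dim_le:
  assumes dim: "covering_dim_le (mtopology_of \<rho>) (2 * m - 1)" and m: "1 \<le> m"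
  shows "right_dense TYPE('a) m"
  unfolding ops_op.left_invertibles_dense_column
proof (intro allI impI)
  fix T and \<epsilon> :: real assume T: "\<forall>i<m. T i \<in> Ops" and \<epsilon>: "0 < \<epsilon>"
  obtain G H C where GHC: "\<And>i. i < m \<Longrightarrow> G i \<in> Ops" "\<And>i. i < m \<Longrightarrow> H i \<in> Ops"
      "\<And>i. i < m \<Longrightarrow> C i \<in> compact_ops TYPE('a)" "\<And>i. i < m \<Longrightarrow> norm (G i + C i - T i) \<le> \<epsilon> / 2"
    and unimodular: "(\<Sum>i<m. G i o\<^sub>L H i) = id_blinfun"
    using lift_unimodular[OF dim m T half_gt_zero[OF \<epsilon>]] by blast
  have compact: "(\<Sum>i<m. C i o\<^sub>L H i) \<in> compact_ops TYPE('a)"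
    using GHC by (intro compact_ops_sum compact_ops_closed(4))
  have "\<exists>E\<in>Ops. norm E < \<delta> \<and> (\<exists>Q\<in>Ops. (id_blinfun + (\<Sum>i<m. C i o\<^sub>L H i) + E) o\<^sub>L Q = id_blinfun)"
    if "0 < \<delta>" for \<delta>
    using compact_perturbation_of_id[OF compact that] unfolding invertible_op_def by blast
  from ops_op.perturb_to_left_invertible[OF GHC(1,2) compact_ops_mem[OF GHC(3)] unimodular this half_gt_zero[OF \<epsilon>]]
  obtain T' S where T': "\<forall>i<m. T' i \<in> Ops" "\<forall>i<m. S i \<in> Ops" "id_blinfun = (\<Sum>i<m. T' i o\<^sub>L S i)"
    "\<forall>i<m. norm (T' i - (G i + C i)) < \<epsilon> / 2" by blast
  have "norm (T' i - T i) < \<epsilon>" if i: "i < m" for i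
  proof -
    have "norm (T' i - T i) \<le> norm (T' i - (G i + C i)) + norm (G i + C i - T i)"
      using norm_triangle_ineq[of "T' i - (G i + C i)" "G i + C i - T i"] by simp
    moreover have "norm (T' i - (G i + C i)) < \<epsilon> / 2" using T'(4) i by blast
    ultimately show ?thesis using GHC(4)[OF i] by linarith
  qed
  then show "\<exists>T'. (\<forall>i<m. T' i \<in> Ops) \<and>
      (\<exists>S. (\<forall>i<m. S i \<in> Ops) \<and> id_blinfun = (\<Sum>i<m. T' i o\<^sub>L S i)) \<and> (\<forall>i<m. norm (T' i - T i) < \<epsilon>)"
    using T'(1-3) by blast
qed

end

section \<open>The rank formula\<close>

lemma Inf_enat_threshold:
  assumes "\<And>m. 1 \<le> m \<Longrightarrow> P m \<longleftrightarrow> m0 \<le> m" and "1 \<le> m0"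
  shows "Inf {enat m | m. 1 \<le> m \<and> P m} = enat m0"
proof (rule antisym)
  show "Inf {enat m | m. 1 \<le> m \<and> P m} \<le> enat m0"
    using assms by (intro Inf_lower) auto
  show "enat m0 \<le> Inf {enat m | m. 1 \<le> m \<and> P m}"
    using assms by (intro Inf_greatest) auto
qed

lemma covering_dim_le_mono: "covering_dim_le K D \<Longrightarrow> D \<le> D' \<Longrightarrow> covering_dim_le K D'"
  unfolding covering_dim_le_def
proof (intro allI impI)
  fix \<U>
  assume le: "D \<le> D'"
    and D: "\<forall>\<U>. finite \<U> \<and> (\<forall>U\<in>\<U>. openin K U) \<and> \<Union>\<U> = topspace K \<longrightarrow>
      (\<exists>\<V>. finite \<V> \<and> (\<forall>V\<in>\<V>. openin K V) \<and> \<Union>\<V> = topspace K \<and>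
        (\<forall>V\<in>\<V>. \<exists>U\<in>\<U>. V \<subseteq> U) \<and> (\<forall>x\<in>topspace K. card {V\<in>\<V>. x \<in> V} \<le> D + 1))"
    and \<U>: "finite \<U> \<and> (\<forall>U\<in>\<U>. openin K U) \<and> \<Union>\<U> = topspace K"
  from mp[OF spec[OF D] \<U>] obtain \<V> where \<V>: "finite \<V>" "\<forall>V\<in>\<V>. openin K V"
    "\<Union>\<V> = topspace K" "\<forall>V\<in>\<V>. \<exists>U\<in>\<U>. V \<subseteq> U"
    "\<forall>x\<in>topspace K. card {V\<in>\<V>. x \<in> V} \<le> D + 1"
    by (elim exE conjE)
  have "card {V\<in>\<V>. x \<in> V} \<le> D' + 1" if "x \<in> topspace K" for x
    using bspec[OF \<V>(5) that] le by linarith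
  then have "\<forall>x\<in>topspace K. card {V\<in>\<V>. x \<in> V} \<le> D' + 1" by simp
  with \<V>(1-4) show "\<exists>\<V>. finite \<V> \<and> (\<forall>V\<in>\<V>. openin K V) \<and> \<Union>\<V> = topspace K \<and>
        (\<forall>V\<in>\<V>. \<exists>U\<in>\<U>. V \<subseteq> U) \<and> (\<forall>x\<in>topspace K. card {V\<in>\<V>. x \<in> V} \<le> D' + 1)"
    by (intro exI[of _ \<V>] conjI)
qed

text \<open>The covering dimension is a threshold for \<open>covering_dim_le\<close>, by monotonicity.\<close>

lemma covering_dim_cases:
  obtains (infinite) "covering_dim K = \<infinity>" "\<And>d. \<not> covering_dim_le K d"
  | (finite) D where "covering_dim K = enat D" "\<And>d. covering_dim_le K d \<longleftrightarrow> D \<le> d"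
proof (cases "\<exists>d. covering_dim_le K d")
  case True
  define D where "D = (LEAST d. covering_dim_le K d)"
  have D: "covering_dim_le K D" "\<And>d. covering_dim_le K d \<Longrightarrow> D \<le> d"
    unfolding D_def using True by (auto intro: LeastI_ex Least_le)
  have "covering_dim K = enat D"
    unfolding covering_dim_def
    by (rule antisym) (auto intro!: Inf_lower Inf_greatest D)
  then show thesis using finite[of D] D covering_dim_le_mono[OF D(1)] by blast
next
  case False
  then have "{enat d | d. covering_dim_le K d} = {}" by auto
  then have "covering_dim K = \<infinity>"
    by (simp add: covering_dim_def top_enat_def)
  then show thesis using infinite False by blast
qed

text \<open>Both sides say \<open>D div 2 \<le> n * (m - 1)\<close>.\<close>

lemma threshold_arith:
  fixes D n m :: nat
  assumes "1 \<le> n" "1 \<le> m"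
  shows "D \<le> 2 * (n * (m - 1) + 1) - 1 \<longleftrightarrow> nat \<lceil>real_of_int \<lfloor>real D / 2\<rfloor> / real n\<rceil> + 1 \<le> m"
proof -
  have fl: "real_of_int \<lfloor>real D / 2\<rfloor> = real (D div 2)"
    using floor_divide_of_nat_eq[where ?'a = real, of D 2] by simp
  have "nat \<lceil>real (D div 2) / real n\<rceil> \<le> m - 1 \<longleftrightarrow> real (D div 2) / real n \<le> real (m - 1)"
    by (simp add: nat_le_iff ceiling_le_iff)
  also have "\<dots> \<longleftrightarrow> real (D div 2) \<le> real (n * (m - 1))"
    using assms(1) by (simp add: divide_le_eq mult.commute)
  also have "\<dots> \<longleftrightarrow> D div 2 \<le> n * (m - 1)"
    by (rule of_nat_le_iff)
  also have "\<dots> \<longleftrightarrow> D \<le> 2 * (n * (m - 1) + 1) - 1"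
  proof -
    have "D div 2 \<le> k \<longleftrightarrow> D \<le> 2 * (k + 1) - 1" for k by presburger
    then show ?thesis .
  qed
  finally show ?thesis unfolding fl using assms(2) by linarith
qed

lemma rank_formula:
  assumes P: "\<And>m. 1 \<le> m \<Longrightarrow> P m \<longleftrightarrow> covering_dim_le K (2 * (n * (m - 1) + 1) - 1)" and n: "1 \<le> n"
  shows "Inf {enat m | m. 1 \<le> m \<and> P m} =
    (case covering_dim K of enat D \<Rightarrow> enat (nat \<lceil>real_of_int \<lfloor>real D / 2\<rfloor> / real n\<rceil> + 1) | \<infinity> \<Rightarrow> \<infinity>)"
proof (cases rule: covering_dim_cases[of K])
  case infinite
  have empty: "{enat m | m. 1 \<le> m \<and> P m} = {}" using P infinite(2) by auto
  show ?thesis unfolding empty by (simp add: infinite(1) top_enat_def)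
next
  case (finite D)
  have "Inf {enat m | m. 1 \<le> m \<and> P m} = enat (nat \<lceil>real_of_int \<lfloor>real D / 2\<rfloor> / real n\<rceil> + 1)"
  proof (rule Inf_enat_threshold)
    show "P m \<longleftrightarrow> nat \<lceil>real_of_int \<lfloor>real D / 2\<rfloor> / real n\<rceil> + 1 \<le> m" if "1 \<le> m" for m
      using P[OF that] finite(2) threshold_arith[OF n that, of D] by simp
  qed simp
  then show ?thesis by (simp add: finite(1))
qed

theorem theoremB:
  fixes K :: "'k topology"
    and \<rho> :: "'k metric"
    and \<Gamma> :: "'g set"
    and e :: "nat \<Rightarrow> 'g"
    and d :: "'g \<Rightarrow> 'a::complex_banach"
    and \<kappa> :: "'g \<Rightarrow> 'k"
    and \<Psi> :: "('k \<Rightarrow> complex) \<Rightarrow> ('a \<Rightarrow>\<^sub>L 'a) set"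
  assumes "compact_space K" and "metrizable_space K" and "topspace K \<noteq> {}"
    and "motakis_realisation K \<rho> \<Gamma> e d \<kappa> \<Psi>"
  shows
    "(let r = (case covering_dim K of
                 enat D \<Rightarrow> enat (nat \<lceil>real_of_int \<lfloor>real D / 2\<rfloor> / real CARD('n)\<rceil> + 1)
               | \<infinity> \<Rightarrow> \<infinity>)
      in ltsr (bounded_ops TYPE('a ^ 'n::finite)) = r \<and>
         rtsr (bounded_ops TYPE('a ^ 'n)) = r)
     \<and> ltsr (bounded_ops TYPE('a)) = tsr (cont_algebra K)
     \<and> rtsr (bounded_ops TYPE('a)) = tsr (cont_algebra K)
     \<and> (stable_rank_one (bounded_ops TYPE('a)) \<longleftrightarrow> covering_dim K \<le> 1)"
proof -
  have K: "mtopology_of \<rho> = K"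
    using assms(4) by (rule motakis_realisation.metric)
  interpret compact_motakis K \<rho> \<Gamma> e d \<kappa> \<Psi>
    using assms(1,3,4) by (intro compact_motakis.intro compact_metric.intro) (auto simp flip: K)
  have left: "left_dense TYPE('a) m \<longleftrightarrow> covering_dim_le K (2 * m - 1)" if "1 \<le> m" for m
    using covering_dim_le_if_left_dense[of m] left_dense_if_covering_dim_le[of m] that by (auto simp: K)
  have right: "right_dense TYPE('a) m \<longleftrightarrow> covering_dim_le K (2 * m - 1)" if "1 \<le> m" for m
    using covering_dim_le_if_right_dense[of m] right_dense_if_covering_dim_le[of m] that by (auto simp: K)
  have CK: "dense_tuples (cont_algebra K) m (Lg (cont_algebra K) m) \<longleftrightarrow> covering_dim_le K (2 * m - 1)"
    if "1 \<le> m" for m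
    using dense_Lg_CK_iff[OF that] by (simp add: K)
  define r where "r n = (case covering_dim K of
      enat D \<Rightarrow> enat (nat \<lceil>real_of_int \<lfloor>real D / 2\<rfloor> / real n\<rceil> + 1) | \<infinity> \<Rightarrow> \<infinity>)" for n :: nat
  have one: "2 * (1 * (m - 1) + 1) - 1 = 2 * m - 1" if "1 \<le> m" for m :: nat
    using that by simp
  have n: "1 \<le> CARD('n)" by (simp add: Suc_le_eq)
  have ltsr_n: "ltsr (bounded_ops TYPE('a ^ 'n)) = r (CARD('n))"
    unfolding ltsr_def r_def dense_Lg_iff_left_invertibles
  proof (rule rank_formula[OF _ n])
    fix m :: nat assume "1 \<le> m"
    then show "left_dense TYPE('a ^ 'n) m \<longleftrightarrow> covering_dim_le K (2 * (CARD('n) * (m - 1) + 1) - 1)"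
      by (intro trans[OF left_invertibles_dense_vec(1) left]) auto
  qed
  have rtsr_n: "rtsr (bounded_ops TYPE('a ^ 'n)) = r (CARD('n))"
    unfolding rtsr_def r_def dense_Rg_iff_left_invertibles
  proof (rule rank_formula[OF _ n])
    fix m :: nat assume "1 \<le> m"
    then show "right_dense TYPE('a ^ 'n) m \<longleftrightarrow> covering_dim_le K (2 * (CARD('n) * (m - 1) + 1) - 1)"
      by (intro trans[OF left_invertibles_dense_vec(2) right]) auto
  qed
  have ltsr_1: "ltsr (bounded_ops TYPE('a)) = r 1"
    unfolding ltsr_def r_def dense_Lg_iff_left_invertibles
    by (rule rank_formula) (simp_all only: one left order_refl)
  have rtsr_1: "rtsr (bounded_ops TYPE('a)) = r 1"
    unfolding rtsr_def r_def dense_Rg_iff_left_invertibles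
    by (rule rank_formula) (simp_all only: one right order_refl)
  have tsr_1: "tsr (cont_algebra K) = r 1"
    unfolding tsr_cont_algebra unfolding ltsr_def r_def
    by (rule rank_formula) (simp_all only: one CK order_refl)
  have "r 1 = 1 \<longleftrightarrow> covering_dim K \<le> 1"
  proof (cases "covering_dim K")
    case (enat D)
    have "r 1 = 1 \<longleftrightarrow> \<lfloor>real D / 2\<rfloor> \<le> 0"
      by (simp add: r_def enat one_enat_def)
    also have "\<dots> \<longleftrightarrow> D \<le> 1" by (simp add: floor_le_iff) linarith
    finally show ?thesis by (simp add: enat one_enat_def)
  qed (simp add: r_def one_enat_def)
  then show ?thesis
    using ltsr_n rtsr_n ltsr_1 rtsr_1 tsr_1
    by (simp add: Let_def stable_rank_one_def flip: r_def)
qed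

end
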